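(* Let $n\ge1$ and let $\iota:\prod_{i=1}^n M(\mathbb R(x_i))\to M(\mathbb R(x_1,\dots,x_n))$ be a compatible embedding. Then the image of $\iota$ is dense in $M(\mathbb R(x_1,\dots,x_n))$. Moreover, if $n>1$, then every non-empty basic open subset of $M(\mathbb R(x_1,\dots,x_n))$ contains infinitely many places that are not in the image of $\iota$.
   Context: $x_1,\dots,x_n$ are algebraically independent over $\mathbb R$. For a field $K$, $M(K)$ is the set of $\mathbb R$-places $K\to\mathbb R\cup\{\infty\}$, with topology generated by the subbasis $H'(b)=\{\zeta\in M(K)\mid \infty\ne\zeta(b)>0\}$, $b\in K$; basic open sets are finite intersections $H'(f_1)\cap\dots\cap H'(f_m)$ with $f_j$ nonzero. Let $\rho:M(\mathbb R(x_1,\dots,x_n))\to\prod_{i=1}^nM(\mathbb R(x_i))$, $\xi\mapsto(\xi|_{\mathbb R(x_1)},\dots,\xi|_{\mathbb R(x_n)})$. A compatible embedding is an injective map $\iota$ from $\prod_i M(\mathbb R(x_i))$ to $M(\mathbb R(x_1,\dots,x_n))$ with $\rho\circ\iota=\mathrm{id}$ (no continuity assumed). *)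

theory Defs
  imports "HOL-Analysis.Analysis"
begin

text \<open>Values in R \<union> {\<infinity>} are modelled as real option: None = \<infinity>, Some r = r.
The ambient field is a type 'k of class real_field (so it contains R via of_real);
subfields are subsets of 'k.\<close>

definition is_subfield :: "'k::field set \<Rightarrow> bool" where
  "is_subfield S \<longleftrightarrow> 0 \<in> S \<and> 1 \<in> S \<and>
     (\<forall>a\<in>S. \<forall>b\<in>S. a + b \<in> S \<and> a * b \<in> S) \<and>
     (\<forall>a\<in>S. - a \<in> S \<and> inverse a \<in> S)"

definition gen_field :: "'k::field set \<Rightarrow> 'k set" where
  "gen_field A = \<Inter> {S. is_subfield S \<and> A \<subseteq> S}"

definition alg_indep :: "('n::finite \<Rightarrow> 'k::real_field) \<Rightarrow> bool" where
  "alg_indep x \<longleftrightarrow>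
     (\<forall>E :: ('n \<Rightarrow> nat) set. \<forall>c :: ('n \<Rightarrow> nat) \<Rightarrow> real. finite E \<longrightarrow>
        (\<Sum>e\<in>E. of_real (c e) * (\<Prod>i\<in>UNIV. x i ^ e i)) = 0 \<longrightarrow> (\<forall>e\<in>E. c e = 0))"

text \<open>A place of the field F (a subfield of 'k) into R \<union> {\<infinity>}:
the finite part O = {a. \<zeta> a \<noteq> \<infinity>} is a subring on which \<zeta> is a ring homomorphism
into R, and for a \<notin> O we have \<zeta>(a\<inverse>) = 0 (so O is a valuation ring
and \<zeta> has the maximal ideal of O as kernel).\<close>
definition is_place :: "'k::field set \<Rightarrow> ('k \<Rightarrow> real option) \<Rightarrow> bool" where
  "is_place F \<zeta> \<longleftrightarrow>
     \<zeta> 0 = Some 0 \<and> \<zeta> 1 = Some 1 \<and>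
     (\<forall>a\<in>F. \<forall>b\<in>F. \<zeta> a \<noteq> None \<and> \<zeta> b \<noteq> None \<longrightarrow>
         \<zeta> (a + b) = Some (the (\<zeta> a) + the (\<zeta> b)) \<and>
         \<zeta> (a * b) = Some (the (\<zeta> a) * the (\<zeta> b))) \<and>
     (\<forall>a\<in>F. \<zeta> a \<noteq> None \<longrightarrow> \<zeta> (- a) = Some (- the (\<zeta> a))) \<and>
     (\<forall>a\<in>F. \<zeta> a = None \<longrightarrow> \<zeta> (inverse a) = Some 0)"

text \<open>M(F): the R-places of F; as a normalisation, places are extended by \<infinity> outside F.\<close>
definition Mset :: "'k::field set \<Rightarrow> ('k \<Rightarrow> real option) set" where
  "Mset F = {\<zeta>. is_place F \<zeta> \<and> (\<forall>a. a \<notin> F \<longrightarrow> \<zeta> a = None)}"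

definition restr_place :: "'k set \<Rightarrow> ('k \<Rightarrow> real option) \<Rightarrow> ('k \<Rightarrow> real option)" where
  "restr_place F \<xi> = (\<lambda>a. if a \<in> F then \<xi> a else None)"

definition Hsub :: "'k::field set \<Rightarrow> 'k \<Rightarrow> ('k \<Rightarrow> real option) set" where
  "Hsub F b = {\<zeta> \<in> Mset F. \<zeta> b \<noteq> None \<and> the (\<zeta> b) > 0}"

definition Mtop :: "'k::field set \<Rightarrow> ('k \<Rightarrow> real option) topology" where
  "Mtop F = subtopology (topology_generated_by {Hsub F b | b. b \<in> F}) (Mset F)"

definition basic_open :: "'k::field set \<Rightarrow> 'k set \<Rightarrow> ('k \<Rightarrow> real option) set" where
  "basic_open F fs = {\<zeta> \<in> Mset F. \<forall>f\<in>fs. \<zeta> \<in> Hsub F f}"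

definition Rx :: "('n \<Rightarrow> 'k::real_field) \<Rightarrow> 'n \<Rightarrow> 'k set" where
  "Rx x i = gen_field (range of_real \<union> {x i})"

definition ProdM :: "('n \<Rightarrow> 'k::real_field) \<Rightarrow> ('n \<Rightarrow> 'k \<Rightarrow> real option) set" where
  "ProdM x = Pi UNIV (\<lambda>i. Mset (Rx x i))"

definition rho :: "('n \<Rightarrow> 'k::real_field) \<Rightarrow> ('k \<Rightarrow> real option) \<Rightarrow> ('n \<Rightarrow> 'k \<Rightarrow> real option)" where
  "rho x \<xi> = (\<lambda>i. restr_place (Rx x i) \<xi>)"

definition compatible_embedding ::
  "('n \<Rightarrow> 'k::real_field) \<Rightarrow> (('n \<Rightarrow> 'k \<Rightarrow> real option) \<Rightarrow> ('k \<Rightarrow> real option)) \<Rightarrow> bool" where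
  "compatible_embedding x \<iota> \<longleftrightarrow>
     \<iota> ` ProdM x \<subseteq> Mset (UNIV :: 'k set) \<and> inj_on \<iota> (ProdM x) \<and>
     (\<forall>p\<in>ProdM x. rho x (\<iota> p) = p)"

end

theory Submission
  imports Defs "HOL-Algebra.Algebraic_Closure_Type"
begin

hide_const (open) UnivPoly.coeff UnivPoly.monom Polynomials.degree Polynomials.lead_coeff Coset.order
  Module.module.smult Divisibility.prime

text \<open>A place \<open>\<zeta>\<close> determines the cone \<open>{g\<^sup>2 u | \<zeta>(u) > 0}\<close>, which is closed under sums because one may
  divide by the dominating \<open>g\<close>.  The cone extends to an ordering with a real closed field \<open>L\<close> above it
  (Zorn's lemma inside the algebraic closure), and in \<open>L\<close> the point \<open>x\<close> satisfies \<open>f > 0\<close> for every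
  \<open>f\<close> with \<open>\<zeta>(f) > 0\<close>.  Sign conditions transfer from \<open>L\<close> to the reals, one variable at a time, by
  comparing sign tables of families of polynomials closed under derivatives and pseudo-remainders.
  So a non-empty basic open set determined by \<open>f\<^sub>1, \<dots>, f\<^sub>m\<close> yields a real point \<open>b\<close> at which
  all \<open>f\<^sub>j\<close> are defined and positive, and then it contains every place centred at \<open>b\<close>.  The image of \<open>\<iota>\<close>
  contains such a place, since \<open>\<rho> \<circ> \<iota> = id\<close>; this is density.  A place of \<open>\<real>(x\<^sub>i)\<close> centred at
  \<open>b\<^sub>i\<close> is unique, so all places centred at \<open>b\<close> have the same image under \<open>\<rho>\<close> and at most one of them is
  in the image of \<open>\<iota>\<close>; for \<open>n > 1\<close> there is one for every slope \<open>c = (x\<^sub>j - b\<^sub>j) / (x\<^sub>k - b\<^sub>k)\<close>, obtained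
  as a limit along a curve.\<close>

subsection \<open>Real closed fields\<close>

text \<open>The given place \<open>\<zeta>\<close> cannot supply the point \<open>b\<close>
  directly: it may send some \<open>x i\<close> to infinity, or the denominators of the
  \<open>f\<^sub>j\<close> may vanish at its centre. Positivity therefore has to pass through an
  ordering, as in the Artin-Lang theorem, and this is what calls for a real closed field and a
  transfer principle. Such a field need be neither archimedean nor complete, so the only analytic
  axiom is the intermediate value property for polynomials; Rolle, monotonicity and the behaviour at
  infinity are derived from it algebraically. One maximality argument inside the algebraic closure
  yields both the total ordering and real closedness. A limit along an arbitrary curve may fail to
  exist. The rates of decay along the curve have to separate all monomials, and the slope is then
  produced by an affine change of coordinates. Algebraic independence enters here: the value of a
  field element along the curve must not depend on the fraction chosen to represent it.\<close>

class rcf = linordered_field +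
  assumes sum_IVT: "a < b \<Longrightarrow> (\<Sum>k\<le>n. f k * a ^ k) < 0 \<Longrightarrow> (\<Sum>k\<le>n. f k * b ^ k) > 0 \<Longrightarrow>
    \<exists>c. a < c \<and> c < b \<and> (\<Sum>k\<le>n. f k * c ^ k) = 0"

instance real :: rcf
proof
  fix a b :: real and f :: "nat \<Rightarrow> real" and n
  assume *: "a < b" "(\<Sum>k\<le>n. f k * a ^ k) < 0" "(\<Sum>k\<le>n. f k * b ^ k) > 0"
  have "continuous_on {a..b} (\<lambda>x. \<Sum>k\<le>n. f k * x ^ k)"
    by (intro continuous_intros)
  then obtain c where "a \<le> c" "c \<le> b" "(\<Sum>k\<le>n. f k * c ^ k) = 0"
    using IVT'[of "\<lambda>x. \<Sum>k\<le>n. f k * x ^ k" a 0 b] * by auto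
  moreover from this * have "c \<noteq> a" "c \<noteq> b" by auto
  ultimately show "\<exists>c. a < c \<and> c < b \<and> (\<Sum>k\<le>n. f k * c ^ k) = 0"
    by (intro exI[of _ c]) auto
qed

lemma rcf_IVT:
  fixes p :: "'a::rcf poly"
  assumes "a < b" "poly p a * poly p b < 0"
  shows "\<exists>c. a < c \<and> c < b \<and> poly p c = 0"
proof (cases "poly p a < 0")
  case True
  then show ?thesis
    using sum_IVT[of a b "coeff p" "degree p"] assms
    by (auto simp: poly_altdef mult_less_0_iff)
next
  case False
  then have "poly (-p) a < 0" "poly (-p) b > 0" using assms(2) by (auto simp: mult_less_0_iff)
  then show ?thesis
    using sum_IVT[of a b "coeff (-p)" "degree (-p)"] assms(1)
    unfolding poly_altdef[symmetric] by auto
qed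

text \<open>Passing to the first root \<open>b'\<close> after \<open>a\<close> and splitting off all
  multiplicities leaves a factor \<open>g\<close> that cannot change sign between \<open>a\<close>
  and \<open>b'\<close>. The part of the derivative that survives cancellation then has opposite
  signs at the two ends.\<close>

lemma rcf_Rolle:
  fixes p :: "'a::rcf poly"
  assumes ab: "a < b" and roots: "poly p a = 0" "poly p b = 0"
  shows "\<exists>c. a < c \<and> c < b \<and> poly (pderiv p) c = 0"
proof (cases "p = 0")
  case True
  then show ?thesis using dense[OF ab] by auto
next
  case False
  define B where "B = {t. poly p t = 0 \<and> a < t}"
  have fB: "finite B" unfolding B_def using poly_roots_finite[OF False] by simp
  have bB: "b \<in> B" using assms by (simp add: B_def)
  define b' where "b' = Min B"
  have b': "b' \<in> B" "b' \<le> b" "\<And>t. t \<in> B \<Longrightarrow> b' \<le> t"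
    using fB bB Min_in[OF fB] unfolding b'_def by (blast, auto)
  then have ab': "a < b'" "poly p b' = 0" by (auto simp: B_def)
  have noroot: "poly p t \<noteq> 0" if "a < t" "t < b'" for t
    using that b'(3)[of t] by (auto simp: B_def)
  define m where "m = order a p"
  obtain q where q: "p = [:-a,1:] ^ m * q" "\<not> [:-a,1:] dvd q"
    using order_decomp[OF False, of a] by (auto simp: m_def)
  have q0: "q \<noteq> 0" using q(2) by auto
  define n where "n = order b' q"
  obtain g where g: "q = [:-b',1:] ^ n * g" "\<not> [:-b',1:] dvd g"
    using order_decomp[OF q0, of b'] by (auto simp: n_def)
  have qa: "poly q a \<noteq> 0" using q(2) by (simp add: poly_eq_0_iff_dvd)
  have gb: "poly g b' \<noteq> 0" using g(2) by (simp add: poly_eq_0_iff_dvd)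
  have ga: "poly g a \<noteq> 0" using qa g(1) by auto
  have "m \<noteq> 0" using False roots(1) by (simp add: m_def order_root)
  then obtain m' where m: "m = Suc m'" using not0_implies_Suc by blast
  have "poly q b' = 0" using ab' q(1) by auto
  then have "n \<noteq> 0" using q0 by (simp add: n_def order_root)
  then obtain n' where n: "n = Suc n'" using not0_implies_Suc by blast
  \<comment> \<open>This is the derivative divided by the powers of both linear factors, each of
    exponent one less than in \<open>p\<close>. At each end only one summand survives, which gives
    \<open>ra\<close> and \<open>rb\<close>; their first factors differ in sign.\<close>
  define r where "r = (smult (of_nat m) [:-b',1:] + smult (of_nat n) [:-a,1:]) * g
     + [:-a,1:] * [:-b',1:] * pderiv g"
  have pd: "pderiv p = [:-a,1:] ^ m' * [:-b',1:] ^ n' * r"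
  proof -
    have "pderiv (A ^ m * (B ^ n * g)) =
        A ^ m' * B ^ n' * ((smult (of_nat m) B + smult (of_nat n) A) * g + A * B * pderiv g)"
      if "pderiv A = 1" "pderiv B = 1" for A B :: "'a poly"
      unfolding m n
      by (simp add: pderiv_mult pderiv_power_Suc that del: power_Suc of_nat_Suc)
         (simp add: algebra_simps)
    from this[of "[:-a,1:]" "[:-b',1:]"] show ?thesis
      unfolding q(1) g(1) r_def by (simp add: pderiv_pCons)
  qed
  have gab: "poly g a * poly g b' > 0"
  proof (rule ccontr)
    assume "\<not> ?thesis"
    then have "poly g a * poly g b' < 0" using ga gb by (metis mult_eq_0_iff not_less_iff_gr_or_eq)
    then obtain c where "a < c" "c < b'" "poly g c = 0" using rcf_IVT ab' by blast
    then show False using noroot[of c] q(1) g(1) by auto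
  qed
  have ra: "poly r a = of_nat m * (a - b') * poly g a" by (simp add: r_def algebra_simps)
  have rb: "poly r b' = of_nat n * (b' - a) * poly g b'" by (simp add: r_def algebra_simps)
  have "poly r a * poly r b' = - (of_nat m * of_nat n * ((b' - a) * (b' - a)) * (poly g a * poly g b'))"
    unfolding ra rb by (simp add: algebra_simps)
  also have "\<dots> < 0" using ab' gab m n by (simp add: mult_pos_pos del: of_nat_Suc)
  finally obtain c where "a < c" "c < b'" "poly r c = 0" using rcf_IVT ab' by blast
  then show ?thesis using pd b'(2) by (intro exI[of _ c]) auto
qed

text \<open>The mean value theorem: Rolle is applied to \<open>p\<close> minus its chord, so the
  derivative takes the slope \<open>k\<close> of the chord at some point in between.\<close>

lemma rcf_increasing:
  fixes p :: "'a::rcf poly"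
  assumes ab: "a < b" and pos: "\<And>c. a < c \<Longrightarrow> c < b \<Longrightarrow> poly (pderiv p) c > 0"
  shows "poly p a < poly p b"
proof -
  define k where "k = (poly p b - poly p a) / (b - a)"
  have k: "k * (b - a) = poly p b - poly p a" using ab by (simp add: k_def)
  define q where "q = p - [:poly p a - k * a, k:]"
  have "poly q a = 0" "poly q b = 0"
    using k by (auto simp: q_def algebra_simps)
  then obtain c where c: "a < c" "c < b" "poly (pderiv q) c = 0" using rcf_Rolle ab by blast
  have "pderiv q = pderiv p - [:k:]" by (simp add: q_def pderiv_diff pderiv_pCons)
  then have "k > 0" using c pos[of c] by simp
  then have "k * (b - a) > 0" using ab by simp
  then show ?thesis using k by simp
qed

section \<open>Signs of polynomials at plus and minus infinity\<close>

lemma poly_ge_lead_coeff_at_top: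
  fixes p :: "'a::linordered_field poly"
  assumes "lead_coeff p > 0"
  shows "\<exists>M. \<forall>x\<ge>M. poly p x \<ge> lead_coeff p"
  using assms
proof (induction p)
  case 0
  then show ?case by simp
next
  case (pCons a p)
  show ?case
  proof (cases "p = 0")
    case False
    then have lc: "lead_coeff p > 0" using pCons by simp
    then obtain M where M: "\<forall>x\<ge>M. poly p x \<ge> lead_coeff p" using pCons by auto
    \<comment> \<open>Beyond this bound \<open>x * lead_coeff p\<close> is at least
      \<open>lead_coeff p\<close> plus the absolute value of the constant term, so the bound of the
      induction hypothesis survives the Horner step.\<close>
    define N where "N = max M (1 + \<bar>a\<bar> / lead_coeff p)"
    have "poly (pCons a p) x \<ge> lead_coeff p" if "x \<ge> N" for x
    proof -
      have x: "x \<ge> M" "x \<ge> 1 + \<bar>a\<bar> / lead_coeff p" using that by (auto simp: N_def)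
      have "(1 + \<bar>a\<bar> / lead_coeff p) * lead_coeff p \<le> x * lead_coeff p"
        using x lc by (intro mult_right_mono) auto
      then have "lead_coeff p + \<bar>a\<bar> \<le> x * lead_coeff p"
        using lc False by (simp add: distrib_right)
      also have "\<dots> \<le> x * poly p x" using M x lc
        by (intro mult_left_mono) (auto intro: order_trans[OF _ x(2)])
      finally show ?thesis by (simp add: abs_if split: if_splits)
    qed
    then show ?thesis using False by auto
  qed auto
qed

text \<open>The sign is an integer so that signs in two different fields can be equated.\<close>

definition sg :: "'a::linordered_idom \<Rightarrow> int" where
  "sg x = (if x > 0 then 1 else if x < 0 then -1 else 0)"

lemma sg_simps [simp]: "sg x = 1 \<longleftrightarrow> x > 0" "sg x = -1 \<longleftrightarrow> x < 0" "sg x = 0 \<longleftrightarrow> x = 0"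
  "sg 0 = 0" "sg 1 = 1"
  by (auto simp: sg_def)

lemma sg_minus [simp]: "sg (- x) = - sg x"
  by (auto simp: sg_def)

lemma sg_mult: "sg (x * y) = sg x * sg y"
  by (auto simp: sg_def zero_less_mult_iff mult_less_0_iff)

lemma sg_eqD:
  assumes "sg x = sg y"
  shows "x > 0 \<longleftrightarrow> y > 0" "x < 0 \<longleftrightarrow> y < 0" "x = 0 \<longleftrightarrow> y = 0"
  using assms by (auto simp: sg_def split: if_splits)

lemma sg_eqI:
  assumes "x > 0 \<longleftrightarrow> y > 0" "x < 0 \<longleftrightarrow> y < 0"
  shows "sg x = sg y"
  using assms by (auto simp: sg_def)

lemma sg_at_top:
  fixes p :: "'a::linordered_field poly"
  assumes "p \<noteq> 0"
  shows "\<exists>M. \<forall>x\<ge>M. sg (poly p x) = sg (lead_coeff p)"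
proof (cases "lead_coeff p > 0")
  case True
  then obtain M where "\<forall>x\<ge>M. poly p x \<ge> lead_coeff p"
    using poly_ge_lead_coeff_at_top by blast
  then show ?thesis using True by (intro exI[of _ M]) (force simp: sg_def)
next
  case False
  then have *: "lead_coeff (-p) > 0" using assms by (auto simp: not_less_iff_gr_or_eq)
  then obtain M where "\<forall>x\<ge>M. poly (-p) x \<ge> lead_coeff (-p)"
    using poly_ge_lead_coeff_at_top by blast
  then show ?thesis using * by (intro exI[of _ M]) (force simp: sg_def)
qed

lemma sg_at_bot:
  fixes p :: "'a::linordered_field poly"
  assumes "p \<noteq> 0"
  shows "\<exists>M. \<forall>x\<le>M. sg (poly p x) = sg (lead_coeff p) * (-1) ^ degree p"
proof -
  let ?q = "pcompose p [:0, -1:]"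
  have "?q \<noteq> 0" using assms pcompose_eq_0[of p "[:0,-1:]"] by auto
  then obtain M where M: "\<forall>x\<ge>M. sg (poly ?q x) = sg (lead_coeff ?q)" using sg_at_top by blast
  have lc: "lead_coeff ?q = lead_coeff p * (-1) ^ degree p"
    by (subst lead_coeff_comp) auto
  have s: "sg ((-1) ^ k :: 'a) = (-1) ^ k" for k
    by (induction k) (auto simp: sg_mult)
  have "sg (poly p x) = sg (lead_coeff p) * (-1) ^ degree p" if "x \<le> - M" for x
    using M[rule_format, of "-x"] that unfolding lc by (simp add: poly_pcompose sg_mult s)
  then show ?thesis by blast
qed

subsection \<open>Sign tables\<close>

text \<open>A table is an order isomorphism between finite sets of roots on the two sides, given as
  its graph \<open>R\<close>; \<open>cell R y z\<close> says that \<open>y\<close> and \<open>z\<close> lie at or between corresponding roots.\<close>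

definition cell :: "('a::linordered_idom \<times> 'b::linordered_idom) set \<Rightarrow> 'a \<Rightarrow> 'b \<Rightarrow> bool" where
  "cell R y z \<longleftrightarrow> (\<forall>(t,s)\<in>R. sg (y - t) = sg (z - s))"

definition order_iso :: "('a::linordered_idom \<times> 'b::linordered_idom) set \<Rightarrow> bool" where
  "order_iso R \<longleftrightarrow> finite R \<and> (\<forall>(t,s)\<in>R. cell R t s)"

lemma cellD:
  assumes "cell R y z" "(t,s) \<in> R"
  shows "t < y \<longleftrightarrow> s < z" "y < t \<longleftrightarrow> z < s" "y = t \<longleftrightarrow> z = s"
proof -
  have "sg (y - t) = sg (z - s)" using assms by (auto simp: cell_def)
  from sg_eqD[OF this] show "t < y \<longleftrightarrow> s < z" "y < t \<longleftrightarrow> z < s" "y = t \<longleftrightarrow> z = s" by auto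
qed

lemma cellI:
  assumes "\<And>t s. (t,s) \<in> R \<Longrightarrow> (t < y \<longleftrightarrow> s < z) \<and> (y < t \<longleftrightarrow> z < s)"
  shows "cell R y z"
  unfolding cell_def
proof clarify
  fix t s assume "(t,s) \<in> R"
  from assms[OF this] show "sg (y - t) = sg (z - s)" by (intro sg_eqI) auto
qed

text \<open>Each hypothesis equates two sign vectors relative to the roots, and the chain
  \<open>t\<close>, \<open>z\<close>, \<open>y\<close>, \<open>s\<close> composes.\<close>

lemma cell_exchange:
  assumes "cell R t z" "cell R y z" "cell R y s"
  shows "cell R t s"
  using assms unfolding cell_def by force

lemma order_isoD:
  assumes "order_iso R" "(t,s) \<in> R" "(t',s') \<in> R"
  shows "t < t' \<longleftrightarrow> s < s'" "t = t' \<longleftrightarrow> s = s'"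
  using assms cellD[of R t s t' s'] unfolding order_iso_def by auto

lemma cell_converse: "cell (R\<inverse>) z y \<longleftrightarrow> cell R y z"
  unfolding cell_def by force

lemma order_iso_converse: "order_iso R \<Longrightarrow> order_iso (R\<inverse>)"
  by (auto simp: order_iso_def cell_converse)

text \<open>The roots below and above \<open>y\<close> correspond to finite sets \<open>A\<close>
  and \<open>B\<close> with \<open>A\<close> below \<open>B\<close>. An ordered field is dense and
  unbounded, so some point separates them; if \<open>y\<close> is itself a root, its partner
  serves.\<close>

lemma ex_cell:
  fixes R :: "('a::linordered_idom \<times> 'b::linordered_field) set"
  assumes "order_iso R"
  shows "\<exists>z. cell R y z"
proof (cases "y \<in> fst ` R")
  case True
  then show ?thesis using assms unfolding order_iso_def by force
next
  case False
  have fin: "finite R" using assms by (simp add: order_iso_def)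
  define A where "A = snd ` {p\<in>R. fst p < y}"
  define B where "B = snd ` {p\<in>R. y < fst p}"
  have AB: "finite A" "finite B" using fin by (auto simp: A_def B_def)
  have less: "a < b" if "a \<in> A" "b \<in> B" for a b
    using that order_isoD(1)[OF assms] unfolding A_def B_def by force
  have "\<exists>z. (\<forall>a\<in>A. a < z) \<and> (\<forall>b\<in>B. z < b)"
  proof (cases "A = {}")
    case A: True
    show ?thesis
    proof (cases "B = {}")
      case False
      then show ?thesis using A AB Min_le[OF AB(2)]
        by (intro exI[of _ "Min B - 1"]) (auto intro: less_le_trans[of _ "Min B"])
    qed (use A in auto)
  next
    case A: False
    show ?thesis
    proof (cases "B = {}")
      case True
      then show ?thesis using A AB Max_ge[OF AB(1)]
        by (intro exI[of _ "Max A + 1"]) (auto intro: le_less_trans[of _ "Max A"])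
    next
      case False
      then have "Max A < Min B" using A AB less by auto
      then obtain z where "Max A < z" "z < Min B" using dense by blast
      then show ?thesis using A False AB by auto
    qed
  qed
  then obtain z where z: "\<And>a. a \<in> A \<Longrightarrow> a < z" "\<And>b. b \<in> B \<Longrightarrow> z < b" by blast
  have "cell R y z"
  proof (rule cellI)
    fix t s assume ts: "(t,s) \<in> R"
    then have "t \<noteq> y" using False by force
    then consider "t < y" "s < z" | "y < t" "z < s"
      using z ts unfolding A_def B_def by (metis (mono_tags, lifting) fst_conv image_eqI mem_Collect_eq neq_iff snd_conv)
    then show "(t < y \<longleftrightarrow> s < z) \<and> (y < t \<longleftrightarrow> z < s)" by cases auto
  qed
  then show ?thesis by blast
qed

text \<open>The situation in which the roots of \<open>f\<close> and \<open>g\<close> can be added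
  to \<open>R\<close>. All critical points already belong to \<open>R\<close>, so both polynomials
  are strictly monotone on open cells; the signs at the roots in \<open>R\<close>, together with
  degree and leading coefficient for the unbounded cells, then decide whether a cell contains a new
  root.\<close>

definition extendable :: "('a::rcf \<times> 'b::rcf) set \<Rightarrow> 'a poly \<Rightarrow> 'b poly \<Rightarrow> bool" where
  "extendable R f g \<longleftrightarrow> order_iso R \<and> degree f > 0 \<and> degree f = degree g \<and>
     sg (lead_coeff f) = sg (lead_coeff g) \<and>
     (\<forall>y z. cell R y z \<longrightarrow> sg (poly (pderiv f) y) = sg (poly (pderiv g) z)) \<and>
     (\<forall>y. poly (pderiv f) y = 0 \<longrightarrow> y \<in> fst ` R) \<and>
     (\<forall>z. poly (pderiv g) z = 0 \<longrightarrow> z \<in> snd ` R) \<and>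
     (\<forall>(t,s)\<in>R. sg (poly f t) = sg (poly g s))"

lemma extendable_converse:
  assumes "extendable R f g"
  shows "extendable (R\<inverse>) g f"
proof -
  have "fst ` (R\<inverse>) = snd ` R" "snd ` (R\<inverse>) = fst ` R" by force+
  then show ?thesis
    using assms unfolding extendable_def
    by (auto simp: cell_converse order_iso_converse split: prod.splits)
qed

lemma extendable_minus:
  assumes "extendable R f g"
  shows "extendable R (-f) (-g)"
  using assms unfolding extendable_def
  by (auto simp: pderiv_minus)

lemma cell_outside:
  assumes "cell R y z"
  shows "y \<notin> fst ` R \<longleftrightarrow> z \<notin> snd ` R"
  using cellD(3)[OF assms] by (auto simp: image_iff) force+

text \<open>The pair \<open>u\<close>, \<open>u'\<close> is the upper end of the open cell: the next
  pair of \<open>R\<close> or, above the last root, points so far out that the leading coefficients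
  dictate the signs. Moving either point up to this end does not leave the cell.\<close>

lemma cell_upper:
  assumes ext: "extendable R f g" and c: "cell R y z" and y: "y \<notin> fst ` R"
  shows "\<exists>u u'. y < u \<and> z < u' \<and> sg (poly f u) = sg (poly g u') \<and>
    (\<forall>w. y \<le> w \<and> w < u \<longrightarrow> cell R w z) \<and> (\<forall>w. z \<le> w \<and> w < u' \<longrightarrow> cell R y w)"
proof -
  have iso: "order_iso R" using ext by (simp add: extendable_def)
  then have fin: "finite R" by (simp add: order_iso_def)
  define B where "B = {t \<in> fst ` R. y < t}"
  have fB: "finite B" using fin by (simp add: B_def)
  have ne: "t \<noteq> y" "s \<noteq> z" if "(t,s) \<in> R" for t s
    using that y cellD(3)[OF c that] image_eqI[of t fst "(t,s)" R] by auto
  show ?thesis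
  proof (cases "B = {}")
    case False
    define u where "u = Min B"
    have u: "u \<in> B" "\<And>t. t \<in> B \<Longrightarrow> u \<le> t"
      using Min_in[OF fB False] Min_le[OF fB] by (auto simp: u_def)
    then obtain u' where u': "(u,u') \<in> R" by (auto simp: B_def)
    have yu: "y < u" using u by (simp add: B_def)
    have above: "u \<le> t \<and> u' \<le> s" if "(t,s) \<in> R" "y < t" for t s
    proof -
      have "u \<le> t" using u(2)[of t] that image_eqI[of t fst "(t,s)" R] by (auto simp: B_def)
      then show ?thesis using order_isoD(1)[OF iso that(1) u'] by auto
    qed
    have "cell R w z" if "y \<le> w" "w < u" for w
    proof (rule cellI)
      fix t s assume ts: "(t,s) \<in> R"
      show "(t < w \<longleftrightarrow> s < z) \<and> (w < t \<longleftrightarrow> z < s)"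
      proof (cases "y < t")
        case True
        then have "w < t" "z < s" using above[OF ts] that cellD[OF c ts] by auto
        then show ?thesis by auto
      next
        case False
        then have "t < w" "s < z" using ne[OF ts] that cellD[OF c ts] by auto
        then show ?thesis by auto
      qed
    qed
    moreover have "cell R y w" if "z \<le> w" "w < u'" for w
    proof (rule cellI)
      fix t s assume ts: "(t,s) \<in> R"
      show "(t < y \<longleftrightarrow> s < w) \<and> (y < t \<longleftrightarrow> w < s)"
      proof (cases "y < t")
        case True
        then have "y < t" "w < s" using above[OF ts] that cellD[OF c ts] by auto
        then show ?thesis by auto
      next
        case False
        then have "t < y" "s < w" using ne[OF ts] that cellD[OF c ts] by auto
        then show ?thesis by auto
      qed
    qed
    moreover have "sg (poly f u) = sg (poly g u')"
      using ext u' by (auto simp: extendable_def)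
    ultimately show ?thesis using yu cellD(2)[OF c u'] by blast
  next
    case True
    have below: "t < y \<and> s < z" if "(t,s) \<in> R" for t s
      proof -
      have "t \<notin> B" "t \<in> fst ` R" using that True image_eqI[of t fst "(t,s)" R] by auto
      then show ?thesis using ne[OF that] cellD[OF c that] by (auto simp: B_def)
    qed
    have "f \<noteq> 0" "g \<noteq> 0" using ext by (auto simp: extendable_def)
    obtain M where M: "\<forall>x\<ge>M. sg (poly f x) = sg (lead_coeff f)"
      using sg_at_top[OF \<open>f \<noteq> 0\<close>] ..
    obtain M' where M': "\<forall>x\<ge>M'. sg (poly g x) = sg (lead_coeff g)"
      using sg_at_top[OF \<open>g \<noteq> 0\<close>] ..
    define u where "u = max M (y + 1)"
    define u' where "u' = max M' (z + 1)"
    have "sg (lead_coeff f) = sg (lead_coeff g)" using ext unfolding extendable_def by blast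
    then have "sg (poly f u) = sg (poly g u')"
      using M[rule_format, of u] M'[rule_format, of u'] by (simp add: u_def u'_def)
    moreover have "y < u" "z < u'" by (auto simp: u_def u'_def less_max_iff_disj)
    moreover have "cell R w z" if "y \<le> w" for w
    proof (rule cellI)
      fix t s assume "(t,s) \<in> R"
      then have "t < w" "s < z" using below that by force+
      then show "(t < w \<longleftrightarrow> s < z) \<and> (w < t \<longleftrightarrow> z < s)" by auto
    qed
    moreover have "cell R y w" if "z \<le> w" for w
    proof (rule cellI)
      fix t s assume "(t,s) \<in> R"
      then have "t < y" "s < w" using below that by force+
      then show "(t < y \<longleftrightarrow> s < w) \<and> (y < t \<longleftrightarrow> w < s)" by auto
    qed
    ultimately show ?thesis by blast
  qed
qed

lemma cell_lower:
  assumes ext: "extendable R f g" and c: "cell R y z" and y: "y \<notin> fst ` R"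
  shows "\<exists>u u'. u < y \<and> u' < z \<and> sg (poly f u) = sg (poly g u') \<and>
    (\<forall>w. u < w \<and> w \<le> y \<longrightarrow> cell R w z) \<and> (\<forall>w. u' < w \<and> w \<le> z \<longrightarrow> cell R y w)"
proof -
  have iso: "order_iso R" using ext by (simp add: extendable_def)
  then have fin: "finite R" by (simp add: order_iso_def)
  define B where "B = {t \<in> fst ` R. t < y}"
  have fB: "finite B" using fin by (simp add: B_def)
  have ne: "t \<noteq> y" "s \<noteq> z" if "(t,s) \<in> R" for t s
    using that y cellD(3)[OF c that] image_eqI[of t fst "(t,s)" R] by auto
  show ?thesis
  proof (cases "B = {}")
    case False
    define u where "u = Max B"
    have u: "u \<in> B" "\<And>t. t \<in> B \<Longrightarrow> t \<le> u"
      using Max_in[OF fB False] Max_ge[OF fB] by (auto simp: u_def)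
    then obtain u' where u': "(u,u') \<in> R" by (auto simp: B_def)
    have yu: "u < y" using u by (simp add: B_def)
    have below: "t \<le> u \<and> s \<le> u'" if "(t,s) \<in> R" "t < y" for t s
    proof -
      have "t \<le> u" using u(2)[of t] that image_eqI[of t fst "(t,s)" R] by (auto simp: B_def)
      then show ?thesis using order_isoD(1)[OF iso u' that(1)] by auto
    qed
    have "cell R w z" if "u < w" "w \<le> y" for w
    proof (rule cellI)
      fix t s assume ts: "(t,s) \<in> R"
      show "(t < w \<longleftrightarrow> s < z) \<and> (w < t \<longleftrightarrow> z < s)"
      proof (cases "t < y")
        case True
        then have "t < w" "s < z" using below[OF ts] that cellD[OF c ts] by auto
        then show ?thesis by auto
      next
        case False
        then have "w < t" "z < s" using ne[OF ts] that cellD[OF c ts] by auto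
        then show ?thesis by auto
      qed
    qed
    moreover have "cell R y w" if "u' < w" "w \<le> z" for w
    proof (rule cellI)
      fix t s assume ts: "(t,s) \<in> R"
      show "(t < y \<longleftrightarrow> s < w) \<and> (y < t \<longleftrightarrow> w < s)"
      proof (cases "t < y")
        case True
        then have "t < y" "s < w" using below[OF ts] that cellD[OF c ts] by auto
        then show ?thesis by auto
      next
        case False
        then have "y < t" "w < s" using ne[OF ts] that cellD[OF c ts] by auto
        then show ?thesis by auto
      qed
    qed
    moreover have "sg (poly f u) = sg (poly g u')"
      using ext u' by (auto simp: extendable_def)
    ultimately show ?thesis using yu cellD(1)[OF c u'] by blast
  next
    case True
    have above: "y < t \<and> z < s" if "(t,s) \<in> R" for t s
      proof -
      have "t \<notin> B" "t \<in> fst ` R" using that True image_eqI[of t fst "(t,s)" R] by auto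
      then show ?thesis using ne[OF that] cellD[OF c that] by (auto simp: B_def)
    qed
    have "f \<noteq> 0" "g \<noteq> 0" using ext by (auto simp: extendable_def)
    obtain M where M: "\<forall>x\<le>M. sg (poly f x) = sg (lead_coeff f) * (-1) ^ degree f"
      using sg_at_bot[OF \<open>f \<noteq> 0\<close>] ..
    obtain M' where M': "\<forall>x\<le>M'. sg (poly g x) = sg (lead_coeff g) * (-1) ^ degree g"
      using sg_at_bot[OF \<open>g \<noteq> 0\<close>] ..
    define u where "u = min M (y - 1)"
    define u' where "u' = min M' (z - 1)"
    \<comment> \<open>At minus infinity the parity of the degree matters too, hence the demand for
      equal degrees in \<open>extendable\<close>.\<close>
    have "sg (lead_coeff f) * (-1) ^ degree f = sg (lead_coeff g) * (-1) ^ degree g"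
      using ext unfolding extendable_def by metis
    then have "sg (poly f u) = sg (poly g u')"
      using M[rule_format, of u] M'[rule_format, of u'] by (simp add: u_def u'_def)
    moreover have "u < y" "u' < z" by (auto simp: u_def u'_def min_less_iff_disj)
    moreover have "cell R w z" if "w \<le> y" for w
    proof (rule cellI)
      fix t s assume "(t,s) \<in> R"
      then have "w < t" "z < s" using above that by force+
      then show "(t < w \<longleftrightarrow> s < z) \<and> (w < t \<longleftrightarrow> z < s)" by auto
    qed
    moreover have "cell R y w" if "w \<le> z" for w
    proof (rule cellI)
      fix t s assume "(t,s) \<in> R"
      then have "y < t" "w < s" using above that by force+
      then show "(t < y \<longleftrightarrow> s < w) \<and> (y < t \<longleftrightarrow> w < s)" by auto
    qed
    ultimately show ?thesis by blast
  qed
qed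

text \<open>Corresponding cells pair the roots. Monotonicity leaves at most one root of each
  polynomial in an open cell, so the pairing is a matching.\<close>

definition new_roots :: "('a::rcf \<times> 'b::rcf) set \<Rightarrow> 'a poly \<Rightarrow> 'b poly \<Rightarrow> ('a \<times> 'b) set" where
  "new_roots R f g = {(y,z). poly f y = 0 \<and> poly g z = 0 \<and> cell R y z}"

lemma new_roots_converse: "new_roots (R\<inverse>) g f = (new_roots R f g)\<inverse>"
  by (auto simp: new_roots_def cell_converse)

text \<open>Rolle puts a critical point of \<open>f\<close> between the two roots; it belongs to
  \<open>R\<close>, and its partner separates \<open>z\<close> from \<open>z'\<close>.\<close>

lemma new_roots_less:
  assumes ext: "extendable R f g"
    and p: "(y,z) \<in> new_roots R f g" "(y',z') \<in> new_roots R f g" and less: "y < y'"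
  shows "z < z'"
proof -
  obtain c where c: "y < c" "c < y'" "poly (pderiv f) c = 0"
    using rcf_Rolle[OF less, of f] p by (auto simp: new_roots_def)
  then obtain s where "(c,s) \<in> R" using ext by (force simp: extendable_def)
  then have "z < s" "s < z'" using p c cellD[of R y z c s] cellD[of R y' z' c s]
    by (auto simp: new_roots_def)
  then show ?thesis by simp
qed

lemma new_roots_less_iff:
  assumes ext: "extendable R f g"
    and p: "(y,z) \<in> new_roots R f g" "(y',z') \<in> new_roots R f g"
  shows "y < y' \<longleftrightarrow> z < z'"
  using new_roots_less[OF ext p] new_roots_less[OF extendable_converse[OF ext], of z y z' y'] p
  by (auto simp: new_roots_converse)

text \<open>The sign of the derivative is constant on the cell, because every point of it is
  compared with one fixed point on the other side. Both polynomials therefore rise through the cell,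
  and their signs agree at its ends.\<close>

lemma cell_increasing:
  assumes ext: "extendable R f g" and c: "cell R y z" and y: "y \<notin> fst ` R"
    and pos: "poly (pderiv f) y > 0"
  shows "\<exists>l l' u u'. l < y \<and> y < u \<and> l' < z \<and> z < u' \<and>
    sg (poly f l) = sg (poly g l') \<and> sg (poly f u) = sg (poly g u') \<and>
    poly f l < poly f y \<and> poly f y < poly f u \<and> poly g l' < poly g z \<and> poly g z < poly g u' \<and>
    (\<forall>w. l < w \<and> w < u \<longrightarrow> cell R w z) \<and> (\<forall>w. l' < w \<and> w < u' \<longrightarrow> cell R y w)"
proof -
  obtain u u' where u: "y < u" "z < u'" "sg (poly f u) = sg (poly g u')"
    "\<And>w. y \<le> w \<Longrightarrow> w < u \<Longrightarrow> cell R w z" "\<And>w. z \<le> w \<Longrightarrow> w < u' \<Longrightarrow> cell R y w"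
    using cell_upper[OF ext c y] by auto
  obtain l l' where l: "l < y" "l' < z" "sg (poly f l) = sg (poly g l')"
    "\<And>w. l < w \<Longrightarrow> w \<le> y \<Longrightarrow> cell R w z" "\<And>w. l' < w \<Longrightarrow> w \<le> z \<Longrightarrow> cell R y w"
    using cell_lower[OF ext c y] by auto
  have cells: "cell R w z" if "l < w" "w < u" for w
    using that u(4)[of w] l(4)[of w] by (cases "w \<le> y") auto
  have cells': "cell R y w" if "l' < w" "w < u'" for w
    using that u(5)[of w] l(5)[of w] by (cases "w \<le> z") auto
  have d: "sg (poly (pderiv f) w) = sg (poly (pderiv g) v)" if "cell R w v" for w v
    using ext that by (auto simp: extendable_def)
  have df: "poly (pderiv f) w > 0" if "l < w" "w < u" for w
    using sg_eqD(1)[OF d[OF cells[OF that]]] sg_eqD(1)[OF d[OF c]] pos by simp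
  have dg: "poly (pderiv g) w > 0" if "l' < w" "w < u'" for w
    using sg_eqD(1)[OF d[OF cells'[OF that]]] pos by simp
  have "poly f l < poly f y" "poly f y < poly f u" "poly g l' < poly g z" "poly g z < poly g u'"
    using u l by (auto intro!: rcf_increasing df dg)
  then show ?thesis using u l cells cells' by blast
qed

text \<open>Since \<open>f\<close> rises through its root, it is negative at the lower end of the
  cell and positive at the upper end. Those signs hold for \<open>g\<close> as well, and the
  intermediate value property gives the partner.\<close>

lemma new_roots_exists_pos:
  assumes ext: "extendable R f g" and y: "y \<notin> fst ` R" and root: "poly f y = 0"
    and pos: "poly (pderiv f) y > 0"
  shows "\<exists>z. (y,z) \<in> new_roots R f g"
proof -
  have "order_iso R" using ext by (simp add: extendable_def)
  then obtain z where c: "cell R y z" using ex_cell by blast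
  from cell_increasing[OF ext c y pos] obtain l l' u u' where
    *: "l' < z" "z < u'" "sg (poly f l) = sg (poly g l')" "sg (poly f u) = sg (poly g u')"
    "poly f l < poly f y" "poly f y < poly f u" "\<forall>w. l' < w \<and> w < u' \<longrightarrow> cell R y w" by blast
  have "poly g l' < 0" "poly g u' > 0"
    using * root sg_eqD[of "poly f l" "poly g l'"] sg_eqD[of "poly f u" "poly g u'"] by auto
  then obtain v where "l' < v" "v < u'" "poly g v = 0"
    using rcf_IVT[of l' u' g] * by (auto simp: mult_neg_pos)
  then show ?thesis using * root by (auto simp: new_roots_def)
qed

lemma new_roots_exists:
  assumes ext: "extendable R f g" and root: "poly f y = 0" 
  shows "\<exists>z. (y,z) \<in> new_roots R f g \<union> R"
proof (cases "y \<in> fst ` R")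
  case True
  then show ?thesis by auto
next
  case False
  then have "poly (pderiv f) y \<noteq> 0" using ext by (auto simp: extendable_def)
  then consider "poly (pderiv f) y > 0" | "poly (pderiv (-f)) y > 0"
    by (auto simp: pderiv_minus neq_iff)
  then show ?thesis
  proof cases
    case 1
    then show ?thesis using new_roots_exists_pos[OF ext False root] by auto
  next
    case 2
    then show ?thesis using new_roots_exists_pos[OF extendable_minus[OF ext] False] root
      by (auto simp: new_roots_def)
  qed
qed

text \<open>Here \<open>f\<close> must have a root \<open>t\<close> below \<open>y\<close> and
  \<open>g\<close> a root \<open>s\<close> above \<open>z\<close>, both in the same cell. The pair
  \<open>(t,s)\<close> is then a new root pair that \<open>y\<close> and \<open>z\<close> see from
  opposite sides.\<close>

lemma cell_new_roots_pos_neg: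
  assumes ext: "extendable R f g" and c: "cell (R \<union> new_roots R f g) y z"
    and y: "y \<notin> fst ` R" and pos: "poly (pderiv f) y > 0"
    and yz: "poly f y > 0" "poly g z < 0"
  shows False
proof -
  have c': "cell R y z" using c by (auto simp: cell_def)
  from cell_increasing[OF ext c' y pos] obtain l l' u u' where
    *: "l < y" "y < u" "l' < z" "z < u'"
    "sg (poly f l) = sg (poly g l')" "sg (poly f u) = sg (poly g u')"
    "poly g l' < poly g z" "poly f y < poly f u"
    "\<forall>w. l < w \<and> w < u \<longrightarrow> cell R w z" "\<forall>w. l' < w \<and> w < u' \<longrightarrow> cell R y w" by blast
  have "poly f l < 0" "poly g u' > 0"
    using * yz sg_eqD[of "poly f l" "poly g l'"] sg_eqD[of "poly f u" "poly g u'"] by auto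
  then obtain t s where t: "l < t" "t < y" "poly f t = 0" and s: "z < s" "s < u'" "poly g s = 0"
    using rcf_IVT[of l y f] rcf_IVT[of z u' g] * yz by (auto simp: mult_neg_pos)
  have "cell R t z" "cell R y s" using * t s by auto
  then have "cell R t s" using c' cell_exchange by blast
  then have "(t,s) \<in> new_roots R f g" using t s by (simp add: new_roots_def)
  then show False using cellD(1)[OF c, of t s] t s by auto
qed

lemma cell_new_roots_same_sign:
  assumes ext: "extendable R f g" and c: "cell (R \<union> new_roots R f g) y z"
    and y: "y \<notin> fst ` R" and yz: "poly f y > 0" "poly g z < 0"
  shows False
proof -
  have c': "cell R y z" using c by (auto simp: cell_def)
  have z: "z \<notin> snd ` R" using y cell_outside[OF c'] by simp
  have "poly (pderiv f) y \<noteq> 0" using ext y by (auto simp: extendable_def)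
  moreover have "sg (poly (pderiv f) y) = sg (poly (pderiv g) z)"
    using ext c' by (simp add: extendable_def)
  ultimately consider "poly (pderiv f) y > 0" | "poly (pderiv (-g)) z > 0"
    using sg_eqD(2) by (fastforce simp: pderiv_minus)
  then show ?thesis
  proof cases
    case 1
    then show ?thesis using cell_new_roots_pos_neg[OF ext c y] yz by simp
  next
    case 2
    \<comment> \<open>If the polynomials fall on the cell, exchanging the two sides and negating
      both gives rising ones, again with a positive value first and a negative one second.\<close>
    have e: "extendable (R\<inverse>) (-g) (-f)" using ext extendable_converse extendable_minus by blast
    have "new_roots R f g = new_roots R (-f) (-g)" by (simp add: new_roots_def)
    then have "cell (R\<inverse> \<union> new_roots (R\<inverse>) (-g) (-f)) z y"
      using c unfolding new_roots_converse converse_Un[symmetric] cell_converse by simp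
    moreover have "z \<notin> fst ` (R\<inverse>)" using z by force
    ultimately show ?thesis using cell_new_roots_pos_neg[OF e] 2 yz by simp
  qed
qed

text \<open>The last clause records the origin of every root. A further polynomial can then be
  reduced modulo the one that has this root, which is how its sign there becomes known.\<close>

definition table :: "('a::rcf poly \<times> 'b::rcf poly) set \<Rightarrow> ('a \<times> 'b) set \<Rightarrow> bool" where
  "table Q R \<longleftrightarrow> order_iso R \<and>
     (\<forall>(f,g)\<in>Q. \<forall>y z. cell R y z \<longrightarrow> sg (poly f y) = sg (poly g z)) \<and>
     (\<forall>(f,g)\<in>Q. (f \<noteq> 0 \<longrightarrow> (\<forall>y. poly f y = 0 \<longrightarrow> y \<in> fst ` R)) \<and>
                 (g \<noteq> 0 \<longrightarrow> (\<forall>z. poly g z = 0 \<longrightarrow> z \<in> snd ` R))) \<and>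
     (\<forall>(t,s)\<in>R. \<exists>(f,g)\<in>Q. f \<noteq> 0 \<and> g \<noteq> 0 \<and> poly f t = 0 \<and> poly g s = 0)"

lemma tableD:
  assumes "table Q R"
  shows "order_iso R"
    and "(f,g) \<in> Q \<Longrightarrow> cell R y z \<Longrightarrow> sg (poly f y) = sg (poly g z)"
    and "(f,g) \<in> Q \<Longrightarrow> f \<noteq> 0 \<Longrightarrow> poly f y = 0 \<Longrightarrow> y \<in> fst ` R"
    and "(f,g) \<in> Q \<Longrightarrow> g \<noteq> 0 \<Longrightarrow> poly g z = 0 \<Longrightarrow> z \<in> snd ` R"
    and "(t,s) \<in> R \<Longrightarrow> \<exists>(f,g)\<in>Q. f \<noteq> 0 \<and> g \<noteq> 0 \<and> poly f t = 0 \<and> poly g s = 0"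
proof -
  note t = assms[unfolded table_def]
  note sign = t[THEN conjunct2, THEN conjunct1] 
    and roots = t[THEN conjunct2, THEN conjunct2, THEN conjunct1]
    and source = t[THEN conjunct2, THEN conjunct2, THEN conjunct2]
  show "order_iso R" using t by (rule conjunct1)
  show "(f,g) \<in> Q \<Longrightarrow> cell R y z \<Longrightarrow> sg (poly f y) = sg (poly g z)"
    using bspec[OF sign, of "(f,g)"] by simp
  show "(f,g) \<in> Q \<Longrightarrow> f \<noteq> 0 \<Longrightarrow> poly f y = 0 \<Longrightarrow> y \<in> fst ` R"
    "(f,g) \<in> Q \<Longrightarrow> g \<noteq> 0 \<Longrightarrow> poly g z = 0 \<Longrightarrow> z \<in> snd ` R"
    using bspec[OF roots, of "(f,g)"] by simp_all
  show "(t,s) \<in> R \<Longrightarrow> \<exists>(f,g)\<in>Q. f \<noteq> 0 \<and> g \<noteq> 0 \<and> poly f t = 0 \<and> poly g s = 0"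
    using bspec[OF source, of "(t,s)"] by simp
qed

lemma table_insert:
  assumes tab: "table Q R" and deriv: "(pderiv f, pderiv g) \<in> Q"
    and deg: "degree f > 0" "degree f = degree g" and lc: "sg (lead_coeff f) = sg (lead_coeff g)"
    and at: "\<And>t s. (t,s) \<in> R \<Longrightarrow> sg (poly f t) = sg (poly g s)"
  shows "table (insert (f,g) Q) (R \<union> new_roots R f g)"
proof -
  have iso: "order_iso R" using tab by (simp add: table_def)
  have d0: "pderiv f \<noteq> 0" "pderiv g \<noteq> 0" using deg by (auto simp: pderiv_eq_0_iff)
  have fg0: "f \<noteq> 0" "g \<noteq> 0" using deg by auto
  have ext: "extendable R f g"
    unfolding extendable_def
    using iso deg lc at tableD(2-4)[OF tab deriv] d0 by auto
  have ext': "extendable (R\<inverse>) g f" using ext by (rule extendable_converse)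
  let ?N = "new_roots R f g"
  have roots: "y \<in> fst ` (R \<union> ?N)" if "poly f y = 0" for y
    using new_roots_exists[OF ext that] by (auto simp: image_iff Bex_def) 
  have roots': "z \<in> snd ` (R \<union> ?N)" if "poly g z = 0" for z
    using new_roots_exists[OF ext' that] by (auto simp: image_iff Bex_def new_roots_converse)
  have "?N \<subseteq> {y. poly f y = 0} \<times> {z. poly g z = 0}" by (auto simp: new_roots_def)
  then have fin: "finite ?N"
    by (rule finite_subset) (simp add: fg0 poly_roots_finite)
  have cellN: "cell (R \<union> ?N) y z" if yz: "(y,z) \<in> R \<union> ?N" for y z
  proof (rule cellI)
    fix t s assume ts: "(t,s) \<in> R \<union> ?N"
    consider "(y,z) \<in> R" "(t,s) \<in> R" | "(y,z) \<in> R" "(t,s) \<in> ?N"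
      | "(y,z) \<in> ?N" "(t,s) \<in> R" | "(y,z) \<in> ?N" "(t,s) \<in> ?N"
      using yz ts by blast
    then show "(t < y \<longleftrightarrow> s < z) \<and> (y < t \<longleftrightarrow> z < s)"
    proof cases
      case 1
      then show ?thesis using order_isoD[OF iso] by blast
    next
      case 2
      then show ?thesis using cellD[of R t s y z] by (auto simp: new_roots_def)
    next
      case 3
      then show ?thesis using cellD[of R y z t s] by (auto simp: new_roots_def)
    next
      case 4
      then show ?thesis using new_roots_less_iff[OF ext] by blast
    qed
  qed
  have sign: "sg (poly f y) = sg (poly g z)" if c: "cell (R \<union> ?N) y z" for y z
  proof (cases "y \<in> fst ` (R \<union> ?N) \<or> z \<in> snd ` (R \<union> ?N)")
    case True
    \<comment> \<open>A root on one side forces its partner on the other, since the cell condition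
      includes equality.\<close>
    then have "(y,z) \<in> R \<union> ?N" using cellD(3)[OF c] by fastforce
    then show ?thesis using at by (auto simp: new_roots_def)
  next
    case False
    then have n0: "poly f y \<noteq> 0" "poly g z \<noteq> 0" using roots roots' by auto
    have "\<not> (poly f y > 0 \<and> poly g z < 0)"
      using cell_new_roots_same_sign[OF ext c] False by auto
    moreover have "cell (R\<inverse> \<union> new_roots (R\<inverse>) g f) z y"
      using c unfolding new_roots_converse converse_Un[symmetric] cell_converse .
    then have "\<not> (poly g z > 0 \<and> poly f y < 0)"
      using cell_new_roots_same_sign[OF ext', of z y] False by force
    ultimately show ?thesis using n0 by (auto simp: sg_def)
  qed
  have sub: "cell R y z" if "cell (R \<union> ?N) y z" for y z
    using that by (auto simp: cell_def)
  show ?thesis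
    unfolding table_def
  proof (intro conjI ballI)
    show "order_iso (R \<union> ?N)" using fin iso cellN by (auto simp: order_iso_def)
  next
    fix p assume p: "p \<in> insert (f,g) Q"
    obtain f' g' where [simp]: "p = (f',g')" by (cases p)
    show "case p of (f, g) \<Rightarrow> \<forall>y z. cell (R \<union> ?N) y z \<longrightarrow> sg (poly f y) = sg (poly g z)"
      using p sign sub tableD(2)[OF tab, of f' g'] by auto
    show "case p of (f, g) \<Rightarrow> (f \<noteq> 0 \<longrightarrow> (\<forall>y. poly f y = 0 \<longrightarrow> y \<in> fst ` (R \<union> ?N))) \<and>
                 (g \<noteq> 0 \<longrightarrow> (\<forall>z. poly g z = 0 \<longrightarrow> z \<in> snd ` (R \<union> ?N)))"
    proof (cases "p = (f,g)")
      case True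
      then show ?thesis using roots roots' by simp
    next
      case False
      then show ?thesis using p tableD(3,4)[OF tab, of f' g'] by (auto simp: image_Un)
    qed
  next
    fix q assume q: "q \<in> R \<union> ?N"
    obtain t s where [simp]: "q = (t,s)" by (cases q)
    show "case q of (t, s) \<Rightarrow> \<exists>(f,g)\<in>insert (f, g) Q. f \<noteq> 0 \<and> g \<noteq> 0 \<and> poly f t = 0 \<and> poly g s = 0"
    proof (cases "q \<in> R")
      case True
      then show ?thesis using tableD(5)[OF tab, of t s] by auto
    next
      case False
      then show ?thesis using q fg0 by (simp add: new_roots_def)
    qed
  qed
qed

lemma table_insert_const:
  assumes tab: "table Q R" and deg: "degree f = 0" "degree g = 0"
    and lc: "sg (lead_coeff f) = sg (lead_coeff g)"
  shows "table (insert (f,g) Q) R"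
proof -
  obtain a b where ab: "f = [:a:]" "g = [:b:]" using deg by (metis degree_eq_zeroE)
  have s: "sg a = sg b" using lc by (simp add: ab)
  show ?thesis
    unfolding table_def
  proof (intro conjI ballI)
    show "order_iso R" using tab by (simp add: table_def)
  next
    fix p assume p: "p \<in> insert (f,g) Q"
    obtain f' g' where [simp]: "p = (f',g')" by (cases p)
    show "case p of (f, g) \<Rightarrow> \<forall>y z. cell R y z \<longrightarrow> sg (poly f y) = sg (poly g z)"
      using p s tableD(2)[OF tab, of f' g'] by (auto simp: ab)
    show "case p of (f, g) \<Rightarrow> (f \<noteq> 0 \<longrightarrow> (\<forall>y. poly f y = 0 \<longrightarrow> y \<in> fst ` R)) \<and>
                 (g \<noteq> 0 \<longrightarrow> (\<forall>z. poly g z = 0 \<longrightarrow> z \<in> snd ` R))"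
      using p tableD(3,4)[OF tab, of f' g'] by (auto simp: ab)
  next
    fix q assume q: "q \<in> R"
    obtain t s where [simp]: "q = (t,s)" by (cases q)
    show "case q of (t, s) \<Rightarrow> \<exists>(f,g)\<in>insert (f, g) Q. f \<noteq> 0 \<and> g \<noteq> 0 \<and> poly f t = 0 \<and> poly g s = 0"
      using tableD(5)[OF tab, of t s] q by auto
  qed
qed

lemma table_empty: "table {} {}"
  by (simp add: table_def order_iso_def)

lemma degree_eq_if_sg_coeff_eq:
  assumes "\<And>i. sg (coeff f i) = sg (coeff g i)"
  shows "degree f = degree g"
proof -
  have "coeff f i = 0 \<longleftrightarrow> coeff g i = 0" for i using sg_eqD(3)[OF assms] .
  then show ?thesis unfolding degree_def by simp
qed

text \<open>The Cohen-Hormander method. Pairs are added in order of increasing degree, so the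
  derivative and the remainders of a pair are in the table before the pair itself.\<close>

lemma table_exists:
  fixes Q :: "('a::rcf poly \<times> 'b::rcf poly) set"
  assumes fin: "finite Q"
    and coeffs: "\<And>f g i. (f,g) \<in> Q \<Longrightarrow> sg (coeff f i) = sg (coeff g i)"
    and deriv: "\<And>f g. (f,g) \<in> Q \<Longrightarrow> degree f > 0 \<Longrightarrow> (pderiv f, pderiv g) \<in> Q"
    and remainder: "\<And>f g h k. (f,g) \<in> Q \<Longrightarrow> (h,k) \<in> Q \<Longrightarrow> degree h > 0 \<Longrightarrow> degree h \<le> degree f \<Longrightarrow>
      \<exists>(r,r')\<in>Q. degree r < degree h \<and> (\<forall>t. poly h t = 0 \<longrightarrow> sg (poly f t) = sg (poly r t)) \<and>
        (\<forall>s. poly k s = 0 \<longrightarrow> sg (poly g s) = sg (poly r' s))"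
  shows "\<exists>R. table Q R"
proof -
  \<comment> \<open>The induction runs over subsets that are closed downwards in degree: removing a
    pair of maximal degree keeps this property, whereas closure under remainders is required only of
    \<open>Q\<close>.\<close>
  have "\<exists>R. table Q' R"
    if "Q' \<subseteq> Q" "\<And>p p'. p \<in> Q' \<Longrightarrow> p' \<in> Q \<Longrightarrow> degree (fst p') < degree (fst p) \<Longrightarrow> p' \<in> Q'" for Q'
    using that
  proof (induction "card Q'" arbitrary: Q')
    case 0
    then have "Q' = {}" using fin finite_subset by (metis card_0_eq)
    then show ?case using table_empty by blast
  next
    case (Suc n)
    have finQ': "finite Q'" "Q' \<noteq> {}" using Suc fin finite_subset by auto
    define d where "d = Max ((\<lambda>p. degree (fst p)) ` Q')"
    have "d \<in> (\<lambda>p. degree (fst p)) ` Q'"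
      unfolding d_def by (rule Max_in) (use finQ' in auto)
    then obtain f g where fg: "(f,g) \<in> Q'" "d = degree f" by force
    have d_max: "degree (fst p) \<le> degree f" if "p \<in> Q'" for p
      unfolding fg(2)[symmetric] d_def by (rule Max_ge) (use finQ' that in auto)
    let ?P = "Q' - {(f,g)}"
    have P_card: "n = card ?P" using Suc.hyps(2) fg finQ' by simp
    have P_sub: "?P \<subseteq> Q" using Suc.prems by auto
    have "\<exists>R. table ?P R"
    proof (rule Suc.hyps(1)[OF P_card P_sub])
      fix p p' assume *: "p \<in> ?P" "p' \<in> Q" "degree (fst p') < degree (fst p)"
      then have "p' \<in> Q'" using Suc.prems(2)[of p p'] by auto
      moreover have "p' \<noteq> (f,g)" using * d_max[of p] by auto
      ultimately show "p' \<in> ?P" by simp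
    qed
    then obtain R where R: "table ?P R" ..
    have fgQ: "(f,g) \<in> Q" using fg Suc.prems by auto
    have lower: "p \<in> ?P" if "p \<in> Q" "degree (fst p) < degree f" for p
      using Suc.prems(2)[OF fg(1) that(1)] that by auto
    have deg: "degree f = degree g" using degree_eq_if_sg_coeff_eq[OF coeffs[OF fgQ]] .
    have lc: "sg (lead_coeff f) = sg (lead_coeff g)"
      using coeffs[OF fgQ] deg by simp
    have ins: "insert (f,g) ?P = Q'" using fg by auto
    show ?case
    proof (cases "degree f = 0")
      case True
      then show ?thesis using table_insert_const[OF R _ _ lc] deg ins by auto
    next
      case False
      then have pos: "degree f > 0" by simp
      have "degree (pderiv f) < degree f" using pos by (simp add: degree_pderiv)
      then have d': "(pderiv f, pderiv g) \<in> ?P" using lower[OF deriv[OF fgQ pos]] by simp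
      \<comment> \<open>An old root \<open>t\<close> comes from some \<open>h\<close> in the table.
        There \<open>f\<close> has the sign of its remainder, whose degree is smaller and whose sign
        is therefore already controlled.\<close>
      have "sg (poly f t) = sg (poly g s)" if ts: "(t,s) \<in> R" for t s
      proof -
        obtain h k where hk: "(h,k) \<in> ?P" "h \<noteq> 0" "k \<noteq> 0" "poly h t = 0" "poly k s = 0"
          using tableD(5)[OF R ts] by auto
        have hkQ: "(h,k) \<in> Q" using hk Suc.prems by auto
        have hpos: "degree h > 0" using hk by (metis degree_eq_zeroE gr0I mult_zero_right poly_0 poly_pCons add_0_right pCons_0_0)
        have hle: "degree h \<le> degree f" using d_max[of "(h,k)"] hk by simp
        obtain r r' where r: "(r,r') \<in> Q" "degree r < degree h"
          "\<forall>t. poly h t = 0 \<longrightarrow> sg (poly f t) = sg (poly r t)"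
          "\<forall>s. poly k s = 0 \<longrightarrow> sg (poly g s) = sg (poly r' s)"
          using remainder[OF fgQ hkQ hpos hle] by auto
        have "(r,r') \<in> ?P" using lower[OF r(1)] r(2) hle by simp
        moreover have "cell R t s" using tableD(1)[OF R] ts by (auto simp: order_iso_def)
        ultimately have "sg (poly r t) = sg (poly r' s)" using tableD(2)[OF R] by blast
        then show ?thesis using r hk by simp
      qed
      then show ?thesis using table_insert[OF R d' pos deg lc] ins by metis
    qed
  qed
  from this[of Q] show ?thesis by blast
qed

text \<open>The degree of \<open>M e h\<close> is bounded by that of the divisor \<open>h\<close>
  alone, so closing from the top degree downwards never reopens a level. \<open>ok k\<close> means
  closed with respect to all \<open>h\<close> of degree above \<open>k\<close>.\<close>

lemma finite_closure_degree:
  fixes deg :: "'p \<Rightarrow> nat"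
  assumes fin: "finite G"
    and D: "\<And>h. deg h > 0 \<Longrightarrow> deg (D h) < deg h"
    and M: "\<And>e h. deg h > 0 \<Longrightarrow> deg (M e h) < deg h"
  shows "\<exists>G'. finite G' \<and> G \<subseteq> G' \<and>
    (\<forall>h\<in>G'. deg h > 0 \<longrightarrow> D h \<in> G' \<and> (\<forall>e\<in>G'. deg h \<le> deg e \<longrightarrow> M e h \<in> G'))"
proof -
  define ok where "ok k G' \<longleftrightarrow> finite G' \<and> G \<subseteq> G' \<and>
    (\<forall>h\<in>G'. deg h > k \<longrightarrow> D h \<in> G' \<and> (\<forall>e\<in>G'. deg h \<le> deg e \<longrightarrow> M e h \<in> G'))" for k G'
  define N where "N = Max (insert 0 (deg ` G))"
  have "deg h \<le> N" if "h \<in> G" for h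
    unfolding N_def by (rule Max_ge) (use that fin in auto)
  then have "ok N G" using fin by (auto simp: ok_def not_less[symmetric])
  moreover have "\<exists>G''. ok k G''" if "ok (Suc k) G'" for k G'
  proof -
    define H where "H = {h \<in> G'. deg h = Suc k}"
    define G'' where "G'' = G' \<union> D ` H \<union> (\<lambda>(e,h). M e h) ` (G' \<times> H)"
    have G': "finite G'" "G \<subseteq> G'"
      "\<And>h. h \<in> G' \<Longrightarrow> deg h > Suc k \<Longrightarrow> D h \<in> G'"
      "\<And>e h. h \<in> G' \<Longrightarrow> deg h > Suc k \<Longrightarrow> e \<in> G' \<Longrightarrow> deg h \<le> deg e \<Longrightarrow> M e h \<in> G'"
      using that by (auto simp: ok_def)
    \<comment> \<open>Whatever is added at this stage has degree at most \<open>k\<close>; hence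
      divisors of degree above \<open>k\<close>, and the dividends that are at least as large, are
      all old.\<close>
    have old: "h \<in> G'" if h: "h \<in> G''" "deg h > k" for h
    proof (rule ccontr)
      assume "h \<notin> G'"
      moreover have "deg (D h') < Suc k" "deg (M e h') < Suc k" if "h' \<in> H" for e h'
        using that D[of h'] M[of h' e] by (simp_all add: H_def)
      ultimately have "deg h < Suc k" using h(1) by (auto simp: G''_def)
      then show False using h(2) by simp
    qed
    have "D h \<in> G'' \<and> (\<forall>e\<in>G''. deg h \<le> deg e \<longrightarrow> M e h \<in> G'')" if h: "h \<in> G''" "deg h > k" for h
    proof (cases "deg h = Suc k")
      case True
      then have "h \<in> H" using old[OF h] by (simp add: H_def)
      then have "D h \<in> G''" "\<And>e. e \<in> G' \<Longrightarrow> M e h \<in> G''" by (auto simp: G''_def)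
      then show ?thesis using old h by auto
    next
      case False
      then have "deg h > Suc k" using h by simp
      then have "D h \<in> G'" "\<And>e. e \<in> G' \<Longrightarrow> deg h \<le> deg e \<Longrightarrow> M e h \<in> G'"
        using G'(3,4) old[OF h] by auto
      moreover have "G' \<subseteq> G''" by (auto simp: G''_def)
      ultimately show ?thesis using old h by (meson less_le_trans subsetD)
    qed
    moreover have "finite G''" "G \<subseteq> G''" using G' by (auto simp: G''_def H_def)
    ultimately have "ok k G''" unfolding ok_def by blast
    then show ?thesis ..
  qed
  then have "\<exists>G''. ok (k - j) G''" if "ok k G'" for k j G'
    using that
  proof (induction j)
    case (Suc j)
    then obtain G'' where G'': "ok (k - j) G''" by blast
    show ?case
    proof (cases "k - j")
      case 0
      then show ?thesis using G'' by (metis diff_Suc nat.case(1))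
    next
      case (Suc i)
      then show ?thesis using G'' \<open>\<And>k G'. ok (Suc k) G' \<Longrightarrow> \<exists>G''. ok k G''\<close> by (metis diff_Suc nat.case(2))
    qed
  qed auto
  ultimately obtain G' where "ok (N - N) G'" by blast
  then show ?thesis by (auto simp: ok_def)
qed

subsection \<open>Transfer of sign conditions to the reals\<close>

text \<open>Real polynomials are kept as syntax because one and the same expression is evaluated in
  two fields, and because derivatives and remainders must be formed before evaluation.\<close>

datatype 'v rexp = Const real | Var 'v | Neg "'v rexp" | Add "'v rexp" "'v rexp" | Mul "'v rexp" "'v rexp"

primrec ev :: "(real \<Rightarrow> 'a) \<Rightarrow> ('v \<Rightarrow> 'a) \<Rightarrow> 'v rexp \<Rightarrow> 'a::comm_ring_1" where
  "ev \<phi> x (Const c) = \<phi> c"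
| "ev \<phi> x (Var i) = x i"
| "ev \<phi> x (Neg e) = - ev \<phi> x e"
| "ev \<phi> x (Add e f) = ev \<phi> x e + ev \<phi> x f"
| "ev \<phi> x (Mul e f) = ev \<phi> x e * ev \<phi> x f"

definition real_hom :: "(real \<Rightarrow> 'a::comm_ring_1) \<Rightarrow> bool" where
  "real_hom \<phi> \<longleftrightarrow> \<phi> 1 = 1 \<and> (\<forall>a b. \<phi> (a + b) = \<phi> a + \<phi> b \<and> \<phi> (a * b) = \<phi> a * \<phi> b)"

lemma real_hom_simps:
  assumes "real_hom \<phi>"
  shows "\<phi> 1 = 1" "\<phi> (a + b) = \<phi> a + \<phi> b" "\<phi> (a * b) = \<phi> a * \<phi> b" "\<phi> 0 = 0" "\<phi> (- a) = - \<phi> a"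
proof -
  show *: "\<phi> 1 = 1" "\<phi> (a + b) = \<phi> a + \<phi> b" "\<phi> (a * b) = \<phi> a * \<phi> b" for a b
    using assms by (auto simp: real_hom_def)
  show "\<phi> 0 = 0" using *(2)[of 0 0] by simp
  then show "\<phi> (- a) = - \<phi> a" using *(2)[of a "-a"] by (simp add: eq_neg_iff_add_eq_0 add.commute)
qed

lemma real_hom_id: "real_hom (\<lambda>r::real. r)"
  by (simp add: real_hom_def)

text \<open>Positive reals are exactly the non-zero squares, and a ring homomorphism between fields
  preserves both being a square and being invertible.\<close>

lemma sg_real_hom:
  fixes \<phi> :: "real \<Rightarrow> 'a::linordered_field"
  assumes "real_hom \<phi>"
  shows "sg (\<phi> a) = sg a"
proof -
  note h = real_hom_simps[OF assms]
  have pos: "\<phi> b > 0" if "b > 0" for b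
  proof -
    have "\<phi> b * \<phi> (inverse b) = 1" using that h(1) by (simp flip: h(3))
    moreover have "\<phi> b = \<phi> (sqrt b) * \<phi> (sqrt b)" using that by (simp flip: h(3))
    ultimately show ?thesis by (metis mult_zero_left not_square_less_zero zero_neq_one linorder_neqE)
  qed
  show ?thesis using pos[of a] pos[of "-a"] h(4) h(5)[of a]
    by (cases a "0::real" rule: linorder_cases) (auto simp: sg_def)
qed

text \<open>A list of expressions stands for a univariate polynomial with parametrised coefficients,
  constant coefficient first; the list may have leading coefficients that evaluate to zero.\<close>

primrec pv :: "(real \<Rightarrow> 'a) \<Rightarrow> ('v \<Rightarrow> 'a) \<Rightarrow> 'v rexp list \<Rightarrow> 'a::comm_ring_1 poly" where
  "pv \<phi> x [] = 0"
| "pv \<phi> x (e # es) = pCons (ev \<phi> x e) (pv \<phi> x es)"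

lemma coeff_pv: "coeff (pv \<phi> x es) i = (if i < length es then ev \<phi> x (es ! i) else 0)"
  by (induction es arbitrary: i) (auto simp: coeff_pCons split: nat.splits)

lemma pv_append: "pv \<phi> x (es @ fs) = pv \<phi> x es + monom 1 (length es) * pv \<phi> x fs"
  by (induction es) (auto simp: monom_Suc)

fun ladd :: "'v rexp list \<Rightarrow> 'v rexp list \<Rightarrow> 'v rexp list" where
  "ladd [] q = q"
| "ladd p [] = p"
| "ladd (a # p) (b # q) = Add a b # ladd p q"

lemma pv_ladd: "pv \<phi> x (ladd p q) = pv \<phi> x p + pv \<phi> x q"
  by (induction p q rule: ladd.induct) auto

lemma length_ladd: "length (ladd p q) = max (length p) (length q)"
  by (induction p q rule: ladd.induct) auto

lemma pv_map_Mul: "pv \<phi> x (map (Mul a) p) = smult (ev \<phi> x a) (pv \<phi> x p)"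
  by (induction p) auto

lemma pv_map_Neg: "pv \<phi> x (map Neg p) = - pv \<phi> x p"
  by (induction p) auto

lemma pv_replicate:
  assumes "real_hom \<phi>"
  shows "pv \<phi> x (replicate n (Const 0) @ p) = monom 1 n * pv \<phi> x p"
  by (induction n) (simp_all add: real_hom_simps[OF assms] monom_Suc)

fun lmul :: "'v rexp list \<Rightarrow> 'v rexp list \<Rightarrow> 'v rexp list" where
  "lmul [] q = []"
| "lmul (a # p) q = ladd (map (Mul a) q) (Const 0 # lmul p q)"

lemma pv_lmul:
  assumes "real_hom \<phi>"
  shows "pv \<phi> x (lmul p q) = pv \<phi> x p * pv \<phi> x q"
  by (induction p) (simp_all add: pv_ladd pv_map_Mul real_hom_simps[OF assms])

fun lderiv :: "'v rexp list \<Rightarrow> 'v rexp list" where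
  "lderiv [] = []"
| "lderiv (a # p) = ladd p (Const 0 # lderiv p)"

lemma pv_lderiv:
  assumes "real_hom \<phi>"
  shows "pv \<phi> x (lderiv p) = pderiv (pv \<phi> x p)"
  by (induction p) (simp_all add: pv_ladd real_hom_simps[OF assms] pderiv_pCons)

text \<open>Pseudo-remainder: each round multiplies by the square of the leading coefficient, so that
  signs at the roots of the divisor are preserved.\<close>

function lrem :: "'v rexp list \<Rightarrow> 'v rexp list \<Rightarrow> 'v rexp list" where
  "lrem p h = (if length p < length h \<or> h = [] then p else
     lrem (butlast (ladd (map (Mul (Mul (last h) (last h))) p)
       (replicate (length p - length h) (Const 0) @ map (Mul (Neg (Mul (last h) (last p)))) h))) h)"
  by auto
termination
  by (relation "Wellfounded.measure (\<lambda>(p,h). length p)") (auto simp: length_ladd neq_Nil_conv)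

declare lrem.simps [simp del]

lemma length_lrem: "h \<noteq> [] \<Longrightarrow> length (lrem p h) < length h"
proof (induction p h rule: lrem.induct)
  case (1 p h)
  then show ?case by (subst lrem.simps) auto
qed

lemma pv_butlast:
  assumes "p \<noteq> []" "ev \<phi> x (last p) = 0"
  shows "pv \<phi> x (butlast p) = pv \<phi> x p"
  using pv_append[of \<phi> x "butlast p" "[last p]"] assms by simp

lemma ev_last_ladd:
  assumes "length p = length q" "p \<noteq> []"
  shows "ev \<phi> x (last (ladd p q)) = ev \<phi> x (last p) + ev \<phi> x (last q)"
  using assms
proof (induction p q rule: ladd.induct)
  case (3 a p b q)
  then show ?case by (cases p; cases q) auto
qed auto

lemma pv_lrem:
  assumes hom: "real_hom \<phi>" and "h \<noteq> []"
  shows "\<exists>q k. smult (ev \<phi> x (last h) ^ (2 * k)) (pv \<phi> x p) = q * pv \<phi> x h + pv \<phi> x (lrem p h)"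
  using assms(2)
proof (induction p h rule: lrem.induct)
  case (1 p h)
  let ?l = "ev \<phi> x (last h)"
  show ?case
  proof (cases "length p < length h")
    case True
    then show ?thesis by (intro exI[of _ 0]) (simp add: lrem.simps[of p h])
  next
    case False
    then have p: "p \<noteq> []" "length h \<le> length p" using 1 by auto
    define m1 where "m1 = map (Mul (Mul (last h) (last h))) p"
    define m2 where "m2 = replicate (length p - length h) (Const 0) @ map (Mul (Neg (Mul (last h) (last p)))) h"
    have len: "length m1 = length m2" "m1 \<noteq> []" using p by (auto simp: m1_def m2_def)
    have ne: "ladd m1 m2 \<noteq> []" using len length_ladd[of m1 m2] by auto
    have "ev \<phi> x (last m1) = ?l * ?l * ev \<phi> x (last p)" using p by (simp add: m1_def last_map)
    moreover have "ev \<phi> x (last m2) = - (?l * ev \<phi> x (last p)) * ?l"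
      using 1 by (simp add: m2_def last_map)
    \<comment> \<open>The leading terms cancel, which justifies dropping the last coefficient by
      \<open>butlast\<close>.\<close>
    ultimately have "ev \<phi> x (last (ladd m1 m2)) = 0" using len by (simp add: ev_last_ladd)
    then have "pv \<phi> x (butlast (ladd m1 m2)) = pv \<phi> x m1 + pv \<phi> x m2"
      using pv_butlast[OF ne] by (simp add: pv_ladd)
    also have "\<dots> = smult (?l\<^sup>2) (pv \<phi> x p) +
        monom 1 (length p - length h) * smult (- (?l * ev \<phi> x (last p))) (pv \<phi> x h)"
      by (simp add: m1_def m2_def pv_replicate[OF hom] pv_map_Mul power2_eq_square)
    finally have step: "pv \<phi> x (butlast (ladd m1 m2)) = \<dots>" .
    have "\<exists>q k. smult (?l ^ (2 * k)) (pv \<phi> x (butlast (ladd m1 m2))) = q * pv \<phi> x h + pv \<phi> x (lrem (butlast (ladd m1 m2)) h)"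
      using 1 False unfolding m1_def m2_def by blast
    moreover have "lrem (butlast (ladd m1 m2)) h = lrem p h"
      using False 1 unfolding m1_def m2_def by (subst (2) lrem.simps) simp
    ultimately obtain q k where
      "smult (?l ^ (2 * k)) (pv \<phi> x (butlast (ladd m1 m2))) = q * pv \<phi> x h + pv \<phi> x (lrem p h)" by auto
    then have "smult (?l ^ (2 * Suc k)) (pv \<phi> x p) =
      (q + smult (?l ^ (2 * k) * (?l * ev \<phi> x (last p))) (monom 1 (length p - length h))) * pv \<phi> x h
        + pv \<phi> x (lrem p h)"
      unfolding step
      by (simp add: algebra_simps power2_eq_square smult_add_right smult_diff_right)
    then show ?thesis by blast
  qed
qed

text \<open>Pseudo-division multiplies by the last coefficient, which therefore has to be non-zero.
  The cut is decided at \<open>x\<close>; it remains correct at every \<open>b\<close> where the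
  coefficients have the same signs, since the dropped ones vanish there too.\<close>

definition ltrim :: "(real \<Rightarrow> 'a::comm_ring_1) \<Rightarrow> ('v \<Rightarrow> 'a) \<Rightarrow> 'v rexp list \<Rightarrow> 'v rexp list" where
  "ltrim \<phi> x es = take (if pv \<phi> x es = 0 then 0 else Suc (degree (pv \<phi> x es))) es"

lemma degree_pv_less: "pv \<phi> x es \<noteq> 0 \<Longrightarrow> degree (pv \<phi> x es) < length es"
  by (metis coeff_pv leading_coeff_0_iff)

lemma ltrim:
  assumes "degree (pv \<phi> x es) > 0"
  shows "ltrim \<phi> x es \<noteq> []" "length (ltrim \<phi> x es) = Suc (degree (pv \<phi> x es))"
    "ev \<phi> x (last (ltrim \<phi> x es)) \<noteq> 0" "last (ltrim \<phi> x es) \<in> set es"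
proof -
  have ne: "pv \<phi> x es \<noteq> 0" using assms by auto
  note d = degree_pv_less[OF ne]
  have t: "ltrim \<phi> x es = take (Suc (degree (pv \<phi> x es))) es" using ne by (simp add: ltrim_def)
  show len: "length (ltrim \<phi> x es) = Suc (degree (pv \<phi> x es))" using d by (simp add: t)
  then show ne': "ltrim \<phi> x es \<noteq> []" by auto
  have l: "last (ltrim \<phi> x es) = es ! degree (pv \<phi> x es)"
    unfolding last_conv_nth[OF ne'] len using d by (simp add: t)
  show "last (ltrim \<phi> x es) \<in> set es" unfolding l using d by simp
  have "ev \<phi> x (es ! degree (pv \<phi> x es)) = lead_coeff (pv \<phi> x es)" using d by (simp add: coeff_pv)
  then show "ev \<phi> x (last (ltrim \<phi> x es)) \<noteq> 0" unfolding l using ne by simp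
qed

lemma pv_ltrim:
  assumes "\<And>e. e \<in> set es \<Longrightarrow> sg (ev \<phi> x e) = sg (ev \<psi> b e)"
  shows "pv \<psi> b (ltrim \<phi> x es) = pv \<psi> b es"
proof (rule poly_eqI)
  fix i
  have "ev \<psi> b (es ! i) = 0" if "i < length es" "coeff (pv \<phi> x es) i = 0"
    using that sg_eqD(3)[OF assms[OF nth_mem[OF that(1)]]] by (simp add: coeff_pv)
  moreover have "coeff (pv \<phi> x es) i = 0" if "pv \<phi> x es = 0 \<or> degree (pv \<phi> x es) < i"
    using that coeff_eq_0 by auto
  ultimately show "coeff (pv \<psi> b (ltrim \<phi> x es)) i = coeff (pv \<psi> b es) i"
    unfolding ltrim_def coeff_pv[of \<psi>] by (auto simp: less_Suc_eq_le not_le)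
qed

lemma sg_poly_pv_lrem:
  fixes \<phi> :: "real \<Rightarrow> 'a::linordered_field"
  assumes "real_hom \<phi>" "h \<noteq> []" "ev \<phi> x (last h) \<noteq> 0" "poly (pv \<phi> x h) t = 0"
  shows "sg (poly (pv \<phi> x p) t) = sg (poly (pv \<phi> x (lrem p h)) t)"
proof -
  obtain q k where *: "smult (ev \<phi> x (last h) ^ (2 * k)) (pv \<phi> x p) = q * pv \<phi> x h + pv \<phi> x (lrem p h)"
    using pv_lrem assms by blast
  have "ev \<phi> x (last h) ^ (2 * k) * poly (pv \<phi> x p) t = poly (pv \<phi> x (lrem p h)) t"
    using arg_cong[OF *, of "\<lambda>p. poly p t"] assms by simp
  moreover have "sg (ev \<phi> x (last h) ^ (2 * k)) = 1" using assms by (simp add: power_mult)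
  ultimately show ?thesis using sg_mult by (metis mult_1)
qed

text \<open>Elimination of one variable. \<open>S\<close> consists of all coefficients in the
  closure of \<open>G\<close> under derivatives and trimmed pseudo-remainders; once their signs
  agree, the families over both fields satisfy the hypotheses of \<open>table_exists\<close>, and
  any \<open>y\<close> has a counterpart in the corresponding real cell. \<open>S\<close> is fixed
  before \<open>b\<close> and \<open>y\<close> are known.\<close>

lemma sign_transfer_step:
  fixes \<phi> :: "real \<Rightarrow> 'a::rcf" and G :: "'v rexp list set"
  assumes hom: "real_hom \<phi>" and fin: "finite G"
  shows "\<exists>S. finite S \<and> (\<forall>b::'v \<Rightarrow> real. (\<forall>e\<in>S. sg (ev \<phi> x e) = sg (ev (\<lambda>r. r) b e)) \<longrightarrow>
    (\<forall>y. \<exists>z. \<forall>es\<in>G. sg (poly (pv \<phi> x es) y) = sg (poly (pv (\<lambda>r. r) b es) z)))"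
proof -
  let ?deg = "\<lambda>es. degree (pv \<phi> x es)"
  let ?M = "\<lambda>es hs. lrem es (ltrim \<phi> x hs)"
  have D: "?deg (lderiv hs) < ?deg hs" if "?deg hs > 0" for hs
    using that by (simp add: pv_lderiv[OF hom] degree_pderiv)
  have M: "?deg (?M es hs) < ?deg hs" if "?deg hs > 0" for es hs
  proof (cases "pv \<phi> x (?M es hs) = 0")
    case False
    show ?thesis
      using degree_pv_less[OF False] length_lrem[OF ltrim(1)[OF that], of es] ltrim(2)[OF that] by linarith
  qed (use that in auto)
  obtain G' where "finite G' \<and> G \<subseteq> G' \<and> (\<forall>hs\<in>G'. ?deg hs > 0 \<longrightarrow>
      lderiv hs \<in> G' \<and> (\<forall>es\<in>G'. ?deg hs \<le> ?deg es \<longrightarrow> ?M es hs \<in> G'))"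
    using finite_closure_degree[where deg = ?deg and D = lderiv and M = ?M, OF fin D M] ..
  then have G': "finite G'" "G \<subseteq> G'"
    "\<And>hs. hs \<in> G' \<Longrightarrow> ?deg hs > 0 \<Longrightarrow> lderiv hs \<in> G'"
    "\<And>es hs. es \<in> G' \<Longrightarrow> hs \<in> G' \<Longrightarrow> ?deg hs > 0 \<Longrightarrow> ?deg hs \<le> ?deg es \<Longrightarrow> ?M es hs \<in> G'"
    by simp_all
  have "\<exists>z. \<forall>es\<in>G. sg (poly (pv \<phi> x es) y) = sg (poly (pv (\<lambda>r. r) b es) z)"
    if S: "\<forall>e\<in>\<Union> (set ` G'). sg (ev \<phi> x e) = sg (ev (\<lambda>r. r) b e)" for b :: "'v \<Rightarrow> real" and y
  proof -
    let ?Q = "(\<lambda>es. (pv \<phi> x es, pv (\<lambda>r. r) b es)) ` G'"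
    have S': "sg (ev \<phi> x e) = sg (ev (\<lambda>r. r) b e)" if "e \<in> set es" "es \<in> G'" for e es
      using S that by blast
    have "\<exists>R. table ?Q R"
    proof (rule table_exists)
      show "finite ?Q" using G' by simp
      show "sg (coeff f i) = sg (coeff g i)" if fg: "(f,g) \<in> ?Q" for f g i
      proof -
        obtain es where es: "es \<in> G'" "f = pv \<phi> x es" "g = pv (\<lambda>r. r) b es" using fg by auto
        then show ?thesis using S'[OF nth_mem, of i es] by (simp add: coeff_pv)
      qed
      show "(pderiv f, pderiv g) \<in> ?Q" if fg: "(f,g) \<in> ?Q" "degree f > 0" for f g
      proof -
        obtain es where es: "es \<in> G'" "f = pv \<phi> x es" "g = pv (\<lambda>r. r) b es" using fg by auto
        then have "lderiv es \<in> G'" using G'(3) fg by simp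
        then show ?thesis
          using es by (intro image_eqI[of _ _ "lderiv es"]) (simp_all add: pv_lderiv[OF hom] pv_lderiv[OF real_hom_id])
      qed
      show "\<exists>(r,r')\<in>?Q. degree r < degree h \<and> (\<forall>t. poly h t = 0 \<longrightarrow> sg (poly f t) = sg (poly r t)) \<and>
          (\<forall>s. poly k s = 0 \<longrightarrow> sg (poly g s) = sg (poly r' s))"
        if fg: "(f,g) \<in> ?Q" "(h,k) \<in> ?Q" "degree h > 0" "degree h \<le> degree f" for f g h k
      proof -
        obtain es where es: "es \<in> G'" "f = pv \<phi> x es" "g = pv (\<lambda>r. r) b es" using fg by auto
        obtain hs where hs: "hs \<in> G'" "h = pv \<phi> x hs" "k = pv (\<lambda>r. r) b hs" using fg by auto
        let ?h = "ltrim \<phi> x hs"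
        have d: "?deg hs > 0" using fg hs by simp
        note lt = ltrim[OF d]
        \<comment> \<open>Agreement of signs carries non-vanishing of the leading coefficient to
          \<open>b\<close>, so the same syntactic remainder works over the reals.\<close>
        have e0: "ev (\<lambda>r. r) b (last ?h) \<noteq> 0"
          using sg_eqD(3)[OF S'[OF lt(4) hs(1)]] lt(3) by simp
        have h: "h = pv \<phi> x ?h" "k = pv (\<lambda>r. r) b ?h"
          using pv_ltrim[of hs \<phi> x \<phi> x] pv_ltrim[of hs \<phi> x "\<lambda>r. r" b, OF S'[OF _ hs(1)]] hs(2,3)
          by simp_all
        have "?M es hs \<in> G'" using G'(4)[OF es(1) hs(1) d] es hs fg by simp
        moreover have "degree (pv \<phi> x (?M es hs)) < degree h" using M[OF d] hs by simp
        moreover have "sg (poly f t) = sg (poly (pv \<phi> x (?M es hs)) t)" if "poly h t = 0" for t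
          unfolding es(2) using that[unfolded h(1)] by (rule sg_poly_pv_lrem[OF hom lt(1,3)])
        moreover have "sg (poly g s) = sg (poly (pv (\<lambda>r. r) b (?M es hs)) s)" if "poly k s = 0" for s
          unfolding es(3) using that[unfolded h(2)] by (rule sg_poly_pv_lrem[OF real_hom_id lt(1) e0])
        ultimately show ?thesis
          by (intro bexI[of _ "(pv \<phi> x (?M es hs), pv (\<lambda>r. r) b (?M es hs))"]) (simp, blast)
      qed
    qed
    then obtain R where R: "table ?Q R" ..
    from ex_cell[OF tableD(1)[OF R]] obtain z where "cell R y z" ..
    then have "sg (poly (pv \<phi> x es) y) = sg (poly (pv (\<lambda>r. r) b es) z)" if "es \<in> G" for es
      using tableD(2)[OF R, of "pv \<phi> x es" "pv (\<lambda>r. r) b es"] that G'(2) by auto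
    then show ?thesis by blast
  qed
  then have "\<forall>b. (\<forall>e\<in>\<Union> (set ` G'). sg (ev \<phi> x e) = sg (ev (\<lambda>r. r) b e)) \<longrightarrow>
    (\<forall>y. \<exists>z. \<forall>es\<in>G. sg (poly (pv \<phi> x es) y) = sg (poly (pv (\<lambda>r. r) b es) z))" by blast
  moreover have "finite (\<Union> (set ` G'))" using G'(1) by simp
  ultimately show ?thesis by blast
qed

primrec as_poly :: "'v \<Rightarrow> 'v rexp \<Rightarrow> 'v rexp list" where
  "as_poly m (Const c) = [Const c]"
| "as_poly m (Var i) = (if i = m then [Const 0, Const 1] else [Var i])"
| "as_poly m (Neg e) = map Neg (as_poly m e)"
| "as_poly m (Add e f) = ladd (as_poly m e) (as_poly m f)"
| "as_poly m (Mul e f) = lmul (as_poly m e) (as_poly m f)"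

lemma poly_as_poly:
  assumes "real_hom \<phi>"
  shows "poly (pv \<phi> x (as_poly m e)) y = ev \<phi> (x(m := y)) e"
  by (induction e)
     (simp_all add: real_hom_simps[OF assms] pv_map_Neg pv_ladd pv_lmul[OF assms])

text \<open>The one-variable step asks for agreement on a new finite set \<open>S'\<close> in fewer
  variables, so \<open>S\<close> is arbitrary in the induction. Variables outside the finite set
  \<open>V\<close> are set to zero because the type of variables may be infinite; later it is the
  field itself.\<close>

theorem sign_transfer:
  fixes \<phi> :: "real \<Rightarrow> 'a::rcf" and x :: "'v \<Rightarrow> 'a"
  assumes hom: "real_hom \<phi>" and V: "finite V" and S: "finite S"
  shows "\<exists>b. \<forall>e\<in>S. sg (ev \<phi> (\<lambda>i. if i \<in> V then x i else 0) e) = sg (ev (\<lambda>r. r) b e)"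
  using V S
proof (induction V arbitrary: S rule: finite_induct)
  case empty
  have "ev \<phi> (\<lambda>_. 0) e = \<phi> (ev (\<lambda>r. r) (\<lambda>_. 0) e)" for e :: "'v rexp"
    by (induction e) (simp_all add: real_hom_simps[OF hom])
  then show ?case using sg_real_hom[OF hom] by (intro exI[of _ "\<lambda>_. 0"]) simp
next
  case (insert m V)
  let ?x = "\<lambda>i. if i \<in> V then x i else 0"
  have "finite (as_poly m ` S)" using insert.prems by simp
  from sign_transfer_step[OF hom this, of ?x]
  obtain S' where S': "finite S'" "\<And>b y. \<forall>e\<in>S'. sg (ev \<phi> ?x e) = sg (ev (\<lambda>r. r) b e) \<Longrightarrow>
    \<exists>z. \<forall>es\<in>as_poly m ` S. sg (poly (pv \<phi> ?x es) y) = sg (poly (pv (\<lambda>r. r) b es) z)"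
    by auto
  obtain b where "\<forall>e\<in>S'. sg (ev \<phi> ?x e) = sg (ev (\<lambda>r. r) b e)" using insert.IH[OF S'(1)] ..
  then obtain z where "\<forall>es\<in>as_poly m ` S. sg (poly (pv \<phi> ?x es) (x m)) = sg (poly (pv (\<lambda>r. r) b es) z)"
    using S'(2) by blast
  then have "\<forall>e\<in>S. sg (ev \<phi> (?x(m := x m)) e) = sg (ev (\<lambda>r. r) (b(m := z)) e)"
    by (simp add: poly_as_poly[OF hom] poly_as_poly[OF real_hom_id])
  moreover have "?x(m := x m) = (\<lambda>i. if i \<in> insert m V then x i else 0)" by auto
  ultimately show ?case by metis
qed

subsection \<open>Orderings and the real closure\<close>

text \<open>A cone \<open>T\<close> encodes an ordered-field candidate inside an ambient field: the subfield is
  \<open>T - T\<close>, and all its squares lie in \<open>T\<close>.\<close>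

definition ordering_cone :: "'c::field set \<Rightarrow> bool" where
  "ordering_cone T \<longleftrightarrow> 1 \<in> T \<and> - 1 \<notin> T \<and> (\<forall>a\<in>T. inverse a \<in> T) \<and>
     (\<forall>a\<in>T. \<forall>b\<in>T. a + b \<in> T \<and> a * b \<in> T \<and> (a - b) * (a - b) \<in> T)"

definition diff_field :: "'c::field set \<Rightarrow> 'c set" where
  "diff_field T = {a - b | a b. a \<in> T \<and> b \<in> T}"

definition max_cone :: "'c::field set \<Rightarrow> bool" where
  "max_cone T \<longleftrightarrow> ordering_cone T \<and> (\<forall>T'. ordering_cone T' \<longrightarrow> T \<subseteq> T' \<longrightarrow> T' = T)"

lemma ordering_coneD:
  assumes "ordering_cone T"
  shows "1 \<in> T" "- 1 \<notin> T" "a \<in> T \<Longrightarrow> inverse a \<in> T" "a \<in> T \<Longrightarrow> b \<in> T \<Longrightarrow> a + b \<in> T"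
    "a \<in> T \<Longrightarrow> b \<in> T \<Longrightarrow> a * b \<in> T" "a \<in> T \<Longrightarrow> b \<in> T \<Longrightarrow> (a - b) * (a - b) \<in> T" "0 \<in> T"
proof -
  show *: "1 \<in> T" "- 1 \<notin> T" "a \<in> T \<Longrightarrow> inverse a \<in> T" "a \<in> T \<Longrightarrow> b \<in> T \<Longrightarrow> a + b \<in> T"
    "a \<in> T \<Longrightarrow> b \<in> T \<Longrightarrow> a * b \<in> T" "a \<in> T \<Longrightarrow> b \<in> T \<Longrightarrow> (a - b) * (a - b) \<in> T" for a b
    using assms by (auto simp: ordering_cone_def)
  show "0 \<in> T" using *(6)[of 1 1] *(1) by simp
qed

lemma max_cone_exists:
  assumes "ordering_cone T0"
  shows "\<exists>T. T0 \<subseteq> T \<and> max_cone T"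
proof -
  have "\<exists>M\<in>{T. ordering_cone T \<and> T0 \<subseteq> T}. \<forall>Y\<in>{T. ordering_cone T \<and> T0 \<subseteq> T}. M \<subseteq> Y \<longrightarrow> Y = M"
  proof (rule subset_Zorn_nonempty)
    show "{T. ordering_cone T \<and> T0 \<subseteq> T} \<noteq> {}" using assms by blast
    fix C assume C: "C \<noteq> {}" "subset.chain {T. ordering_cone T \<and> T0 \<subseteq> T} C"
    have cones: "ordering_cone T \<and> T0 \<subseteq> T" if "T \<in> C" for T
      using subsetD[OF conjunct1[OF C(2)[unfolded subset_chain_def]] that] by simp
    have two: "\<exists>T\<in>C. a \<in> T \<and> b \<in> T" if "a \<in> \<Union> C" "b \<in> \<Union> C" for a b
    proof -
      from that obtain A B where AB: "A \<in> C" "a \<in> A" "B \<in> C" "b \<in> B" by auto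
      then have "A \<subseteq> B \<or> B \<subseteq> A"
        using conjunct2[OF C(2)[unfolded subset_chain_def]] by simp
      then show ?thesis using AB by auto
    qed
    have "ordering_cone (\<Union> C)"
      unfolding ordering_cone_def
    proof (intro conjI ballI)
      obtain T where "T \<in> C" using C(1) by auto
      then show "1 \<in> \<Union> C" using ordering_coneD(1)[of T] cones by auto
      show "- 1 \<notin> \<Union> C"
      proof
        assume "- 1 \<in> \<Union> C"
        then obtain T where "T \<in> C" "- 1 \<in> T" by auto
        then show False using ordering_coneD(2)[of T] cones by auto
      qed
    next
      fix a assume "a \<in> \<Union> C"
      then obtain T where "T \<in> C" "a \<in> T" by auto
      then show "inverse a \<in> \<Union> C" using ordering_coneD(3)[of T a] cones by auto
    next
      fix a b assume "a \<in> \<Union> C" "b \<in> \<Union> C"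
      then obtain T where "T \<in> C" "a \<in> T" "b \<in> T" using two[of a b] by auto
      then show "a + b \<in> \<Union> C" "a * b \<in> \<Union> C" "(a - b) * (a - b) \<in> \<Union> C"
        using cones[of T] ordering_coneD(4-6)[of T a b] by auto
    qed
    moreover have "T0 \<subseteq> \<Union> C" using C(1) cones by fast
    ultimately show "\<Union> C \<in> {T. ordering_cone T \<and> T0 \<subseteq> T}" by simp
  qed
  then obtain M where M: "ordering_cone M" "T0 \<subseteq> M"
    "\<forall>Y\<in>{T. ordering_cone T \<and> T0 \<subseteq> T}. M \<subseteq> Y \<longrightarrow> Y = M" by auto
  then have "max_cone M" by (simp add: max_cone_def)
  then show ?thesis using M(2) by (intro exI conjI)
qed

context
  fixes T :: "'c::field set"
  assumes T: "ordering_cone T"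
begin

lemma diff_fieldI: "a \<in> T \<Longrightarrow> b \<in> T \<Longrightarrow> a - b \<in> diff_field T"
  by (auto simp: diff_field_def)

lemma diff_fieldE:
  assumes "u \<in> diff_field T"
  obtains a b where "u = a - b" "a \<in> T" "b \<in> T"
  using assms by (auto simp: diff_field_def)

lemma cone_subset_diff_field: "a \<in> T \<Longrightarrow> a \<in> diff_field T"
  using diff_fieldI[of a 0] ordering_coneD(7)[OF T] by simp

lemma diff_field_square: "u \<in> diff_field T \<Longrightarrow> u * u \<in> T"
  by (elim diff_fieldE) (use ordering_coneD(6)[OF T] in simp)

lemma diff_field_uminus: "u \<in> diff_field T \<Longrightarrow> - u \<in> diff_field T"
  by (elim diff_fieldE) (use diff_fieldI in simp)

lemma diff_field_add:
  assumes "u \<in> diff_field T" "v \<in> diff_field T"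
  shows "u + v \<in> diff_field T"
proof -
  obtain a b where u: "u = a - b" "a \<in> T" "b \<in> T" using assms(1) by (rule diff_fieldE)
  obtain c d where v: "v = c - d" "c \<in> T" "d \<in> T" using assms(2) by (rule diff_fieldE)
  have "u + v = (a + c) - (b + d)" by (simp add: u v)
  then show ?thesis using diff_fieldI[OF ordering_coneD(4)[OF T u(2) v(2)] ordering_coneD(4)[OF T u(3) v(3)]] by simp
qed

lemma diff_field_mult:
  assumes "u \<in> diff_field T" "v \<in> diff_field T"
  shows "u * v \<in> diff_field T"
proof -
  obtain a b where u: "u = a - b" "a \<in> T" "b \<in> T" using assms(1) by (rule diff_fieldE)
  obtain c d where v: "v = c - d" "c \<in> T" "d \<in> T" using assms(2) by (rule diff_fieldE)
  have "u * v = (a * c + b * d) - (a * d + b * c)" by (simp add: u v algebra_simps)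
  moreover have "a * c + b * d \<in> T" "a * d + b * c \<in> T"
    by (intro ordering_coneD(4)[OF T] ordering_coneD(5)[OF T] u v)+
  ultimately show ?thesis using diff_fieldI by simp
qed

lemma diff_field_inverse:
  assumes "u \<in> diff_field T"
  shows "inverse u \<in> diff_field T"
proof -
  \<comment> \<open>A cone contains the inverses of its own elements only, hence the detour through
    the square.\<close>
  have "inverse (u * u) \<in> diff_field T"
    using ordering_coneD(3)[OF T] diff_field_square[OF assms] cone_subset_diff_field by blast
  then have "u * inverse (u * u) \<in> diff_field T" using assms diff_field_mult by blast
  then show ?thesis by (cases "u = 0") (simp_all add: field_simps)
qed

lemma cone_antisym:
  assumes "a \<in> T" "- a \<in> T"
  shows "a = 0"
proof (rule ccontr)
  assume "a \<noteq> 0"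
  then have "- a * inverse a = - 1" by simp
  then show False using ordering_coneD(2)[OF T] ordering_coneD(5)[OF T assms(2) ordering_coneD(3)[OF T assms(1)]] by simp
qed

end

text \<open>\<open>T'\<close> adjoins \<open>- a\<close> to \<open>T\<close>. If \<open>- 1\<close>
  were in it, then \<open>a\<close> would be a quotient \<open>(1 + s) / t\<close> of elements of
  \<open>T\<close> and so lie in \<open>T\<close>. Otherwise \<open>T'\<close> is a cone, and
  maximality puts \<open>- a\<close> into \<open>T\<close>.\<close>

lemma max_cone_total:
  assumes max: "max_cone T" and a: "a \<in> diff_field T"
  shows "a \<in> T \<or> - a \<in> T"
proof (rule ccontr)
  assume not: "\<not> ?thesis"
  have T: "ordering_cone T" using max by (simp add: max_cone_def)
  note D = ordering_coneD[OF T]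
  define T' where "T' = {s - a * t | s t. s \<in> T \<and> t \<in> T}"
  have I: "u \<in> T'" if "u = s - a * t" "s \<in> T" "t \<in> T" for u s t
    using that by (auto simp: T'_def)
  have sub: "u \<in> diff_field T" if u: "u \<in> T'" for u
  proof -
    obtain s t where "u = s + - (a * t)" "s \<in> T" "t \<in> T" using u by (auto simp: T'_def)
    then show ?thesis
      using diff_field_add[OF T cone_subset_diff_field[OF T] diff_field_uminus[OF T diff_field_mult[OF T a
        cone_subset_diff_field[OF T]]]] by simp
  qed
  have TT': "T \<subseteq> T'" using I[of _ _ 0] D by auto
  have mult: "u * v \<in> T'" if uv: "u \<in> T'" "v \<in> T'" for u v
  proof -
    obtain s t where u: "u = s - a * t" "s \<in> T" "t \<in> T" using uv(1) by (auto simp: T'_def)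
    obtain p q where v: "v = p - a * q" "p \<in> T" "q \<in> T" using uv(2) by (auto simp: T'_def)
    have "u * v = (s * p + (a * a) * (t * q)) - a * (s * q + t * p)"
      by (simp add: u v algebra_simps)
    moreover have "s * p + (a * a) * (t * q) \<in> T" "s * q + t * p \<in> T"
      by (intro D(4) D(5) u v diff_field_square[OF T a])+
    ultimately show ?thesis by (rule I)
  qed
  have "ordering_cone T'"
    unfolding ordering_cone_def
  proof (intro conjI ballI)
    show "1 \<in> T'" using TT' D by auto
    show "- 1 \<notin> T'"
    proof
      assume "- 1 \<in> T'"
      then obtain s t where st: "- 1 = s - a * t" "s \<in> T" "t \<in> T" by (auto simp: T'_def)
      then have at: "a * t = 1 + s" by (simp add: algebra_simps)
      have "t \<noteq> 0" using st D by auto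
      then have "a = (1 + s) * inverse t" using at by (simp add: field_simps)
      then have "a \<in> T" using D(1,3,4,5) st by simp
      then show False using not by simp
    qed
    fix u assume u: "u \<in> T'"
    have "inverse u * inverse u \<in> T'"
      using TT' diff_field_square[OF T diff_field_inverse[OF T sub[OF u]]] by blast
    then have "u * (inverse u * inverse u) \<in> T'" using mult u by blast
    then show "inverse u \<in> T'" by (cases "u = 0") (simp_all add: mult.assoc[symmetric])
    fix v assume v: "v \<in> T'"
    show "u * v \<in> T'" using mult u v .
    obtain s t p q where *: "u = s - a * t" "s \<in> T" "t \<in> T" "v = p - a * q" "p \<in> T" "q \<in> T"
      using u v by (auto simp: T'_def)
    have "u + v = (s + p) - a * (t + q)" by (simp add: *(1,4) algebra_simps)
    then show "u + v \<in> T'" by (rule I) (intro D(4) *)+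
    have "u + - v \<in> diff_field T" using sub u v diff_field_add[OF T] diff_field_uminus[OF T] by blast
    then show "(u - v) * (u - v) \<in> T'" using diff_field_square[OF T] TT' by auto
  qed
  then have "T' = T" using max TT' by (simp add: max_cone_def)
  moreover have "- a \<in> T'" using I[of _ 0 1] D by simp
  ultimately show False using not by simp
qed

section \<open>Sums of squares of polynomials with non-negative weights\<close>

text \<open>The weights \<open>c\<close> make the values at any point contain all non-negative
  scalars, which at this stage are not known to be squares.\<close>

inductive_set sos :: "'a::linordered_field poly set" where
  zero: "0 \<in> sos"
| add: "c \<ge> 0 \<Longrightarrow> s \<in> sos \<Longrightarrow> smult c (g * g) + s \<in> sos"

lemma sos_square: "c \<ge> 0 \<Longrightarrow> smult c (g * g) \<in> sos"
  using sos.add[OF _ sos.zero, of c g] by simp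

lemma sos_add: "s \<in> sos \<Longrightarrow> s' \<in> sos \<Longrightarrow> s + s' \<in> sos"
  by (induction rule: sos.induct) (auto simp: add.assoc intro: sos.intros)

lemma sos_mult_square: "s \<in> sos \<Longrightarrow> c \<ge> 0 \<Longrightarrow> smult c (g * g) * s \<in> sos"
proof (induction rule: sos.induct)
  case (add d s h)
  have "smult c (g * g) * (smult d (h * h) + s) = smult (c * d) ((g * h) * (g * h)) + smult c (g * g) * s"
    by (simp add: algebra_simps smult_add_right)
  then show ?case using add sos.add[of "c * d" _ "g * h"] by simp
qed (auto intro: sos.zero)

lemma sos_mult: "s \<in> sos \<Longrightarrow> s' \<in> sos \<Longrightarrow> s * s' \<in> sos"
proof (induction rule: sos.induct)
  case (add c s g)
  then show ?case using sos_add[OF sos_mult_square[OF add.prems] add.IH] by (simp add: distrib_right)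
qed (auto intro: sos.zero)

lemma poly_sos_nonneg: "s \<in> sos \<Longrightarrow> poly s y \<ge> 0"
  by (induction rule: sos.induct) auto

text \<open>Each \<open>g\<close> is reduced modulo \<open>p\<close> before squaring. This bounds
  the degree by twice \<open>degree p - 1\<close>, the bound on which the descent below
  rests.\<close>

lemma sos_reduce:
  assumes "s \<in> sos" and d: "degree p > 0"
  shows "\<exists>s'\<in>sos. p dvd s - s' \<and> degree s' \<le> 2 * (degree p - 1)"
  using assms(1)
proof (induction rule: sos.induct)
  case zero
  then show ?case by (intro bexI[of _ 0]) (auto intro: sos.zero)
next
  case (add c s g)
  then obtain s' where s': "s' \<in> sos" "p dvd s - s'" "degree s' \<le> 2 * (degree p - 1)" by blast
  let ?r = "g mod p"
  have "p \<noteq> 0" using d by auto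
  then have "degree ?r \<le> degree p - 1" using degree_mod_less'[of p g] d by fastforce
  then have "degree (?r * ?r) \<le> 2 * (degree p - 1)" using degree_mult_le[of ?r ?r] by linarith
  then have "degree (smult c (?r * ?r)) \<le> 2 * (degree p - 1)"
    by (rule order_trans[OF degree_smult_le])
  then have "degree (smult c (?r * ?r) + s') \<le> 2 * (degree p - 1)"
    using s'(3) by (rule degree_add_le)
  moreover have "smult c (?r * ?r) + s' \<in> sos" using add s' sos.add by blast
  moreover have "p dvd g - ?r" by (simp add: minus_mod_eq_mult_div)
  \<comment> \<open>The difference of the squares of \<open>g\<close> and \<open>?r\<close> factors
    as \<open>(g - ?r) * (g + ?r)\<close>.\<close>
  then have "p dvd smult c ((g - ?r) * (g + ?r)) + (s - s')" using s'(2) by (intro dvd_add dvd_smult dvd_mult2)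
  then have "p dvd smult c (g * g) + s - (smult c (?r * ?r) + s')"
    by (simp add: algebra_simps smult_add_right smult_diff_right)
  ultimately show ?case by blast
qed

text \<open>The failure of \<open>ex_real_point\<close>, transported to the algebraic closure. The
  variables of the expressions are elements of the field, each standing for itself.\<close>

definition bad_cone :: "'k::real_field alg_closure set \<Rightarrow> bool" where
  "bad_cone T \<longleftrightarrow> (\<forall>k. to_ac (k * k) \<in> T) \<and>
     (\<exists>S :: 'k rexp set. finite S \<and> (\<forall>e\<in>S. to_ac (ev of_real (\<lambda>k. k) e) \<in> T - {0}) \<and>
        \<not> (\<exists>b::'k \<Rightarrow> real. \<forall>e\<in>S. ev (\<lambda>r. r) b e > 0))"

text \<open>A type cannot depend on a locally given cone.  Therefore the type \<open>rc\<close> of the real closure is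
  built from one globally chosen maximal cone, a counterexample to \<open>ex_real_point\<close> below if there
  is any.\<close>

definition the_cone :: "'k::real_field alg_closure set" where
  "the_cone = (SOME T. max_cone T \<and> ((\<exists>T'::'k alg_closure set. max_cone T' \<and> bad_cone T') \<longrightarrow> bad_cone T))"

text \<open>A starting point for Zorn's lemma, so that a maximal cone can be chosen even when no bad
  one exists.\<close>

lemma cone_reals: "ordering_cone ((\<lambda>r. to_ac (of_real r :: 'k::real_field)) ` {0..})"
proof -
  let ?f = "\<lambda>r. to_ac (of_real r :: 'k)"
  have I: "u \<in> ?f ` {0..}" if "u = ?f r" "r \<ge> 0" for u r using that by auto
  show ?thesis
    unfolding ordering_cone_def
  proof (intro conjI ballI)
    show "1 \<in> ?f ` {0..}" by (rule I[of _ 1]) auto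
    show "- 1 \<notin> ?f ` {0..}"
    proof
      assume "- 1 \<in> ?f ` {0..}"
      then obtain r where r: "- 1 = ?f r" "r \<ge> 0" by auto
      then have "?f (r + 1) = 0" by (simp flip: r(1))
      then have "r + 1 = 0" by (simp only: to_ac_eq_0_iff of_real_eq_0_iff)
      then show False using r by simp
    qed
    fix a assume "a \<in> ?f ` {0..}"
    then obtain r where r: "a = ?f r" "r \<ge> 0" by auto
    then show "inverse a \<in> ?f ` {0..}" by (intro I[of _ "inverse r"]) auto
    fix b assume "b \<in> ?f ` {0..}"
    then obtain s where s: "b = ?f s" "s \<ge> 0" by auto
    show "a + b \<in> ?f ` {0..}" using r s by (intro I[of _ "r + s"]) auto
    show "a * b \<in> ?f ` {0..}" using r s by (intro I[of _ "r * s"]) auto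
    show "(a - b) * (a - b) \<in> ?f ` {0..}" using r s by (intro I[of _ "(r - s) * (r - s)"]) auto
  qed
qed

lemma the_cone:
  shows max_cone_the_cone: "max_cone (the_cone :: 'k::real_field alg_closure set)"
    and bad_cone_the_cone: "max_cone (T :: 'k alg_closure set) \<Longrightarrow> bad_cone T \<Longrightarrow> bad_cone (the_cone :: 'k alg_closure set)"
proof -
  have "\<exists>T::'k alg_closure set. max_cone T \<and> ((\<exists>T'::'k alg_closure set. max_cone T' \<and> bad_cone T') \<longrightarrow> bad_cone T)"
  proof (cases "\<exists>T'::'k alg_closure set. max_cone T' \<and> bad_cone T'")
    case False
    obtain T :: "'k alg_closure set" where "max_cone T"
      using max_cone_exists[OF cone_reals[where 'k = 'k]] by auto
    then show ?thesis using False by (intro exI[of _ T]) simp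
  qed auto
  note * = someI_ex[OF this, folded the_cone_def]
  show "max_cone (the_cone :: 'k alg_closure set)" using * by (rule conjunct1)
  show "bad_cone (the_cone :: 'k alg_closure set)" if "max_cone T" "bad_cone T"
    using conjunct2[OF *] that by auto
qed

lemma cone_the_cone: "ordering_cone the_cone"
  by (rule max_cone_the_cone[unfolded max_cone_def, THEN conjunct1])

lemmas the_cone_simps = ordering_coneD[OF cone_the_cone]

lemma diff_field_0_1: "ordering_cone T \<Longrightarrow> 0 \<in> diff_field T" "ordering_cone T \<Longrightarrow> 1 \<in> diff_field T"
  using ordering_coneD(1,7) cone_subset_diff_field by metis+

section \<open>The ordered field carried by the chosen cone\<close>

typedef (overloaded) 'k rc = "diff_field (the_cone :: 'k::real_field alg_closure set)"
  using diff_field_0_1 cone_the_cone by blast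

instantiation rc :: (real_field) linordered_field
begin

definition "0 = Abs_rc 0"
definition "1 = Abs_rc 1"
definition "x + y = Abs_rc (Rep_rc x + Rep_rc y)"
definition "x - y = Abs_rc (Rep_rc x - Rep_rc y)"
definition "- x = Abs_rc (- Rep_rc x)"
definition "x * y = Abs_rc (Rep_rc x * Rep_rc y)"
definition "inverse x = Abs_rc (inverse (Rep_rc x))"
definition "x div y = Abs_rc (Rep_rc x / Rep_rc y)"
definition "x \<le> y \<longleftrightarrow> Rep_rc y - Rep_rc x \<in> the_cone"
definition "x < y \<longleftrightarrow> x \<le> y \<and> x \<noteq> (y :: 'a rc)"
definition "\<bar>x :: 'a rc\<bar> = (if x < 0 then - x else x)"
definition "sgn (x :: 'a rc) = (if x = 0 then 0 else if 0 < x then 1 else - 1)"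

lemma Rep_rc_simps:
  "Rep_rc 0 = 0" "Rep_rc 1 = 1" "Rep_rc (x + y) = Rep_rc x + Rep_rc y"
  "Rep_rc (x - y) = Rep_rc x - Rep_rc y" "Rep_rc (- x) = - Rep_rc x"
  "Rep_rc (x * y) = Rep_rc x * Rep_rc y" "Rep_rc (inverse x) = inverse (Rep_rc x)"
  "Rep_rc (x div y) = Rep_rc x / Rep_rc y"
proof -
  note F = diff_field_add[OF cone_the_cone] diff_field_mult[OF cone_the_cone]
    diff_field_uminus[OF cone_the_cone] diff_field_inverse[OF cone_the_cone]
    diff_field_0_1[OF cone_the_cone]
  have sub: "Rep_rc x - Rep_rc y \<in> diff_field the_cone" for x y :: "'a rc"
    using F(1)[OF Rep_rc[of x] F(3)[OF Rep_rc[of y]]] by simp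
  have divi: "Rep_rc x / Rep_rc y \<in> diff_field the_cone" for x y :: "'a rc"
    using F(2)[OF Rep_rc[of x] F(4)[OF Rep_rc[of y]]] by (simp add: divide_inverse)
  show "Rep_rc 0 = 0" "Rep_rc 1 = 1" "Rep_rc (x + y) = Rep_rc x + Rep_rc y"
    "Rep_rc (x - y) = Rep_rc x - Rep_rc y" "Rep_rc (- x) = - Rep_rc x"
    "Rep_rc (x * y) = Rep_rc x * Rep_rc y" "Rep_rc (inverse x) = inverse (Rep_rc x)"
    "Rep_rc (x div y) = Rep_rc x / Rep_rc y"
    unfolding zero_rc_def one_rc_def plus_rc_def minus_rc_def uminus_rc_def times_rc_def
      inverse_rc_def divide_rc_def
    by (simp_all add: Abs_rc_inverse F Rep_rc sub divi)
qed

instance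
proof
  fix x y z :: "'a rc"
  note eq = Rep_rc_inject[symmetric]
  show "x + y + z = x + (y + z)" "x + y = y + x" "0 + x = x" "- x + x = 0" "x - y = x + - y"
    "x * y * z = x * (y * z)" "x * y = y * x" "1 * x = x" "(x + y) * z = x * z + y * z"
    "(0 :: 'a rc) \<noteq> 1" "x + y - x = y" "x - y - z = x - (y + z)" "0 * x = 0" "x * 0 = 0" "x div y = x * inverse y" "inverse (0 :: 'a rc) = 0"
    by (simp_all add: eq Rep_rc_simps algebra_simps divide_inverse)
  show "inverse x * x = 1" if "x \<noteq> 0" using that by (simp add: eq Rep_rc_simps)
  show "x \<le> x" by (simp add: less_eq_rc_def the_cone_simps)
  show trans: "x \<le> z" if "x \<le> y" "y \<le> z"
    using the_cone_simps(4)[OF that[unfolded less_eq_rc_def]] by (simp add: less_eq_rc_def)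
  show antisym: "x = y" if "x \<le> y" "y \<le> x"
    using cone_antisym[OF cone_the_cone, of "Rep_rc y - Rep_rc x"] that by (simp add: eq less_eq_rc_def)
  show "x < y \<longleftrightarrow> x \<le> y \<and> \<not> y \<le> x" using antisym by (auto simp: less_rc_def less_eq_rc_def the_cone_simps)
  show "x \<le> y \<or> y \<le> x"
    using max_cone_total[OF max_cone_the_cone Rep_rc[of "y - x"]] by (simp add: less_eq_rc_def Rep_rc_simps)
  show "z + x \<le> z + y" if "x \<le> y" using that by (simp add: less_eq_rc_def Rep_rc_simps)
  show "z * x < z * y" if "x < y" "0 < z"
  proof -
    have "(Rep_rc y - Rep_rc x) * Rep_rc z \<in> the_cone" "x \<noteq> y" "z \<noteq> 0"
      using that by (auto simp: less_rc_def less_eq_rc_def Rep_rc_simps the_cone_simps)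
    moreover from this have "z * x \<noteq> z * y" by (simp add: eq Rep_rc_simps)
    ultimately show ?thesis by (simp add: less_rc_def less_eq_rc_def Rep_rc_simps algebra_simps)
  qed
  show "\<bar>x\<bar> = (if x < 0 then - x else x)" "sgn x = (if x = 0 then 0 else if 0 < x then 1 else - 1)"
    by (simp_all add: abs_rc_def sgn_rc_def)
qed

end

lemma Rep_rc_nonneg: "x \<ge> 0 \<longleftrightarrow> Rep_rc x \<in> the_cone"
  by (simp add: less_eq_rc_def Rep_rc_simps)

section \<open>Evaluation of polynomials over \<open>rc\<close> at algebraic elements\<close>

definition eval_at :: "'k::real_field alg_closure \<Rightarrow> 'k rc poly \<Rightarrow> 'k alg_closure" where
  "eval_at t g = poly (map_poly Rep_rc g) t"

lemma eval_at_pCons: "eval_at t (pCons a g) = Rep_rc a + t * eval_at t g"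
  by (cases "a = 0 \<and> g = 0") (auto simp: eval_at_def map_poly_pCons Rep_rc_simps)

lemma eval_at_0 [simp]: "eval_at t 0 = 0"
  by (simp add: eval_at_def)

lemma eval_at_add: "eval_at t (g + h) = eval_at t g + eval_at t h"
  by (induction g h rule: poly_induct2) (simp_all add: eval_at_pCons Rep_rc_simps algebra_simps)

lemma eval_at_smult: "eval_at t (smult c g) = Rep_rc c * eval_at t g"
  by (induction g) (simp_all add: eval_at_pCons Rep_rc_simps algebra_simps)

lemma eval_at_mult: "eval_at t (g * h) = eval_at t g * eval_at t h"
  by (induction g) (simp_all add: eval_at_pCons eval_at_add eval_at_smult Rep_rc_simps algebra_simps)

lemma eval_at_minus: "eval_at t (- g) = - eval_at t g"
  using eval_at_smult[of t "-1" g] by (simp add: Rep_rc_simps)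

lemma eval_at_diff: "eval_at t (g - h) = eval_at t g - eval_at t h"
  using eval_at_add[of t g "-h"] by (simp add: eval_at_minus)

lemma eval_at_1: "eval_at t 1 = 1"
  by (simp add: one_pCons eval_at_pCons Rep_rc_simps)

lemma eval_at_const: "eval_at t [:c:] = Rep_rc c"
  by (simp add: eval_at_pCons)

lemma eval_at_Rep_rc: "eval_at (Rep_rc r) g = Rep_rc (poly g r)"
  by (induction g) (simp_all add: eval_at_pCons Rep_rc_simps)

lemma eval_at_root_exists:
  assumes "degree g > 0"
  shows "\<exists>t. eval_at t g = 0"
proof -
  have "degree (map_poly Rep_rc g) = degree g"
    by (rule degree_map_poly) (metis Rep_rc_inject Rep_rc_simps(1))
  then show ?thesis unfolding eval_at_def using alg_closed_imp_poly_has_root assms by metis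
qed

text \<open>The Artin-Schreier descent: if \<open>p\<close> has a sign change but no root in between, and \<open>p\<close> is of least
  degree, then the sums of squares in the field generated by a root of \<open>p\<close> still form an ordering
  cone, since an equation \<open>p h = 1 + \<Sum> c g\<^sup>2\<close> would produce a sign change of \<open>h\<close>.\<close>

lemma sign_change_linear:
  fixes k :: "'a::linordered_field"
  assumes "poly (smult k [:- r, 1:]) a * poly (smult k [:- r, 1:]) b < 0" "a < b"
  shows "a < r \<and> r < b"
proof (rule ccontr)
  assume "\<not> ?thesis"
  then have "(a - r) * (b - r) \<ge> 0" using assms(2) by (auto simp: zero_le_mult_iff)
  then have "(k * k) * ((a - r) * (b - r)) \<ge> 0" by (rule mult_nonneg_nonneg[OF zero_le_square])
  moreover have "poly (smult k [:- r, 1:]) a * poly (smult k [:- r, 1:]) b = (k * k) * ((a - r) * (b - r))"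
    by (simp add: algebra_simps)
  ultimately show False using assms(1) by simp
qed

lemma rc_descent:
  fixes p :: "'k::real_field rc poly"
  assumes ab: "a < b" and sign: "poly p a * poly p b < 0"
    and IH: "\<And>h. degree h < degree p \<Longrightarrow> poly h a * poly h b < 0 \<Longrightarrow> \<exists>c. a < c \<and> c < b \<and> poly h c = 0"
    and noroot: "\<And>c. a < c \<Longrightarrow> c < b \<Longrightarrow> poly p c \<noteq> 0"
  shows False
proof -
  \<comment> \<open>In a proper factorisation one factor changes sign as well, and by minimality of
    the degree it would give \<open>p\<close> a root in between.\<close>
  have irr: "degree g = 0 \<or> degree h = 0" if gh: "p = g * h" for g h
  proof (rule ccontr)
    assume pos: "\<not> ?thesis"
    then have "g \<noteq> 0" "h \<noteq> 0" by auto
    then have deg: "degree g < degree p" "degree h < degree p"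
      using pos unfolding gh by (simp_all add: degree_mult_eq)
    have "(poly g a * poly g b) * (poly h a * poly h b) < 0"
      using sign unfolding gh by (simp add: algebra_simps)
    then have "poly g a * poly g b < 0 \<or> poly h a * poly h b < 0" by (auto simp: mult_less_0_iff)
    then obtain c where "a < c" "c < b" "poly p c = 0" using IH deg unfolding gh by fastforce
    then show False using noroot by blast
  qed
  have p0: "p \<noteq> 0" using sign by auto
  have dp: "degree p > 0"
  proof (rule ccontr)
    assume "\<not> ?thesis"
    then obtain c where "p = [:c:]" using degree_eq_zeroE by auto
    then show False using sign by (simp add: not_square_less_zero)
  qed
  then obtain t where t: "eval_at t p = 0" using eval_at_root_exists by blast
  \<comment> \<open>Euclid's algorithm as a descent: at \<open>t\<close> the value of
    \<open>g\<close> times that of the quotient is minus the value of the remainder of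
    \<open>p\<close> by \<open>g\<close>, so an inverse for the remainder gives one for
    \<open>g\<close>.\<close>
  have inv_small: "\<exists>u. eval_at t u * eval_at t g = 1" if "g \<noteq> 0" "degree g < degree p" for g
    using that
  proof (induction "degree g" arbitrary: g rule: less_induct)
    case less
    show ?case
    proof (cases "degree g = 0")
      case True
      then obtain c where c: "g = [:c:]" using degree_eq_zeroE by auto
      then have "c \<noteq> 0" using less by auto
      then have "eval_at t [:inverse c:] * eval_at t g = 1"
        unfolding c eval_at_const by (metis Rep_rc_simps(2,6) left_inverse)
      then show ?thesis by blast
    next
      case False
      let ?r = "p mod g" and ?q = "p div g"
      have pq: "p = g * ?q + ?r" by simp
      have r0: "?r \<noteq> 0"
      proof
        assume "?r = 0"
        then have g: "p = g * ?q" using pq by simp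
        then have "?q \<noteq> 0" using p0 by (metis mult_zero_right)
        then have "degree p = degree g + degree ?q"
          using g degree_mult_eq[OF less.prems(1)] by metis
        moreover have "degree ?q = 0" using irr[OF g] False by simp
        ultimately show False using less by simp
      qed
      then have "degree ?r < degree g" using degree_mod_less' less by blast
      then obtain u where u: "eval_at t u * eval_at t ?r = 1" using less r0 by (meson less_trans)
      have "eval_at t ?r = - (eval_at t g * eval_at t ?q)"
        using t arg_cong[OF pq, of "eval_at t"] unfolding eval_at_add eval_at_mult by (simp add: eq_neg_iff_add_eq_0 add.commute)
      then have "eval_at t (- (u * ?q)) * eval_at t g = 1"
        using u by (simp add: eval_at_minus eval_at_mult algebra_simps)
      then show ?thesis by blast
    qed
  qed
  have reduce: "eval_at t g = eval_at t p * eval_at t (g div p) + eval_at t (g mod p)" for g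
    by (metis eval_at_add eval_at_mult mult_div_mod_eq)
  have dvd: "p dvd g" if "eval_at t g = 0" for g
  proof (rule ccontr)
    assume "\<not> p dvd g"
    then have "g mod p \<noteq> 0" by (simp add: mod_eq_0_iff_dvd)
    moreover from this have "degree (g mod p) < degree p" using degree_mod_less' p0 by blast
    ultimately show False using inv_small[of "g mod p"] reduce[of g] that t by auto
  qed
  have inv: "\<exists>u. eval_at t u = inverse (eval_at t g)" for g
  proof (cases "eval_at t g = 0")
    case True
    then show ?thesis by (intro exI[of _ 0]) simp
  next
    case False
    have g: "eval_at t g = eval_at t (g mod p)"
      using reduce t by simp
    then have "g mod p \<noteq> 0" using False by auto
    moreover from this have "degree (g mod p) < degree p" using degree_mod_less' p0 by blast
    ultimately obtain u where "eval_at t u * eval_at t g = 1" using inv_small g by auto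
    then show ?thesis using False by (metis inverse_unique mult.commute)
  qed
  define T where "T = eval_at t ` sos"
  have I: "eval_at t s \<in> T" if "s \<in> sos" for s using that by (simp add: T_def)
  have sq: "g * g \<in> sos" for g :: "'k rc poly" using sos_square[of 1 g] by simp
  have "ordering_cone T"
    unfolding ordering_cone_def
  proof (intro conjI ballI)
    show "1 \<in> T" using I[OF sq[of 1]] by (simp add: eval_at_1)
    show "- 1 \<notin> T"
    proof
      assume "- 1 \<in> T"
      then obtain s where s: "s \<in> sos" "eval_at t s = - 1" by (auto simp: T_def)
      obtain s' where s': "s' \<in> sos" "p dvd s - s'" "degree s' \<le> 2 * (degree p - 1)"
        using sos_reduce[OF s(1) dp] by blast
      obtain v where v: "s - s' = p * v" using s'(2) by (rule dvdE)
      have "eval_at t s - eval_at t s' = 0"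
        using arg_cong[OF v, of "eval_at t"] t by (simp add: eval_at_diff eval_at_mult)
      then have "eval_at t s' = - 1" using s(2) by simp
      then have "eval_at t (1 + s') = 0" by (simp add: eval_at_add eval_at_1)
      then obtain h where h: "1 + s' = p * h" using dvd by blast
      have pos: "poly (1 + s') y > 0" for y
        using poly_sos_nonneg[OF s'(1), of y] by (simp add: add_pos_nonneg)
      then have "1 + s' \<noteq> 0" by (metis less_irrefl poly_0)
      then have "h \<noteq> 0" using h by auto
      have "degree (1 + s') \<le> 2 * (degree p - 1)" using s'(3) by (intro degree_add_le) auto
      \<comment> \<open>The degrees of \<open>p\<close> and \<open>h\<close> add up to at most twice
        \<open>degree p - 1\<close>, so \<open>h\<close> has degree at most
        \<open>degree p - 2\<close> and the induction hypothesis applies to it.\<close>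
      then have "degree h < degree p"
        using dp unfolding h degree_mult_eq[OF p0 \<open>h \<noteq> 0\<close>] by linarith
      moreover have "(poly p a * poly p b) * (poly h a * poly h b) > 0"
        using mult_pos_pos[OF pos[of a] pos[of b]] unfolding h by (simp add: algebra_simps)
      then have "poly h a * poly h b < 0" using sign
        unfolding zero_less_mult_iff[of "poly p a * poly p b"] by linarith
      ultimately obtain c where "poly h c = 0" using IH by blast
      then show False using pos[of c] unfolding h by simp
    qed
    fix u assume "u \<in> T"
    then obtain s where s: "u = eval_at t s" "s \<in> sos" by (auto simp: T_def)
    obtain i where i: "eval_at t i = inverse u" using inv s by metis
    have "eval_at t (s * (i * i)) \<in> T" using I sos_mult s sq by blast
    then show "inverse u \<in> T"
      by (cases "u = 0") (simp_all add: eval_at_mult i s(1)[symmetric] mult.assoc[symmetric])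
    fix w assume "w \<in> T"
    then obtain s' where s': "w = eval_at t s'" "s' \<in> sos" by (auto simp: T_def)
    show "u + w \<in> T" using I[OF sos_add[OF s(2) s'(2)]] by (simp add: s s' eval_at_add)
    show "u * w \<in> T" using I[OF sos_mult[OF s(2) s'(2)]] by (simp add: s s' eval_at_mult)
    show "(u - w) * (u - w) \<in> T" using I[OF sq[of "s - s'"]] by (simp add: s s' eval_at_mult eval_at_diff)
  qed
  moreover have "the_cone \<subseteq> T"
  proof
    fix w :: "'k alg_closure" assume w: "w \<in> the_cone"
    then obtain c where c: "w = Rep_rc c"
      using cone_subset_diff_field[OF cone_the_cone] by (metis Abs_rc_inverse)
    then have "c \<ge> 0" using w by (simp add: Rep_rc_nonneg)
    then have "smult c (1 * 1) \<in> sos" by (rule sos_square)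
    from I[OF this] show "w \<in> T" by (simp add: c eval_at_const one_pCons eval_at_pCons)
  qed
  \<comment> \<open>Maximality now says that adjoining \<open>t\<close> added nothing. It remains to
    see that \<open>t\<close> itself lies in the field of differences, which makes \<open>p\<close>
    linear with its root between \<open>a\<close> and \<open>b\<close>.\<close>
  ultimately have T: "T = the_cone" using max_cone_the_cone unfolding max_cone_def by blast
  \<comment> \<open>The identity used is
    \<open>t = ((t + 1) / 2)^2 - ((t - 1) / 2)^2\<close>.\<close>
  define c4 :: "'k rc" where "c4 = inverse 4"
  have "c4 \<ge> 0" by (simp add: c4_def)
  define s1 s2 where "s1 = smult c4 ([:1,1:] * [:1,1:])" and "s2 = smult c4 ([:- 1,1:] * [:- 1,1:])"
  have "eval_at t s1 \<in> T" "eval_at t s2 \<in> T"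
    unfolding s1_def s2_def using \<open>c4 \<ge> 0\<close> by (intro I sos_square; simp)+
  moreover have "s1 - s2 = [:0, 1:]" by (simp add: s1_def s2_def c4_def)
  then have "eval_at t s1 - eval_at t s2 = t" 
    using eval_at_diff[of t s1 s2] by (simp add: eval_at_pCons Rep_rc_simps)
  ultimately have "t \<in> diff_field the_cone" unfolding T using diff_fieldI[OF cone_the_cone] by metis
  then obtain r where r: "t = Rep_rc r" by (metis Abs_rc_inverse)
  have "poly p r = 0" using t unfolding r eval_at_Rep_rc by (metis Rep_rc_inject Rep_rc_simps(1))
  then obtain q where q: "p = [:- r, 1:] * q" by (auto simp: poly_eq_0_iff_dvd)
  then have "degree q = 0" using irr[OF q] by simp
  then obtain k where "q = [:k:]" using degree_eq_zeroE by auto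
  then have "p = smult k [:- r, 1:]" using q by simp
  then have "a < r \<and> r < b" using sign_change_linear ab sign by blast
  then show False using noroot \<open>poly p r = 0\<close> by blast
qed

instance rc :: (real_field) rcf
proof
  fix a b :: "'a rc" and f :: "nat \<Rightarrow> 'a rc" and n
  assume *: "a < b" "(\<Sum>k\<le>n. f k * a ^ k) < 0" "(\<Sum>k\<le>n. f k * b ^ k) > 0"
  have "\<exists>c. a < c \<and> c < b \<and> poly p c = 0" if "poly p a * poly p b < 0" for p
    using that
  proof (induction "degree p" arbitrary: p rule: less_induct)
    case less
    then show ?case using rc_descent[OF \<open>a < b\<close>, of p] by blast
  qed
  moreover define p where "p = (\<Sum>k\<le>n. monom (f k) k)"
  have "poly p x = (\<Sum>k\<le>n. f k * x ^ k)" for x by (simp add: p_def poly_sum poly_monom)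
  ultimately show "\<exists>c. a < c \<and> c < b \<and> (\<Sum>k\<le>n. f k * c ^ k) = 0"
    using * by (metis mult_neg_pos)
qed

text \<open>\<open>emb\<close> is meaningful only if all squares of the ground field lie in the chosen cone.\<close>

definition emb :: "'k::real_field \<Rightarrow> 'k rc" where
  "emb k = Abs_rc (to_ac k)"

lemma Rep_rc_emb:
  assumes "\<And>k::'k::real_field. to_ac (k * k) \<in> the_cone"
  shows "Rep_rc (emb k :: 'k rc) = to_ac k"
proof -
  \<comment> \<open>Every element is a difference of two squares, so a cone containing all squares
    of the ground field has the whole ground field among its differences.\<close>
  have "to_ac k = to_ac (((k + 1) / 2) * ((k + 1) / 2)) - to_ac (((k - 1) / 2) * ((k - 1) / 2))"
    unfolding to_ac_diff[symmetric] to_ac_eq_iff by (simp add: field_simps)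
  then have "to_ac k \<in> diff_field the_cone" using diff_fieldI[OF cone_the_cone] assms by metis
  then show ?thesis by (simp add: emb_def Abs_rc_inverse)
qed

text \<open>A failure for \<open>P\<close> extends to a bad maximal cone, hence the globally chosen
  cone is bad too; but \<open>rc\<close> is real closed with respect to that cone, and sign transfer
  refutes its badness.\<close>

theorem ex_real_point:
  fixes P :: "'k::real_field set" and S :: "'k rexp set"
  assumes cone: "ordering_cone P" and squares: "\<And>k. k * k \<in> P"
    and fin: "finite S" and S: "\<And>e. e \<in> S \<Longrightarrow> ev of_real (\<lambda>k. k) e \<in> P - {0}"
  shows "\<exists>b. \<forall>e\<in>S. ev (\<lambda>r. r) b e > 0"
proof (rule ccontr)
  assume none: "\<not> ?thesis"
  have "ordering_cone (to_ac ` P)"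
    unfolding ordering_cone_def
  proof (intro conjI ballI)
    show "1 \<in> to_ac ` P" using ordering_coneD(1)[OF cone] by (rule rev_image_eqI) simp
    show "- 1 \<notin> to_ac ` P"
    proof
      assume "- 1 \<in> to_ac ` P"
      then obtain c where "c \<in> P" "to_ac (- 1) = to_ac c" by auto
      then show False using ordering_coneD(2)[OF cone] by (metis to_ac_eq_iff)
    qed
    fix a assume "a \<in> to_ac ` P"
    then obtain a' where a: "a = to_ac a'" "a' \<in> P" by auto
    show "inverse a \<in> to_ac ` P" using ordering_coneD(3)[OF cone a(2)] by (rule rev_image_eqI) (simp add: a)
    fix b assume "b \<in> to_ac ` P"
    then obtain b' where b: "b = to_ac b'" "b' \<in> P" by auto
    note D = ordering_coneD(4-6)[OF cone a(2) b(2)]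
    show "a + b \<in> to_ac ` P" using D(1) by (rule rev_image_eqI) (simp add: a b)
    show "a * b \<in> to_ac ` P" using D(2) by (rule rev_image_eqI) (simp add: a b)
    show "(a - b) * (a - b) \<in> to_ac ` P" using D(3) by (rule rev_image_eqI) (simp add: a b)
  qed
  from max_cone_exists[OF this] obtain T where T: "to_ac ` P \<subseteq> T" "max_cone T" by auto
  have "to_ac (ev of_real (\<lambda>k. k) e) \<in> T - {0}" if "e \<in> S" for e
    using S[OF that] T(1) by auto
  moreover have "to_ac (k * k) \<in> T" for k using T(1) squares[of k] by blast
  ultimately have "bad_cone T" unfolding bad_cone_def using fin none by (intro conjI allI exI[of _ S]) simp_all
  then have "bad_cone (the_cone :: 'k alg_closure set)" by (rule bad_cone_the_cone[OF T(2)])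
  then have sq: "\<And>k::'k. to_ac (k * k) \<in> the_cone"
    and "\<exists>S::'k rexp set. finite S \<and> (\<forall>e\<in>S. to_ac (ev of_real (\<lambda>k. k) e) \<in> the_cone - {0}) \<and>
        \<not> (\<exists>b::'k \<Rightarrow> real. \<forall>e\<in>S. ev (\<lambda>r. r) b e > 0)"
    unfolding bad_cone_def by simp_all
  \<comment> \<open>From here on \<open>S\<close> is the witness that belongs to the chosen cone and
    no longer the given set.\<close>
  then obtain S :: "'k rexp set" where S: "finite S"
    "\<And>e. e \<in> S \<Longrightarrow> to_ac (ev of_real (\<lambda>k. k) e) \<in> the_cone - {0}"
    "\<not> (\<exists>b. \<forall>e\<in>S. ev (\<lambda>r. r) b e > 0)"
    by auto
  note emb = Rep_rc_emb[OF sq]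
  have emb_eq: "emb k = x \<longleftrightarrow> to_ac k = Rep_rc x" for k :: 'k and x
    by (metis Rep_rc_inject emb)
  have hom: "real_hom (\<lambda>r. emb (of_real r) :: 'k rc)"
    by (simp add: real_hom_def emb_eq Rep_rc_simps emb)
  have ev_emb: "Rep_rc (ev (\<lambda>r. emb (of_real r)) (emb :: 'k \<Rightarrow> 'k rc) e) = to_ac (ev of_real (\<lambda>k. k) e)" for e
    by (induction e) (simp_all add: emb Rep_rc_simps)
  define V where "V = \<Union> (set_rexp ` S)"
  have set_fin: "finite (set_rexp e)" for e :: "'k rexp" by (induction e) auto
  then have "finite V" using S(1) by (simp add: V_def)
  from sign_transfer[OF hom this S(1), of emb] obtain b where b:
    "\<forall>e\<in>S. sg (ev (\<lambda>r. emb (of_real r)) (\<lambda>i. if i \<in> V then emb i else 0) e) = sg (ev (\<lambda>r. r) b e)" ..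
  have "ev (\<lambda>r. r) b e > 0" if e: "e \<in> S" for e
  proof -
    have ev_cong: "ev \<phi> x e' = ev \<phi> x' e'" if "\<And>i. i \<in> set_rexp e' \<Longrightarrow> x i = x' i"
      for \<phi> :: "real \<Rightarrow> 'k rc" and x x' and e' :: "'k rexp"
      using that by (induction e') simp_all
    have "ev (\<lambda>r. emb (of_real r)) (\<lambda>i. if i \<in> V then emb i else 0) e
        = ev (\<lambda>r. emb (of_real r)) (emb :: 'k \<Rightarrow> 'k rc) e"
      by (rule ev_cong) (use e in \<open>auto simp: V_def\<close>)
    moreover have "ev (\<lambda>r. emb (of_real r)) (emb :: 'k \<Rightarrow> 'k rc) e > 0"
    proof -
      have "ev (\<lambda>r. emb (of_real r)) (emb :: 'k \<Rightarrow> 'k rc) e \<ge> 0"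
        using S(2)[OF e] by (simp add: Rep_rc_nonneg ev_emb)
      moreover have "ev (\<lambda>r. emb (of_real r)) (emb :: 'k \<Rightarrow> 'k rc) e \<noteq> 0"
      proof
        assume "ev (\<lambda>r. emb (of_real r)) (emb :: 'k \<Rightarrow> 'k rc) e = 0"
        then have "to_ac (ev of_real (\<lambda>k. k) e) = 0" using ev_emb[of e] by (simp add: Rep_rc_simps)
        then show False using S(2)[OF e] by simp
      qed
      ultimately show ?thesis by simp
    qed
    ultimately show ?thesis using sg_eqD(1)[OF b[rule_format, OF e]] by simp
  qed
  then have "\<forall>e\<in>S. ev (\<lambda>r. r) b e > 0" by (rule ballI)
  then show False by (rule notE[OF S(3) exI])
qed

subsection \<open>Real places\<close>

lemma placeD:
  assumes "is_place UNIV \<zeta>"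
  shows place_0: "\<zeta> 0 = Some 0" and place_1: "\<zeta> 1 = Some 1"
    and place_add: "\<zeta> a = Some r \<Longrightarrow> \<zeta> b = Some s \<Longrightarrow> \<zeta> (a + b) = Some (r + s)"
    and place_mult: "\<zeta> a = Some r \<Longrightarrow> \<zeta> b = Some s \<Longrightarrow> \<zeta> (a * b) = Some (r * s)"
    and place_minus: "\<zeta> a = Some r \<Longrightarrow> \<zeta> (- a) = Some (- r)"
    and place_None: "\<zeta> a = None \<Longrightarrow> \<zeta> (inverse a) = Some 0"
  using assms unfolding is_place_def by auto

lemma place_inverse:
  assumes P: "is_place UNIV \<zeta>" and a: "\<zeta> a = Some r" "r \<noteq> 0"
  shows "\<zeta> (inverse a) = Some (inverse r)"
proof (cases "\<zeta> (inverse a)")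
  case None
  then show ?thesis using place_None[OF P None] a by simp
next
  case (Some s)
  have "a \<noteq> 0" using a place_0[OF P] by auto
  then have "Some (r * s) = Some 1" using place_mult[OF P a(1) Some] place_1[OF P] by simp
  then show ?thesis using Some a by (simp add: field_simps)
qed

lemma place_divide:
  assumes "is_place UNIV \<zeta>" "\<zeta> a = Some r" "\<zeta> b = Some s" "s \<noteq> 0"
  shows "\<zeta> (a / b) = Some (r / s)"
  using place_mult[OF assms(1,2) place_inverse[OF assms(1,3,4)]] by (simp add: divide_inverse)

lemma place_power:
  assumes "is_place UNIV \<zeta>" "\<zeta> a = Some r"
  shows "\<zeta> (a ^ n) = Some (r ^ n)"
  by (induction n) (simp_all add: place_1[OF assms(1)] place_mult[OF assms])

lemma place_inverse_0:
  assumes P: "is_place UNIV \<zeta>" and a: "\<zeta> (inverse a) = Some 0" "a \<noteq> 0"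
  shows "\<zeta> a = None"
proof (cases "\<zeta> a")
  case (Some r)
  have "\<zeta> 1 = Some (r * 0)" using place_mult[OF P Some a(1)] a(2) by simp
  then show ?thesis using place_1[OF P] by simp
qed

lemma place_ratio:
  assumes "is_place UNIV \<zeta>"
  obtains q where "\<zeta> (h / g) = Some q" | "\<zeta> (g / h) = Some 0"
  using place_None[OF assms, of "h / g"] by (cases "\<zeta> (h / g)") auto

lemma place_sum_squares:
  assumes P: "is_place UNIV \<zeta>" and u: "\<zeta> u = Some r" "r > 0" and v: "\<zeta> v = Some s" "s > 0"
    and gh: "g \<noteq> 0 \<or> h \<noteq> 0"
  shows "\<exists>k w t. k \<noteq> 0 \<and> g * g * u + h * h * v = k * k * w \<and> \<zeta> w = Some t \<and> t > 0"
proof -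
  consider "g = 0" "h \<noteq> 0" | "g \<noteq> 0" "h = 0" | "g \<noteq> 0" "h \<noteq> 0" using gh by auto
  then show ?thesis
  proof cases
    case 1
    then show ?thesis using v by (intro exI[of _ h] exI[of _ v] exI[of _ s]) simp
  next
    case 2
    then show ?thesis using u by (intro exI[of _ g] exI[of _ u] exI[of _ r]) simp
  next
    case 3
    show ?thesis
    proof (rule place_ratio[OF P, of h g])
      fix q assume q: "\<zeta> (h / g) = Some q"
      have "\<zeta> (u + h / g * (h / g) * v) = Some (r + q * q * s)"
        by (intro place_add[OF P] place_mult[OF P] q u v)
      moreover have "r + q * q * s > 0" using u v by (simp add: add_pos_nonneg)
      moreover have "g * g * u + h * h * v = g * g * (u + h / g * (h / g) * v)"
        using 3 by (simp add: field_simps)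
      ultimately show ?thesis using 3 by (intro exI conjI)
    next
      assume q: "\<zeta> (g / h) = Some 0"
      have "\<zeta> (g / h * (g / h) * u + v) = Some (0 * 0 * r + s)"
        by (intro place_add[OF P] place_mult[OF P] q u v)
      moreover have "0 * 0 * r + s > 0" using v by simp
      moreover have "g * g * u + h * h * v = h * h * (g / h * (g / h) * u + v)"
        using 3 by (simp add: field_simps)
      ultimately show ?thesis using 3 by (intro exI conjI)
    qed
  qed
qed

definition place_cone :: "('k::real_field \<Rightarrow> real option) \<Rightarrow> 'k set" where
  "place_cone \<zeta> = {g * g * u | g u. \<exists>r>0. \<zeta> u = Some r}"

lemma place_coneI: "a = g * g * u \<Longrightarrow> \<zeta> u = Some r \<Longrightarrow> r > 0 \<Longrightarrow> a \<in> place_cone \<zeta>"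
  by (auto simp: place_cone_def)

lemma place_coneE:
  assumes "a \<in> place_cone \<zeta>"
  obtains g u r where "a = g * g * u" "\<zeta> u = Some r" "r > 0"
  using assms by (auto simp: place_cone_def)

lemma place_cone_square: "is_place UNIV \<zeta> \<Longrightarrow> k * k \<in> place_cone \<zeta>"
  by (rule place_coneI[of _ k 1 _ 1]) (simp_all add: place_1)

lemma ordering_cone_place_cone:
  assumes P: "is_place UNIV \<zeta>"
  shows "ordering_cone (place_cone \<zeta>)"
  unfolding ordering_cone_def
proof (intro conjI ballI)
  show "1 \<in> place_cone \<zeta>" using place_cone_square[OF P, of 1] by simp
  show "- 1 \<notin> place_cone \<zeta>"
  proof
    assume "- 1 \<in> place_cone \<zeta>"
    then obtain g u r where u: "- 1 = g * g * u" "\<zeta> u = Some r" "r > 0" by (rule place_coneE)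
    \<comment> \<open>Applied to \<open>1\<close> and \<open>g * g * u\<close>, whose sum is zero,
      although neither \<open>k\<close> nor \<open>w\<close> can vanish.\<close>
    obtain k w t where k: "k \<noteq> 0" "1 * 1 * 1 + g * g * u = k * k * w" "\<zeta> w = Some t" "t > 0"
      using place_sum_squares[OF P place_1[OF P] zero_less_one u(2,3), of 1 g] by auto
    then have "w = 0" unfolding u(1)[symmetric] by simp
    then show False using k place_0[OF P] by simp
  qed
  fix a assume "a \<in> place_cone \<zeta>"
  then obtain g u r where a: "a = g * g * u" "\<zeta> u = Some r" "r > 0" by (rule place_coneE)
  show "inverse a \<in> place_cone \<zeta>"
    by (rule place_coneI[of _ "inverse g" "inverse u" _ "inverse r"])
       (use a place_inverse[OF P a(2)] in auto)
  fix b assume "b \<in> place_cone \<zeta>"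
  then obtain h v s where b: "b = h * h * v" "\<zeta> v = Some s" "s > 0" by (rule place_coneE)
  show "a * b \<in> place_cone \<zeta>"
    by (rule place_coneI[of _ "g * h" "u * v" _ "r * s"])
       (use a b place_mult[OF P a(2) b(2)] in auto)
  show "(a - b) * (a - b) \<in> place_cone \<zeta>" by (rule place_cone_square[OF P])
  show "a + b \<in> place_cone \<zeta>"
  proof (cases "g \<noteq> 0 \<or> h \<noteq> 0")
    case True
    then obtain k w t where "g * g * u + h * h * v = k * k * w" "\<zeta> w = Some t" "t > 0"
      using place_sum_squares[OF P a(2,3) b(2,3) True] by auto
    then show ?thesis using a b by (intro place_coneI[of _ k w _ t]) auto
  next
    case False
    then show ?thesis using a b place_cone_square[OF P, of 0] by simp
  qed
qed

text \<open>The real field is rigid: a homomorphism preserves the order because positive numbers are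
  squares, it fixes the rationals, and these are dense.\<close>

lemma real_hom_real:
  fixes \<phi> :: "real \<Rightarrow> real"
  assumes hom: "real_hom \<phi>"
  shows "\<phi> c = c"
proof -
  note h = real_hom_simps[OF hom]
  have nat: "\<phi> (of_nat n) = of_nat n" for n by (induction n) (simp_all add: h)
  have int: "\<phi> (of_int m) = of_int m" for m
    by (cases m rule: int_cases2) (simp_all add: nat h(5))
  have rat: "\<phi> q = q" if "q \<in> \<rat>" for q
  proof -
    from that obtain m n where q: "q = of_int m / of_int n" "n > 0" by (auto elim: Rats_cases')
    then have "\<phi> (q * of_int n) = q * of_int n" using int by simp
    then show ?thesis using q(2) unfolding h(3) int by simp
  qed
  have diff: "\<phi> (a - b) = \<phi> a - \<phi> b" for a b using h(2)[of a "-b"] h(5) by simp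
  have mono: "a < b \<longleftrightarrow> \<phi> a < \<phi> b" for a b
    using sg_eqD(1)[OF sg_real_hom[OF hom, of "b - a"]] by (simp add: diff)
  show ?thesis
  proof (rule ccontr)
    assume "\<phi> c \<noteq> c"
    then consider "\<phi> c < c" | "c < \<phi> c" by linarith
    then show False
    proof cases
      case 1
      then obtain q where "q \<in> \<rat>" "\<phi> c < q" "q < c" using Rats_dense_in_real by blast
      then show False using mono[of q c] rat by auto
    next
      case 2
      then obtain q where "q \<in> \<rat>" "c < q" "q < \<phi> c" using Rats_dense_in_real by blast
      then show False using mono[of c q] rat by auto
    qed
  qed
qed

text \<open>Squares cannot cancel at a real place, because the residue \<open>1 + q * q\<close> is
  never zero. Factoring out the dominating square therefore shows that a finite sum has finite
  summands.\<close>

lemma place_finite_of_sum_squares: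
  assumes P: "is_place UNIV \<zeta>" and m: "\<zeta> (a * a + b * b) = Some m"
  shows "\<zeta> a \<noteq> None"
proof
  assume None: "\<zeta> a = None"
  then have inv: "\<zeta> (inverse a) = Some 0" by (rule place_None[OF P])
  have a0: "a \<noteq> 0" using None place_0[OF P] by auto
  have contra: False if "\<zeta> (a * a) = Some t" for t
  proof -
    have "\<zeta> (a * a * (inverse a * inverse a)) = Some (t * (0 * 0))"
      by (intro place_mult[OF P] that inv)
    then show False using a0 place_1[OF P] by (simp add: field_simps)
  qed
  have pos: "1 + q * q \<noteq> 0" for q :: real by (metis add_pos_nonneg zero_le_square zero_less_one less_irrefl)
  show False
  proof (rule place_ratio[OF P, of b a])
    fix q assume q: "\<zeta> (b / a) = Some q"
    have *: "\<zeta> (1 + b / a * (b / a)) = Some (1 + q * q)"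
      by (intro place_add[OF P] place_mult[OF P] q place_1[OF P])
    have "1 + b / a * (b / a) \<noteq> 0" using * pos place_0[OF P] by (metis option.inject)
    moreover have "a * a + b * b = a * a * (1 + b / a * (b / a))" using a0 by (simp add: field_simps)
    ultimately have "a * a = (a * a + b * b) / (1 + b / a * (b / a))" by simp
    then show False using contra place_divide[OF P m * pos] by simp
  next
    assume q: "\<zeta> (a / b) = Some 0"
    show False
    proof (cases "b = 0")
      case True
      then show ?thesis using contra m by simp
    next
      case False
      have *: "\<zeta> (1 + a / b * (a / b)) = Some (1 + 0 * 0)"
        by (intro place_add[OF P] place_mult[OF P] q place_1[OF P])
      have "1 + a / b * (a / b) \<noteq> 0" using * pos[of 0] place_0[OF P] by (metis option.inject)
      moreover have "a * a + b * b = b * b * (1 + a / b * (a / b))" using False by (simp add: field_simps)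
      ultimately have "b * b = (a * a + b * b) / (1 + a / b * (a / b))" by simp
      then have "\<zeta> (b * b) = Some (m / (1 + 0 * 0))" using place_divide[OF P m * pos] by simp
      then have "\<zeta> (a / b * (a / b) * (b * b)) = Some (0 * 0 * (m / (1 + 0 * 0)))"
        by (intro place_mult[OF P] q)
      moreover have "a / b * (a / b) * (b * b) = a * a" using False by simp
      ultimately show ?thesis using contra by simp
    qed
  qed
qed

text \<open>The definition of a place does not mention the constants. They are finite because a
  non-negative \<open>c\<close> is a summand in a representation of a natural number as a sum of two
  squares; rigidity of the reals then determines their values.\<close>

lemma place_of_real:
  fixes \<zeta> :: "'k::real_field \<Rightarrow> real option"
  assumes P: "is_place UNIV \<zeta>"
  shows "\<zeta> (of_real c) = Some c"
proof -
  have nat: "\<zeta> (of_nat n) = Some (of_nat n)" for n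
    by (induction n) (simp_all add: place_0[OF P] place_add[OF P place_1[OF P]])
  have fin: "\<zeta> (of_real c) \<noteq> None" if "c \<ge> 0" for c
  proof -
    obtain n where n: "c \<le> of_nat n" using real_arch_simple by blast
    have eq: "of_real (sqrt c) * of_real (sqrt c) + of_real (sqrt (of_nat n - c)) * of_real (sqrt (of_nat n - c))
        = (of_nat n :: 'k)"
      using that n by (simp flip: of_real_mult of_real_add)
    have "\<zeta> (of_real (sqrt c)) \<noteq> None"
      by (rule place_finite_of_sum_squares[OF P, of _ "of_real (sqrt (of_nat n - c))" "of_nat n"])
         (unfold eq, rule nat)
    then obtain r where "\<zeta> (of_real (sqrt c)) = Some r" by auto
    from place_mult[OF P this this] that show ?thesis by (simp flip: of_real_mult)
  qed
  then have ex: "\<exists>r. \<zeta> (of_real c) = Some r" for c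
    using place_minus[OF P, of "of_real (- c)"] fin[of c] fin[of "- c"] by (cases "c \<ge> 0") auto
  define \<phi> where "\<phi> c = the (\<zeta> (of_real c))" for c
  have \<phi>: "\<zeta> (of_real c) = Some (\<phi> c)" for c using ex[of c] by (auto simp: \<phi>_def)
  have "real_hom \<phi>"
    unfolding real_hom_def
    using \<phi>[of 1] place_1[OF P] place_add[OF P \<phi> \<phi>] place_mult[OF P \<phi> \<phi>] \<phi>
    by (metis of_real_1 of_real_add of_real_mult option.inject)
  then show ?thesis using \<phi> real_hom_real by simp
qed

lemma place_ev:
  fixes \<zeta> :: "'k::real_field \<Rightarrow> real option"
  assumes P: "is_place UNIV \<zeta>" and x: "\<And>i. \<zeta> (x i) = Some (b i)"
  shows "\<zeta> (ev of_real x e) = Some (ev (\<lambda>r. r) b e)"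
  by (induction e)
     (simp_all add: place_of_real[OF P] x place_minus[OF P] place_add[OF P] place_mult[OF P])

section \<open>Field elements as fractions of expressions\<close>

definition fractions :: "('v \<Rightarrow> 'k::real_field) \<Rightarrow> 'k set" where
  "fractions x = {ev of_real x n / ev of_real x d | n d. ev of_real x d \<noteq> 0}"

lemma fractionsI: "ev of_real x d \<noteq> 0 \<Longrightarrow> f = ev of_real x n / ev of_real x d \<Longrightarrow> f \<in> fractions x"
  by (auto simp: fractions_def)

lemma is_subfield_fractions: "is_subfield (fractions x)"
  unfolding is_subfield_def
proof (intro conjI ballI)
  show "0 \<in> fractions x" by (rule fractionsI[of _ "Const 1" _ "Const 0"]) auto
  show "1 \<in> fractions x" by (rule fractionsI[of _ "Const 1" _ "Const 1"]) auto
  fix f assume "f \<in> fractions x"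
  then obtain n d where f: "f = ev of_real x n / ev of_real x d" "ev of_real x d \<noteq> 0"
    by (auto simp: fractions_def)
  show "- f \<in> fractions x" by (rule fractionsI[of _ d _ "Neg n"]) (use f in auto)
  show "inverse f \<in> fractions x"
  proof (cases "ev of_real x n = 0")
    case True
    then show ?thesis using f \<open>0 \<in> fractions x\<close> by simp
  next
    case False
    then show ?thesis by (intro fractionsI[of _ n _ d]) (use f in auto)
  qed
  fix g assume "g \<in> fractions x"
  then obtain m c where g: "g = ev of_real x m / ev of_real x c" "ev of_real x c \<noteq> 0"
    by (auto simp: fractions_def)
  show "f + g \<in> fractions x"
    by (rule fractionsI[of _ "Mul d c" _ "Add (Mul n c) (Mul m d)"]) (simp_all add: f g add_frac_eq)
  show "f * g \<in> fractions x"
    by (rule fractionsI[of _ "Mul d c" _ "Mul n m"]) (use f g in auto)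
qed

lemma gen_field_le: "is_subfield S \<Longrightarrow> A \<subseteq> S \<Longrightarrow> gen_field A \<subseteq> S"
  by (auto simp: gen_field_def)

lemma subset_gen_field: "A \<subseteq> gen_field A"
  by (auto simp: gen_field_def)

lemma is_subfield_gen_field: "is_subfield (gen_field A)"
  unfolding gen_field_def is_subfield_def by blast

lemma fractions_eq_UNIV:
  assumes "gen_field (range of_real \<union> range x) = (UNIV :: 'k::real_field set)"
  shows "fractions x = UNIV"
proof -
  have "of_real c \<in> fractions x" for c by (rule fractionsI[of _ "Const 1" _ "Const c"]) auto
  moreover have "x i \<in> fractions x" for i by (rule fractionsI[of _ "Const 1" _ "Var i"]) auto
  ultimately have "range of_real \<union> range x \<subseteq> fractions x" by auto
  then show ?thesis using gen_field_le[OF is_subfield_fractions] assms by blast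
qed

lemma ev_map_rexp: "ev \<phi> v (map_rexp g e) = ev \<phi> (\<lambda>i. v (g i)) e"
  by (induction e) simp_all

lemma basic_open_UNIV_iff:
  "\<zeta> \<in> basic_open UNIV fs \<longleftrightarrow> is_place UNIV \<zeta> \<and> (\<forall>f\<in>fs. \<exists>r>0. \<zeta> f = Some r)"
  by (auto simp: basic_open_def Hsub_def Mset_def)

text \<open>The condition on \<open>f = n / d\<close> is expressed by the polynomial
  \<open>n * d\<close>, which equals \<open>d * d * f\<close> and so lies in the cone of
  \<open>\<zeta>\<close>. At a real point, positivity of \<open>n * d\<close> yields both that the
  denominator does not vanish and that the quotient is positive. Renaming by
  \<open>map_rexp x\<close> turns the variables into the field elements expected by
  \<open>ex_real_point\<close>.\<close>

lemma ex_center: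
  fixes x :: "'v \<Rightarrow> 'k::real_field"
  assumes frac: "fractions x = UNIV" and fin: "finite fs" and \<zeta>: "\<zeta> \<in> basic_open UNIV fs"
  shows "\<exists>b. \<forall>\<xi>. is_place UNIV \<xi> \<longrightarrow> (\<forall>i. \<xi> (x i) = Some (b i)) \<longrightarrow> \<xi> \<in> basic_open UNIV fs"
proof -
  have P: "is_place UNIV \<zeta>" and pos: "\<And>f. f \<in> fs \<Longrightarrow> \<exists>r>0. \<zeta> f = Some r"
    using \<zeta> unfolding basic_open_UNIV_iff by auto
  have "\<exists>n d. f = ev of_real x n / ev of_real x d \<and> ev of_real x d \<noteq> 0" for f
    using UNIV_I[of f] unfolding frac[symmetric] fractions_def by simp
  then obtain n d where nd: "\<And>f. f = ev of_real x (n f) / ev of_real x (d f)" "\<And>f. ev of_real x (d f) \<noteq> 0"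
    by metis
  have "\<exists>b. \<forall>e\<in>(\<lambda>f. map_rexp x (Mul (n f) (d f))) ` fs. ev (\<lambda>r. r) b e > 0"
  proof (rule ex_real_point[OF ordering_cone_place_cone[OF P] place_cone_square[OF P]])
    show "finite ((\<lambda>f. map_rexp x (Mul (n f) (d f))) ` fs)" using fin by simp
    fix e assume "e \<in> (\<lambda>f. map_rexp x (Mul (n f) (d f))) ` fs"
    then obtain f where f: "f \<in> fs" "e = map_rexp x (Mul (n f) (d f))" by auto
    let ?d = "ev of_real x (d f)"
    have "ev of_real x (n f) = f * ?d" using nd[of f] by (simp add: field_simps)
    then have e: "ev of_real (\<lambda>k. k) e = ?d * ?d * f"
      unfolding f(2) ev_map_rexp by (simp add: mult_ac)
    obtain r where r: "r > 0" "\<zeta> f = Some r" using pos[OF f(1)] by auto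
    then have "f \<noteq> 0" using place_0[OF P] by auto
    then show "ev of_real (\<lambda>k. k) e \<in> place_cone \<zeta> - {0}"
      using e nd(2)[of f] place_coneI[of _ ?d f \<zeta> r] r by simp
  qed
  then obtain b where b: "\<And>f. f \<in> fs \<Longrightarrow> ev (\<lambda>r. r) (\<lambda>i. b (x i)) (n f) * ev (\<lambda>r. r) (\<lambda>i. b (x i)) (d f) > 0"
    by (auto simp: ev_map_rexp)
  show ?thesis
  proof (intro exI[of _ "\<lambda>i. b (x i)"] allI impI)
    fix \<xi> assume Q: "is_place UNIV \<xi>" and c: "\<forall>i. \<xi> (x i) = Some (b (x i))"
    have "\<exists>r>0. \<xi> f = Some r" if "f \<in> fs" for f
    proof -
      note evs = place_ev[OF Q, of x "\<lambda>i. b (x i)"]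
      let ?n = "ev (\<lambda>r. r) (\<lambda>i. b (x i)) (n f)" and ?d = "ev (\<lambda>r. r) (\<lambda>i. b (x i)) (d f)"
      have "?n * ?d > 0" by (rule b[OF that])
      then have nz: "?d \<noteq> 0" "?n / ?d > 0" by (auto simp: zero_less_mult_iff zero_less_divide_iff)
      have "\<xi> (ev of_real x (n f) / ev of_real x (d f)) = Some (?n / ?d)"
        using evs c by (intro place_divide[OF Q] nz(1)) auto
      then show ?thesis using nz(2) nd(1)[of f] by metis
    qed
    then show "\<xi> \<in> basic_open UNIV fs" unfolding basic_open_UNIV_iff using Q by simp
  qed
qed

subsection \<open>Places from curves\<close>

definition monomial :: "('v::finite \<Rightarrow> 'a::comm_ring_1) \<Rightarrow> ('v \<Rightarrow> nat) \<Rightarrow> 'a" where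
  "monomial v m = (\<Prod>i\<in>UNIV. v i ^ m i)"

lemma monomial_add: "monomial v (\<lambda>i. m i + n i) = monomial v m * monomial v n"
  by (simp add: monomial_def power_add prod.distrib)

lemma monomial_0: "monomial v (\<lambda>_. 0) = 1"
  by (simp add: monomial_def)

lemma monomial_unit: "monomial v (\<lambda>j. if j = i then 1 else 0) = v i"
proof -
  have "v j ^ (if j = i then 1 else 0) = (if j = i then v i else 1)" for j by simp
  then show ?thesis unfolding monomial_def by (simp only: prod.delta finite UNIV_I if_True)
qed

primrec terms :: "'v::finite rexp \<Rightarrow> (real \<times> ('v \<Rightarrow> nat)) list" where
  "terms (Const c) = [(c, \<lambda>_. 0)]"
| "terms (Var i) = [(1, \<lambda>j. if j = i then 1 else 0)]"
| "terms (Neg e) = map (\<lambda>(c,m). (- c, m)) (terms e)"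
| "terms (Add e f) = terms e @ terms f"
| "terms (Mul e f) = concat (map (\<lambda>(c,m). map (\<lambda>(d,n). (c * d, \<lambda>i. m i + n i)) (terms f)) (terms e))"

definition terms_sum :: "(real \<Rightarrow> 'a) \<Rightarrow> ('v::finite \<Rightarrow> 'a::comm_ring_1) \<Rightarrow> (real \<times> ('v \<Rightarrow> nat)) list \<Rightarrow> 'a" where
  "terms_sum \<phi> v l = (\<Sum>(c,m)\<leftarrow>l. \<phi> c * monomial v m)"

lemma terms_sum_simps [simp]:
  "terms_sum \<phi> v [] = 0"
  "terms_sum \<phi> v ((c,m) # l) = \<phi> c * monomial v m + terms_sum \<phi> v l"
  "terms_sum \<phi> v (l @ l') = terms_sum \<phi> v l + terms_sum \<phi> v l'"
  by (simp_all add: terms_sum_def)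

lemma ev_terms:
  assumes "real_hom \<phi>"
  shows "ev \<phi> v e = terms_sum \<phi> v (terms e)"
proof (induction e)
  case (Neg e)
  have "terms_sum \<phi> v (map (\<lambda>(c,m). (- c, m)) l) = - terms_sum \<phi> v l" for l
    by (induction l) (auto simp: real_hom_simps[OF assms])
  then show ?case using Neg by simp
next
  case (Mul e f)
  have *: "terms_sum \<phi> v (map (\<lambda>(d,n). (c * d, \<lambda>i. m i + n i)) l) = \<phi> c * monomial v m * terms_sum \<phi> v l"
    for c m l
    by (induction l) (auto simp: real_hom_simps[OF assms] monomial_add algebra_simps)
  have "terms_sum \<phi> v (concat (map (\<lambda>(c,m). map (\<lambda>(d,n). (c * d, \<lambda>i. m i + n i)) l) l'))
      = terms_sum \<phi> v l' * terms_sum \<phi> v l" for l l'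
    by (induction l') (auto simp: * algebra_simps)
  then show ?case using Mul by simp
qed (simp_all add: monomial_0 monomial_unit[simplified] real_hom_simps[OF assms])

fun coef_of :: "(real \<times> ('v \<Rightarrow> nat)) list \<Rightarrow> ('v \<Rightarrow> nat) \<Rightarrow> real" where
  "coef_of [] m = 0"
| "coef_of ((c,n) # l) m = (if m = n then c else 0) + coef_of l m"

lemma terms_sum_collect:
  assumes hom: "real_hom \<phi>" and "finite E" "snd ` set l \<subseteq> E"
  shows "terms_sum \<phi> v l = (\<Sum>m\<in>E. \<phi> (coef_of l m) * monomial v m)"
  using assms(3)
proof (induction l)
  case (Cons t l)
  obtain c n where t: "t = (c,n)" by (cases t)
  have "(\<Sum>m\<in>E. \<phi> (if m = n then c else 0) * monomial v m) = (\<Sum>m\<in>E. if m = n then \<phi> c * monomial v n else 0)"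
    by (intro sum.cong) (auto simp: real_hom_simps[OF hom])
  also have "\<dots> = \<phi> c * monomial v n" using Cons.prems assms(2) by (simp add: t)
  finally show ?case
    using Cons by (simp add: t real_hom_simps[OF hom] distrib_right sum.distrib)
qed (simp add: real_hom_simps[OF hom])

lemma real_hom_of_real: "real_hom (of_real :: real \<Rightarrow> 'k::real_field)"
  by (simp add: real_hom_def)

text \<open>Terms in the list may cancel; only exponents whose collected coefficient is non-zero can
  govern the asymptotics.\<close>

definition exp_set :: "'v::finite rexp \<Rightarrow> ('v \<Rightarrow> nat) set" where
  "exp_set e = {m \<in> snd ` set (terms e). coef_of (terms e) m \<noteq> 0}"

lemma finite_exp_set: "finite (exp_set e)"
  by (simp add: exp_set_def)

lemma ev_exp_set:
  assumes "real_hom \<phi>"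
  shows "ev \<phi> v e = (\<Sum>m\<in>exp_set e. \<phi> (coef_of (terms e) m) * monomial v m)"
proof -
  have "ev \<phi> v e = (\<Sum>m\<in>snd ` set (terms e). \<phi> (coef_of (terms e) m) * monomial v m)"
    unfolding ev_terms[OF assms] by (rule terms_sum_collect[OF assms]) auto
  also have "\<dots> = (\<Sum>m\<in>exp_set e. \<phi> (coef_of (terms e) m) * monomial v m)"
    by (rule sum.mono_neutral_right) (auto simp: exp_set_def real_hom_simps[OF assms])
  finally show ?thesis .
qed

lemma exp_set_nonempty:
  assumes "real_hom \<phi>" "ev \<phi> v e \<noteq> 0"
  shows "exp_set e \<noteq> {}"
  using assms(2) by (auto simp: ev_exp_set[OF assms(1)])

text \<open>Algebraic independence in the form used for specialisation: an identity at \<open>x\<close> holds at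
  all real points.\<close>

definition generic :: "('v \<Rightarrow> 'k::real_field) \<Rightarrow> bool" where
  "generic x \<longleftrightarrow> (\<forall>e. ev of_real x e = 0 \<longrightarrow> (\<forall>v. ev (\<lambda>r. r) v e = 0))"

lemma generic_alg_indep:
  assumes "alg_indep x"
  shows "generic x"
  unfolding generic_def
proof (intro allI impI)
  fix e :: "'a rexp" and v assume "ev of_real x e = 0"
  then have "(\<Sum>m\<in>exp_set e. of_real (coef_of (terms e) m) * (\<Prod>i\<in>UNIV. x i ^ m i)) = 0"
    by (simp add: ev_exp_set[OF real_hom_of_real] monomial_def)
  then have "\<forall>m\<in>exp_set e. coef_of (terms e) m = 0"
    using assms finite_exp_set unfolding alg_indep_def by blast
  then show "ev (\<lambda>r. r) v e = 0" by (simp add: ev_exp_set[OF real_hom_id])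
qed

lemma generic_eq:
  assumes "generic x" "ev of_real x e = ev of_real x f"
  shows "ev (\<lambda>r. r) v e = ev (\<lambda>r. r) v f"
proof -
  have "ev of_real x (Add e (Neg f)) = 0" using assms(2) by simp
  then have "ev (\<lambda>r. r) v (Add e (Neg f)) = 0" using assms(1) unfolding generic_def by blast
  then show ?thesis by simp
qed

lemma inj_prime_power_prod:
  fixes p :: "'v::finite \<Rightarrow> nat"
  assumes "inj p" "\<And>i. prime (p i)" "(\<Prod>i\<in>UNIV. p i ^ m i) = (\<Prod>i\<in>UNIV. p i ^ n i)"
  shows "m = n"
proof
  fix i
  have "(\<Prod>i\<in>UNIV. p i ^ m i) = (\<Prod>q\<in>range p. q ^ m (inv_into UNIV p q))" for m :: "'v \<Rightarrow> nat"
    using assms(1) by (subst prod.reindex) auto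
  moreover have "multiplicity (p i) (\<Prod>q\<in>range p. q ^ m (inv_into UNIV p q)) = m i" for m :: "'v \<Rightarrow> nat"
    using assms(1,2) by (subst multiplicity_prod_prime_powers) auto
  ultimately show "m i = n i" using assms(3) by metis
qed

text \<open>Along the curve \<open>v\<^sub>i = (1 / p\<^sub>i)\<^sup>s\<close>, distinct monomials decay at distinct rates by unique
  factorisation, so each polynomial is asymptotic to one of its terms.\<close>

definition curve :: "('v \<Rightarrow> nat) \<Rightarrow> nat \<Rightarrow> 'v \<Rightarrow> real" where
  "curve p s i = (1 / real (p i)) ^ s"

lemma ev_curve_asymp:
  fixes p :: "'v::finite \<Rightarrow> nat"
  assumes p: "inj p" "\<And>i. prime (p i)" and nz: "exp_set e \<noteq> {}"
  shows "\<exists>C r. C \<noteq> 0 \<and> r > 0 \<and> (\<lambda>s. ev (\<lambda>r. r) (curve p s) e / r ^ s) \<longlonglongrightarrow> C"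
proof -
  define N where "N m = (\<Prod>i\<in>UNIV. p i ^ m i)" for m :: "'v \<Rightarrow> nat"
  have N_pos: "N m > 0" for m using p(2) by (auto simp: N_def prime_gt_0_nat intro!: prod_pos)
  have mon: "monomial (curve p s) m = (1 / real (N m)) ^ s" for s m
  proof -
    have "monomial (curve p s) m = (\<Prod>i\<in>UNIV. ((1 / real (p i)) ^ m i) ^ s)"
      unfolding monomial_def curve_def by (simp add: power_mult[symmetric] mult.commute)
    also have "\<dots> = (\<Prod>i\<in>UNIV. (1 / real (p i)) ^ m i) ^ s" by (rule prod_power_distrib[symmetric])
    also have "(\<Prod>i\<in>UNIV. (1 / real (p i)) ^ m i) = 1 / real (N m)"
      by (simp add: N_def power_one_over prod_dividef)
    finally show ?thesis .
  qed
  let ?E = "exp_set e" and ?c = "coef_of (terms e)"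
  \<comment> \<open>The least \<open>N\<close> belongs to the monomial of slowest decay. It
    dominates along the curve, and its coefficient becomes the limit \<open>C\<close>.\<close>
  obtain m0 where m0: "m0 \<in> ?E" "\<And>m. m \<in> ?E \<Longrightarrow> N m0 \<le> N m"
    using arg_min_if_finite(1)[OF finite_exp_set nz, of N] arg_min_least[OF finite_exp_set nz, of _ N] by blast
  define r where "r = 1 / real (N m0)"
  have r: "r > 0" using N_pos by (simp add: r_def)
  have eq: "ev (\<lambda>r. r) (curve p s) e / r ^ s = (\<Sum>m\<in>?E. ?c m * (real (N m0) / real (N m)) ^ s)" for s
    unfolding ev_exp_set[OF real_hom_id] mon sum_divide_distrib r_def
    by (intro sum.cong) (simp_all add: power_divide)
  have "(\<lambda>s. ?c m * (real (N m0) / real (N m)) ^ s) \<longlonglongrightarrow> (if m = m0 then ?c m0 else 0)"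
    if "m \<in> ?E" for m
  proof (cases "m = m0")
    case True
    then show ?thesis using N_pos[of m0] by simp
  next
    case False
    then have "N m0 \<noteq> N m" using inj_prime_power_prod[OF p] unfolding N_def by metis
    then have "N m0 < N m" using m0(2)[OF that] by simp
    then have "(\<lambda>s. (real (N m0) / real (N m)) ^ s) \<longlonglongrightarrow> 0"
      by (intro LIMSEQ_realpow_zero) auto
    from tendsto_mult_left[OF this, of "?c m"] show ?thesis using False by simp
  qed
  then have "(\<lambda>s. \<Sum>m\<in>?E. ?c m * (real (N m0) / real (N m)) ^ s) \<longlonglongrightarrow> (\<Sum>m\<in>?E. if m = m0 then ?c m0 else 0)"
    by (rule tendsto_sum)
  also have "(\<Sum>m\<in>?E. if m = m0 then ?c m0 else 0) = ?c m0" using m0(1) finite_exp_set[of e] by simp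
  finally have "(\<lambda>s. ev (\<lambda>r. r) (curve p s) e / r ^ s) \<longlonglongrightarrow> ?c m0" by (simp add: eq)
  moreover have "?c m0 \<noteq> 0" using m0(1) by (simp add: exp_set_def)
  ultimately show ?thesis using r by blast
qed

lemma ev_curve_nonzero:
  fixes p :: "'v::finite \<Rightarrow> nat"
  assumes "inj p" "\<And>i. prime (p i)" "exp_set e \<noteq> {}"
  shows "\<forall>\<^sub>F s in sequentially. ev (\<lambda>r. r) (curve p s) e \<noteq> 0"
proof -
  obtain C r where C: "C \<noteq> 0" "(\<lambda>s. ev (\<lambda>r. r) (curve p s) e / r ^ s) \<longlonglongrightarrow> C"
    using ev_curve_asymp[OF assms] by auto
  show ?thesis using tendsto_imp_eventually_ne[OF C(2,1)] by eventually_elim auto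
qed

text \<open>Both polynomials are asymptotic to constants times exponentials, so their quotient is
  too. This dichotomy is what turns taking limits into a place: where a quotient has no limit, its
  inverse tends to zero.\<close>

lemma curve_ratio_limit:
  fixes p :: "'v::finite \<Rightarrow> nat"
  assumes p: "inj p" "\<And>i. prime (p i)" and nz: "exp_set e \<noteq> {}" "exp_set f \<noteq> {}"
  shows "convergent (\<lambda>s. ev (\<lambda>r. r) (curve p s) e / ev (\<lambda>r. r) (curve p s) f) \<or>
    (\<lambda>s. ev (\<lambda>r. r) (curve p s) f / ev (\<lambda>r. r) (curve p s) e) \<longlonglongrightarrow> 0"
proof -
  obtain C r where C: "C \<noteq> 0" "r > 0" "(\<lambda>s. ev (\<lambda>r. r) (curve p s) e / r ^ s) \<longlonglongrightarrow> C"
    using ev_curve_asymp[OF p nz(1)] by auto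
  obtain D q where D: "D \<noteq> 0" "q > 0" "(\<lambda>s. ev (\<lambda>r. r) (curve p s) f / q ^ s) \<longlonglongrightarrow> D"
    using ev_curve_asymp[OF p nz(2)] by auto
  show ?thesis
  proof (cases "r \<le> q")
    case True
    have "(\<lambda>s. (r / q) ^ s) \<longlonglongrightarrow> (if r = q then 1 else 0)"
    proof (cases "r = q")
      case False
      then show ?thesis using True C D by (auto intro!: LIMSEQ_realpow_zero)
    qed (use D in simp)
    from tendsto_mult[OF tendsto_divide[OF C(3) D(3,1)] this]
    have "(\<lambda>s. ev (\<lambda>r. r) (curve p s) e / ev (\<lambda>r. r) (curve p s) f) \<longlonglongrightarrow> C / D * (if r = q then 1 else 0)"
      using C D by (simp add: field_simps)
    then show ?thesis by (auto simp: convergent_def)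
  next
    case False
    then have "(\<lambda>s. (q / r) ^ s) \<longlonglongrightarrow> 0" using C D by (auto intro!: LIMSEQ_realpow_zero)
    from tendsto_mult[OF tendsto_divide[OF D(3) C(3,1)] this]
    have "(\<lambda>s. ev (\<lambda>r. r) (curve p s) f / ev (\<lambda>r. r) (curve p s) e) \<longlonglongrightarrow> D / C * 0"
      using C D by (simp add: field_simps)
    then show ?thesis by simp
  qed
qed

text \<open>The place sends \<open>f\<close> to the limit of its values along the curve and to
  infinity if there is none. A larger prime gives faster decay, hence the condition on the
  quotients.\<close>

lemma curve_place_exists:
  fixes w :: "'v::finite \<Rightarrow> 'k::real_field" and p :: "'v \<Rightarrow> nat"
  assumes gen: "generic w" and frac: "fractions w = UNIV"
    and p: "inj p" "\<And>i. prime (p i)"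
  shows "\<exists>\<xi>. is_place UNIV \<xi> \<and> (\<forall>i. \<xi> (w i) = Some 0) \<and> (\<forall>j k. p k < p j \<longrightarrow> \<xi> (w j / w k) = Some 0)"
proof -
  let ?ev = "\<lambda>s e. ev (\<lambda>r. r) (curve p s) e"
  have "\<exists>n d. f = ev of_real w n / ev of_real w d \<and> ev of_real w d \<noteq> 0" for f
    using UNIV_I[of f] unfolding frac[symmetric] fractions_def by simp
  then obtain n d where nd: "\<And>f. f = ev of_real w (n f) / ev of_real w (d f)" "\<And>f. ev of_real w (d f) \<noteq> 0"
    by metis
  define h where "h f s = ?ev s (n f) / ?ev s (d f)" for f s
  have ne: "exp_set e \<noteq> {}" if "ev of_real w e \<noteq> 0" for e
    using exp_set_nonempty[OF real_hom_of_real that] .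
  have ev_nz: "\<forall>\<^sub>F s in sequentially. ?ev s e \<noteq> 0" if "ev of_real w e \<noteq> 0" for e
    using ev_curve_nonzero[OF p ne[OF that]] .
  \<comment> \<open>The fraction representing \<open>f\<close> was chosen arbitrarily. Two
    representations agree after cross-multiplication, genericity carries this polynomial identity to
    the curve, and the denominators are non-zero for large \<open>s\<close>.\<close>
  have h_eq: "\<forall>\<^sub>F s in sequentially. h f s = ?ev s n' / ?ev s d'"
    if "ev of_real w d' \<noteq> 0" "f = ev of_real w n' / ev of_real w d'" for f n' d'
  proof -
    have "ev of_real w (n f) / ev of_real w (d f) = ev of_real w n' / ev of_real w d'"
      using nd(1)[of f] that(2) by simp
    then have "ev of_real w (Mul (n f) d') = ev of_real w (Mul n' (d f))"
      using nd(2)[of f] that(1) by (simp add: frac_eq_eq)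
    then have "?ev s (Mul (n f) d') = ?ev s (Mul n' (d f))" for s
      by (rule generic_eq[OF gen])
    then have eq: "?ev s (n f) * ?ev s d' = ?ev s n' * ?ev s (d f)" for s by simp
    show ?thesis
      using ev_nz[OF nd(2)[of f]] ev_nz[OF that(1)]
      by eventually_elim (simp add: h_def frac_eq_eq eq)
  qed
  define \<xi> where "\<xi> f = (if convergent (h f) then Some (lim (h f)) else None)" for f
  have \<xi>I: "\<xi> f = Some l" if "\<forall>\<^sub>F s in sequentially. h f s = g s" "g \<longlonglongrightarrow> l" for f g l
  proof -
    have "h f \<longlonglongrightarrow> l" using tendsto_cong[OF that(1)] that(2) by simp
    then show ?thesis unfolding \<xi>_def using limI convergentI by auto
  qed
  have \<xi>D: "h f \<longlonglongrightarrow> l" if "\<xi> f = Some l" for f l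
    using that by (auto simp: \<xi>_def convergent_LIMSEQ_iff split: if_splits)
  have \<xi>0: "\<xi> 0 = Some 0"
    by (rule \<xi>I[OF h_eq[of "Const 1" 0 "Const 0"]]) auto
  have \<xi>1: "\<xi> 1 = Some 1"
    by (rule \<xi>I[OF h_eq[of "Const 1" 1 "Const 1"]]) auto
  have add: "\<xi> (f + g) = Some (l + m)" if "\<xi> f = Some l" "\<xi> g = Some m" for f g l m
  proof (rule \<xi>I)
    show "(\<lambda>s. h f s + h g s) \<longlonglongrightarrow> l + m" using that by (intro tendsto_add \<xi>D)
    have "f + g = ev of_real w (n f) / ev of_real w (d f) + ev of_real w (n g) / ev of_real w (d g)"
      using nd(1)[of f] nd(1)[of g] by simp
    also have "\<dots> = ev of_real w (Add (Mul (n f) (d g)) (Mul (n g) (d f))) / ev of_real w (Mul (d f) (d g))"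
      using nd(2) by (simp add: add_frac_eq)
    finally have "\<forall>\<^sub>F s in sequentially. h (f + g) s =
      ?ev s (Add (Mul (n f) (d g)) (Mul (n g) (d f))) / ?ev s (Mul (d f) (d g))"
      by (intro h_eq) (use nd(2) in auto)
    then show "\<forall>\<^sub>F s in sequentially. h (f + g) s = h f s + h g s"
      using ev_nz[OF nd(2)[of f]] ev_nz[OF nd(2)[of g]]
      by eventually_elim (simp add: h_def add_frac_eq)
  qed
  have mult: "\<xi> (f * g) = Some (l * m)" if "\<xi> f = Some l" "\<xi> g = Some m" for f g l m
  proof (rule \<xi>I)
    show "(\<lambda>s. h f s * h g s) \<longlonglongrightarrow> l * m" using that by (intro tendsto_mult \<xi>D)
    have "f * g = (ev of_real w (n f) / ev of_real w (d f)) * (ev of_real w (n g) / ev of_real w (d g))"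
      using nd(1)[of f] nd(1)[of g] by simp
    also have "\<dots> = ev of_real w (Mul (n f) (n g)) / ev of_real w (Mul (d f) (d g))" by simp
    finally have "\<forall>\<^sub>F s in sequentially. h (f * g) s = ?ev s (Mul (n f) (n g)) / ?ev s (Mul (d f) (d g))"
      by (intro h_eq) (use nd(2) in auto)
    then show "\<forall>\<^sub>F s in sequentially. h (f * g) s = h f s * h g s"
      by eventually_elim (simp add: h_def)
  qed
  have "\<xi> (of_real (- 1)) = Some (- 1)"
    by (rule \<xi>I[OF h_eq[of "Const 1" _ "Const (- 1)"]]) auto
  from mult[OF this] have minus: "\<xi> (- f) = Some (- l)" if "\<xi> f = Some l" for f l
    using that by fastforce
  have None: "\<xi> (inverse f) = Some 0" if "\<xi> f = None" for f
  proof -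
    have "f \<noteq> 0" using that \<xi>0 by auto
    then have nf: "ev of_real w (n f) \<noteq> 0" using nd(1)[of f] by auto
    have "\<not> convergent (h f)" using that by (auto simp: \<xi>_def split: if_splits)
    then have "(\<lambda>s. ?ev s (d f) / ?ev s (n f)) \<longlonglongrightarrow> 0"
      using curve_ratio_limit[OF p ne[OF nf] ne[OF nd(2)[of f]]] unfolding h_def by simp
    moreover have "inverse f = inverse (ev of_real w (n f) / ev of_real w (d f))"
      using nd(1)[of f] by simp
    then have "inverse f = ev of_real w (d f) / ev of_real w (n f)" by simp
    from h_eq[OF nf this] have "\<forall>\<^sub>F s in sequentially. h (inverse f) s = ?ev s (d f) / ?ev s (n f)" .
    ultimately show ?thesis by (intro \<xi>I)
  qed
  have "is_place UNIV \<xi>"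
    unfolding is_place_def using \<xi>0 \<xi>1 add mult minus None by auto
  moreover have p2: "p i \<ge> 2" for i using p(2) prime_ge_2_nat by blast
  have "\<xi> (w i) = Some 0" for i
  proof (rule \<xi>I)
    show "\<forall>\<^sub>F s in sequentially. h (w i) s = ?ev s (Var i) / ?ev s (Const 1)"
      by (rule h_eq) auto
    have "(\<lambda>s. (1 / real (p i)) ^ s) \<longlonglongrightarrow> 0" using p2[of i] by (intro LIMSEQ_realpow_zero) auto
    then show "(\<lambda>s. ?ev s (Var i) / ?ev s (Const 1)) \<longlonglongrightarrow> 0" by (simp add: curve_def)
  qed
  moreover have "\<xi> (w j / w k) = Some 0" if "p k < p j" for j k
  proof (rule \<xi>I)
    have "w k \<noteq> 0"
    proof
      assume "w k = 0"
      then have "ev (\<lambda>r. r) (\<lambda>_. 1) (Var k) = 0" using gen unfolding generic_def by (metis ev.simps(2))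
      then show False by simp
    qed
    then show "\<forall>\<^sub>F s in sequentially. h (w j / w k) s = ?ev s (Var j) / ?ev s (Var k)"
      by (intro h_eq) auto
    have "(\<lambda>s. (real (p k) / real (p j)) ^ s) \<longlonglongrightarrow> 0"
      using that by (intro LIMSEQ_realpow_zero) auto
    then show "(\<lambda>s. ?ev s (Var j) / ?ev s (Var k)) \<longlonglongrightarrow> 0" by (simp add: curve_def power_divide)
  qed
  ultimately show ?thesis by (intro exI conjI allI impI)
qed

subsection \<open>Places with prescribed centre and slope\<close>

primrec substitute :: "('v \<Rightarrow> 'w rexp) \<Rightarrow> 'v rexp \<Rightarrow> 'w rexp" where
  "substitute \<sigma> (Const c) = Const c"
| "substitute \<sigma> (Var i) = \<sigma> i"
| "substitute \<sigma> (Neg e) = Neg (substitute \<sigma> e)"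
| "substitute \<sigma> (Add e f) = Add (substitute \<sigma> e) (substitute \<sigma> f)"
| "substitute \<sigma> (Mul e f) = Mul (substitute \<sigma> e) (substitute \<sigma> f)"

lemma ev_substitute: "ev \<phi> v (substitute \<sigma> e) = ev \<phi> (\<lambda>i. ev \<phi> v (\<sigma> i)) e"
  by (induction e) simp_all

lemma ex_inj_primes:
  fixes j k :: "'v::finite"
  shows "\<exists>p::'v \<Rightarrow> nat. inj p \<and> (\<forall>i. prime (p i)) \<and> (j \<noteq> k \<longrightarrow> p k < p j)"
proof -
  obtain A :: "nat set" where A: "finite A" "card A = CARD('v)" "A \<subseteq> {p. prime p}"
    using infinite_arbitrarily_large[OF primes_infinite, of "CARD('v)"] by auto
  then obtain p where p: "bij_betw p (UNIV :: 'v set) A"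
    using finite_same_card_bij[of "UNIV :: 'v set" A] by auto
  then have inj: "inj p" by (simp add: bij_betw_def)
  have prime: "prime (p i)" for i using bij_betwE[OF p] A(3) by auto
  show ?thesis
  proof (cases "j \<noteq> k \<longrightarrow> p k < p j")
    case True
    then show ?thesis using inj prime by (intro exI[of _ p]) simp
  next
    case False
    then have "p j < p k" using injD[OF inj, of j k] by (metis linorder_neqE_nat)
    moreover have "inj (p \<circ> Transposition.transpose j k)" using inj by (intro inj_compose) simp_all
    ultimately show ?thesis using prime by (intro exI[of _ "p \<circ> Transposition.transpose j k"]) simp
  qed
qed

text \<open>The coordinates are translated to \<open>b\<close> and sheared so that
  \<open>w j\<close> is \<open>x j - b j\<close> minus \<open>c\<close> times
  \<open>x k - b k\<close>. A place at which \<open>w j / w k\<close> vanishes then has slope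
  \<open>c\<close>. With \<open>j = k\<close> and \<open>c = 0\<close> only the translation remains,
  which gives a place centred at \<open>b\<close> for any number of variables.\<close>

lemma place_with_slope:
  fixes x :: "'v::finite \<Rightarrow> 'k::real_field"
  assumes gen: "generic x" and frac: "fractions x = UNIV" and jk: "j \<noteq> k \<or> c = 0"
  shows "\<exists>\<xi>. is_place UNIV \<xi> \<and> (\<forall>i. \<xi> (x i) = Some (b i)) \<and>
    (j \<noteq> k \<longrightarrow> \<xi> ((x j - of_real (b j)) / (x k - of_real (b k))) = Some c)"
proof -
  define w where "w i = x i - of_real (b i) - (if i = j then of_real c * (x k - of_real (b k)) else 0)" for i
  have x: "x i = w i + of_real (b i) + (if i = j then of_real c * w k else 0)" for i
    using jk by (auto simp: w_def)
  \<comment> \<open>\<open>\<sigma>\<close> writes the new coordinates in terms of the old ones and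
    \<open>\<tau>\<close> does the converse. Genericity is inherited through
    \<open>\<sigma>\<close>, the fact that the fractions exhaust the field through
    \<open>\<tau>\<close>.\<close>
  define \<sigma> where "\<sigma> i = Add (Add (Var i) (Const (- b i)))
    (if i = j then Mul (Const (- c)) (Add (Var k) (Const (- b k))) else Const 0)" for i
  define \<tau> where "\<tau> i = Add (Add (Var i) (Const (b i))) (if i = j then Mul (Const c) (Var k) else Const 0)" for i
  have \<sigma>: "ev of_real x (substitute \<sigma> e) = ev of_real w e" for e
  proof -
    have "(\<lambda>i. ev of_real x (\<sigma> i)) = w" by (auto simp: \<sigma>_def w_def)
    then show ?thesis by (simp add: ev_substitute)
  qed
  have \<tau>: "ev of_real w (substitute \<tau> e) = ev of_real x e" for e
  proof -
    have "(\<lambda>i. ev of_real w (\<tau> i)) = x"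
    proof
      fix i
      show "ev of_real w (\<tau> i) = x i" using x[of i] by (simp add: \<tau>_def)
    qed
    then show ?thesis by (simp add: ev_substitute)
  qed
  have gen_w: "generic w"
    unfolding generic_def
  proof (intro allI impI)
    fix e v assume "ev of_real w e = 0"
    then have "ev of_real x (substitute \<sigma> e) = 0" by (simp add: \<sigma>)
    then have *: "ev (\<lambda>r. r) u (substitute \<sigma> e) = 0" for u using gen unfolding generic_def by simp
    \<comment> \<open>The real point that the affine map maps to \<open>v\<close>, so that an
      identity at all \<open>u\<close> becomes one at all \<open>v\<close>.\<close>
    define u where "u i = v i + b i + (if i = j then c * v k else 0)" for i
    have "(\<lambda>i. ev (\<lambda>r. r) u (\<sigma> i)) = v"
      using jk by (auto simp: \<sigma>_def u_def)
    then show "ev (\<lambda>r. r) v e = 0" using *[of u] by (simp add: ev_substitute)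
  qed
  have frac_w: "fractions w = UNIV"
  proof -
    have "f \<in> fractions w" if "f \<in> fractions x" for f
    proof -
      obtain n d where f: "f = ev of_real x n / ev of_real x d" "ev of_real x d \<noteq> 0"
        using \<open>f \<in> fractions x\<close> by (auto simp: fractions_def)
      show ?thesis by (rule fractionsI[of _ "substitute \<tau> d" _ "substitute \<tau> n"]) (simp_all add: \<tau> f)
    qed
    then show ?thesis using frac by auto
  qed
  obtain p :: "'v \<Rightarrow> nat" where p: "inj p" "\<And>i. prime (p i)" "j \<noteq> k \<longrightarrow> p k < p j"
    using ex_inj_primes[of j k] by auto
  obtain \<xi> where P: "is_place UNIV \<xi>" and w0: "\<And>i. \<xi> (w i) = Some 0"
    and ratio: "\<And>j k. p k < p j \<Longrightarrow> \<xi> (w j / w k) = Some 0"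
    using curve_place_exists[OF gen_w frac_w p(1,2)] by auto
  have "\<xi> (x i) = Some (b i)" for i
  proof -
    have "\<xi> (if i = j then of_real c * w k else 0) = Some 0"
      using place_mult[OF P place_of_real[OF P] w0, of c k] place_0[OF P] by simp
    from place_add[OF P place_add[OF P w0 place_of_real[OF P]] this, of i "b i"]
    show ?thesis using x[of i] by simp
  qed
  moreover have "\<xi> ((x j - of_real (b j)) / (x k - of_real (b k))) = Some c" if "j \<noteq> k"
  proof -
    have wk: "w k = x k - of_real (b k)" using that by (simp add: w_def)
    have "w k \<noteq> 0"
    proof
      assume "w k = 0"
      then have "ev of_real w (Var k) = 0" by simp
      then have "ev (\<lambda>r. r) (\<lambda>_. 1) (Var k) = 0" using gen_w unfolding generic_def by blast
      then show False by simp
    qed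
    then have "(x j - of_real (b j)) / (x k - of_real (b k)) = w j / w k + of_real c"
      unfolding wk[symmetric] using x[of j] by (simp add: add_divide_distrib)
    then show ?thesis using place_add[OF P ratio[of k j] place_of_real[OF P, of c]] p(3) that by simp
  qed
  ultimately show ?thesis using P by (intro exI[of _ \<xi>]) simp
qed

section \<open>Places on a field generated by one variable\<close>

definition rpoly :: "'k::real_field \<Rightarrow> real poly \<Rightarrow> 'k" where
  "rpoly t g = poly (map_poly of_real g) t"

lemma rpoly_pCons: "rpoly t (pCons a g) = of_real a + t * rpoly t g"
  by (cases "a = 0 \<and> g = 0") (auto simp: rpoly_def map_poly_pCons)

lemma rpoly_0 [simp]: "rpoly t 0 = 0"
  by (simp add: rpoly_def)

lemma rpoly_add: "rpoly t (g + h) = rpoly t g + rpoly t h"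
  by (induction g h rule: poly_induct2) (simp_all add: rpoly_pCons algebra_simps)

lemma rpoly_smult: "rpoly t (smult c g) = of_real c * rpoly t g"
  by (induction g) (simp_all add: rpoly_pCons algebra_simps)

lemma rpoly_minus: "rpoly t (- g) = - rpoly t g"
  using rpoly_smult[of t "- 1" g] by simp

lemma rpoly_mult: "rpoly t (g * h) = rpoly t g * rpoly t h"
  by (induction g) (simp_all add: rpoly_pCons rpoly_add rpoly_smult algebra_simps)

lemma rpoly_1 [simp]: "rpoly t 1 = 1"
  by (simp add: one_pCons rpoly_pCons)

lemma rpoly_power: "rpoly t (g ^ n) = rpoly t g ^ n"
  by (induction n) (simp_all add: rpoly_mult)

lemma place_rpoly:
  fixes t :: "'k::real_field"
  assumes P: "is_place UNIV \<xi>" and t: "\<xi> t = Some b"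
  shows "\<xi> (rpoly t g) = Some (poly g b)"
proof (induction g)
  case (pCons a g)
  show ?case
    using place_add[OF P place_of_real[OF P] place_mult[OF P t pCons.IH]] by (simp add: rpoly_pCons)
qed (simp add: place_0[OF P])

lemma is_subfield_rpoly: "is_subfield {rpoly t A / rpoly t B | A B. rpoly t B \<noteq> 0}"
proof -
  let ?F = "{rpoly t A / rpoly t B | A B. rpoly t B \<noteq> 0}"
  have I: "f \<in> ?F" if "rpoly t B \<noteq> 0" "f = rpoly t A / rpoly t B" for f A B using that by auto
  show ?thesis
    unfolding is_subfield_def
  proof (intro conjI ballI)
    show "0 \<in> ?F" by (rule I[of 1 _ 0]) auto
    show "1 \<in> ?F" by (rule I[of 1 _ 1]) auto
    fix f assume "f \<in> ?F"
    then obtain A B where f: "f = rpoly t A / rpoly t B" "rpoly t B \<noteq> 0" by auto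
    show "- f \<in> ?F"
      by (rule I[of B _ "- A"]) (simp_all add: f rpoly_minus)
    show "inverse f \<in> ?F"
    proof (cases "rpoly t A = 0")
      case True
      then show ?thesis using f \<open>0 \<in> ?F\<close> by simp
    next
      case False
      then show ?thesis by (intro I[of A _ B]) (simp_all add: f)
    qed
    fix g assume "g \<in> ?F"
    then obtain C D where g: "g = rpoly t C / rpoly t D" "rpoly t D \<noteq> 0" by auto
    show "f + g \<in> ?F"
      by (rule I[of "B * D" _ "A * D + C * B"]) (simp_all add: f g add_frac_eq rpoly_add rpoly_mult)
    show "f * g \<in> ?F"
      by (rule I[of "B * D" _ "A * C"]) (simp_all add: f g rpoly_mult)
  qed
qed

lemma Rx_rpoly:
  assumes "f \<in> Rx x i"
  shows "\<exists>A B. f = rpoly (x i) A / rpoly (x i) B \<and> rpoly (x i) B \<noteq> 0"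
proof -
  let ?F = "{rpoly (x i) A / rpoly (x i) B | A B. rpoly (x i) B \<noteq> 0}"
  have "of_real r \<in> ?F" for r
    by (rule CollectI, rule exI[of _ "[:r:]"], rule exI[of _ 1]) (simp add: rpoly_pCons)
  moreover have "x i \<in> ?F"
    by (rule CollectI, rule exI[of _ "[:0,1:]"], rule exI[of _ 1]) (simp add: rpoly_pCons)
  ultimately have "Rx x i \<subseteq> ?F"
    unfolding Rx_def by (intro gen_field_le[OF is_subfield_rpoly]) auto
  then show ?thesis using assms by auto
qed

text \<open>Splitting off the powers of \<open>X - b\<close> from numerator and denominator leaves
  factors with non-zero residues. The two orders at \<open>b\<close> and these residues determine
  the value without reference to the place.\<close>

lemma place_Rx_determined:
  fixes x :: "'v \<Rightarrow> 'k::real_field"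
  assumes f: "f \<in> Rx x i"
  shows "\<exists>v. \<forall>\<xi>. is_place UNIV \<xi> \<longrightarrow> \<xi> (x i) = Some b \<longrightarrow> \<xi> f = v"
proof -
  obtain A B where f: "f = rpoly (x i) A / rpoly (x i) B" and B0: "rpoly (x i) B \<noteq> 0"
    using Rx_rpoly[OF f] by auto
  show ?thesis
  proof (cases "rpoly (x i) A = 0")
    case True
    then show ?thesis using f place_0 by (intro exI[of _ "Some 0"]) auto
  next
    case A0: False
    define y where "y = rpoly (x i) [:- b, 1:]"
    have y: "\<xi> y = Some 0" if "is_place UNIV \<xi>" "\<xi> (x i) = Some b" for \<xi>
      unfolding y_def using place_rpoly[OF that] by simp
    have "A \<noteq> 0" "B \<noteq> 0" using A0 B0 by auto
    then obtain k l A1 B1 where AB: "A = [:- b, 1:] ^ k * A1" "\<not> [:- b, 1:] dvd A1"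
      "B = [:- b, 1:] ^ l * B1" "\<not> [:- b, 1:] dvd B1"
      using order_decomp[of A b] order_decomp[of B b] by blast
    then have nz: "poly A1 b \<noteq> 0" "poly B1 b \<noteq> 0" by (simp_all add: poly_eq_0_iff_dvd)
    let ?u = "rpoly (x i) A1" and ?v = "rpoly (x i) B1"
    have A: "rpoly (x i) A = y ^ k * ?u" and B: "rpoly (x i) B = y ^ l * ?v"
      unfolding AB y_def by (simp_all add: rpoly_mult rpoly_power)
    have ne: "y ^ k \<noteq> 0" "?u \<noteq> 0" "y ^ l \<noteq> 0" "?v \<noteq> 0" using A0 B0 unfolding A B by auto
    have cancel: "a * q * u / (q * v) = a * (u / v)" "inverse (q * v / (a * q * u)) = a * (u / v)"
      if "q \<noteq> 0" for a q u v :: 'k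
      using that by simp_all
    show ?thesis
    proof (cases "l \<le> k")
      case True
      then have "y ^ k = y ^ (k - l) * y ^ l" by (simp flip: power_add)
      then have eq: "f = y ^ (k - l) * (?u / ?v)" unfolding f A B by (simp only: cancel(1)[OF ne(3)])
      \<comment> \<open>\<open>y\<close> has residue zero; equal orders are covered by
        \<open>0 ^ 0 = 1\<close>.\<close>
      have "\<xi> f = Some (0 ^ (k - l) * (poly A1 b / poly B1 b))"
        if "is_place UNIV \<xi>" "\<xi> (x i) = Some b" for \<xi>
        unfolding eq using that nz
        by (intro place_mult place_power place_divide place_rpoly y)
      then show ?thesis by blast
    next
      case False
      then have "y ^ l = y ^ (l - k) * y ^ k" by (simp flip: power_add)
      then have eq: "inverse f = y ^ (l - k) * (?v / ?u)" unfolding f A B by (simp only: cancel(2)[OF ne(1)])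
      have f0: "f \<noteq> 0" unfolding f using A0 B0 by simp
      have "\<xi> f = None" if "is_place UNIV \<xi>" "\<xi> (x i) = Some b" for \<xi>
      proof -
        have "\<xi> (inverse f) = Some (0 ^ (l - k) * (poly B1 b / poly A1 b))"
          unfolding eq using that nz
          by (intro place_mult place_power place_divide place_rpoly y)
        then show ?thesis using False f0 by (intro place_inverse_0[OF that(1)]) (simp_all add: power_0_left)
      qed
      then show ?thesis by blast
    qed
  qed
qed

lemma x_in_Rx: "x i \<in> Rx x i"
  unfolding Rx_def using subset_gen_field by blast

lemma rho_determined:
  assumes "is_place UNIV \<xi>" "is_place UNIV \<xi>'" "\<And>i. \<xi> (x i) = Some (b i)" "\<And>i. \<xi>' (x i) = Some (b i)"
  shows "rho x \<xi> = rho x \<xi>'"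
proof (intro ext)
  fix i a
  show "rho x \<xi> i a = rho x \<xi>' i a"
  proof (cases "a \<in> Rx x i")
    case True
    from place_Rx_determined[OF this, of "b i"] show ?thesis
      using assms by (auto simp: rho_def restr_place_def)
  qed (simp add: rho_def restr_place_def)
qed

lemma restr_place_Mset:
  assumes P: "is_place UNIV \<xi>" and F: "is_subfield F"
  shows "restr_place F \<xi> \<in> Mset F"
proof -
  have "0 \<in> F" "1 \<in> F" "\<And>a b. a \<in> F \<Longrightarrow> b \<in> F \<Longrightarrow> a + b \<in> F \<and> a * b \<in> F"
    "\<And>a. a \<in> F \<Longrightarrow> - a \<in> F \<and> inverse a \<in> F"
    using F by (auto simp: is_subfield_def)
  then have "is_place F (restr_place F \<xi>)"
    using placeD[OF P] unfolding is_place_def restr_place_def by auto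
  then show ?thesis by (simp add: Mset_def restr_place_def)
qed

lemma rho_ProdM:
  assumes "is_place UNIV \<xi>"
  shows "rho x \<xi> \<in> ProdM x"
  unfolding ProdM_def rho_def Rx_def using restr_place_Mset[OF assms is_subfield_gen_field] by auto

section \<open>Basic neighbourhoods in the space of places\<close>

lemma Hsub_1: "Hsub F 1 = Mset F"
  by (auto simp: Hsub_def Mset_def is_place_def)

lemma topspace_Mtop:
  fixes F :: "'k::field set"
  assumes "1 \<in> F"
  shows "topspace (Mtop F) = Mset F"
proof -
  have "Mset F \<subseteq> topspace (topology_generated_by {Hsub F b | b. b \<in> F})"
    using assms Hsub_1[of F] by (force simp: topology_generated_by_topspace)
  then show ?thesis by (auto simp: Mtop_def)
qed

lemma Mtop_basic_nbhd:
  assumes "generate_topology_on {Hsub F b | b. b \<in> F} U" "\<zeta> \<in> U" "\<zeta> \<in> Mset F"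
  shows "\<exists>fs. finite fs \<and> \<zeta> \<in> basic_open F fs \<and> basic_open F fs \<subseteq> U"
  using assms(1,2)
proof (induction rule: generate_topology_on.induct)
  case (Int a b)
  then obtain fs gs where "finite fs" "\<zeta> \<in> basic_open F fs" "basic_open F fs \<subseteq> a"
    "finite gs" "\<zeta> \<in> basic_open F gs" "basic_open F gs \<subseteq> b" by auto
  moreover have "basic_open F (fs \<union> gs) = basic_open F fs \<inter> basic_open F gs"
    by (auto simp: basic_open_def)
  ultimately show ?case by (intro exI[of _ "fs \<union> gs"]) auto
next
  case (UN K)
  then obtain k where "k \<in> K" "\<zeta> \<in> k" by auto
  with UN obtain fs where "finite fs" "\<zeta> \<in> basic_open F fs" "basic_open F fs \<subseteq> k" by metis
  then show ?case using \<open>k \<in> K\<close> by (intro exI[of _ fs]) auto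
next
  case (Basis s)
  then obtain b where b: "s = Hsub F b" by auto
  have "\<zeta> \<in> basic_open F {b}" "basic_open F {b} \<subseteq> s"
    using Basis assms(3) unfolding b basic_open_def by auto
  then show ?case by (intro exI[of _ "{b}"]) simp
qed simp

theorem theorem7p3:
  fixes x :: "'n::finite \<Rightarrow> 'k::real_field"
    and \<iota> :: "('n \<Rightarrow> 'k \<Rightarrow> real option) \<Rightarrow> ('k \<Rightarrow> real option)"
  assumes indep: "alg_indep x"
    and gen: "gen_field (range of_real \<union> range x) = (UNIV :: 'k set)"
    and emb: "compatible_embedding x \<iota>"
  shows "Mtop UNIV closure_of (\<iota> ` ProdM x) = topspace (Mtop UNIV) \<and>
         (CARD('n) > 1 \<longrightarrow>
            (\<forall>fs :: 'k set. finite fs \<and> 0 \<notin> fs \<and> basic_open UNIV fs \<noteq> {} \<longrightarrow>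
               infinite (basic_open UNIV fs - \<iota> ` ProdM x)))"
proof -
  note gx = generic_alg_indep[OF indep]
  note fx = fractions_eq_UNIV[OF gen]
  have \<iota>: "is_place UNIV (\<iota> p)" "rho x (\<iota> p) = p" if "p \<in> ProdM x" for p
    using emb that by (auto simp: compatible_embedding_def Mset_def)
  have centre_image: "\<exists>\<xi>\<in>\<iota> ` ProdM x. is_place UNIV \<xi> \<and> (\<forall>i. \<xi> (x i) = Some (b i))" for b
  proof -
    obtain \<xi> where P: "is_place UNIV \<xi>" and c: "\<And>i. \<xi> (x i) = Some (b i)"
      \<comment> \<open>Equal indices and \<open>c = 0\<close> impose no slope condition, so this
        also covers a single variable.\<close>
      using place_with_slope[OF gx fx, of undefined undefined 0 b] by auto
    have p: "rho x \<xi> \<in> ProdM x" by (rule rho_ProdM[OF P])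
    have "\<iota> (rho x \<xi>) (x i) = rho x (\<iota> (rho x \<xi>)) i (x i)" for i
      by (simp add: rho_def restr_place_def x_in_Rx)
    also have "\<dots> i = Some (b i)" for i
      unfolding \<iota>(2)[OF p] by (simp add: rho_def restr_place_def x_in_Rx c)
    finally show ?thesis using \<iota>(1)[OF p] p by blast
  qed
  have "\<zeta> \<in> Mtop UNIV closure_of (\<iota> ` ProdM x)" if \<zeta>: "\<zeta> \<in> Mset UNIV" for \<zeta>
    unfolding in_closure_of topspace_Mtop[OF UNIV_I]
  proof (intro conjI allI impI \<zeta>)
    fix W assume W: "\<zeta> \<in> W \<and> openin (Mtop UNIV) W"
    then obtain U where U: "generate_topology_on {Hsub UNIV b | b::'k. b \<in> UNIV} U" "W = U \<inter> Mset UNIV"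
      by (auto simp: Mtop_def openin_subtopology openin_topology_generated_by_iff)
    then obtain fs where fs: "finite fs" "\<zeta> \<in> basic_open UNIV fs" "basic_open UNIV fs \<subseteq> U"
      using Mtop_basic_nbhd[OF U(1) _ \<zeta>] W by auto
    obtain b where b: "\<And>\<xi>. is_place UNIV \<xi> \<Longrightarrow> \<forall>i. \<xi> (x i) = Some (b i) \<Longrightarrow> \<xi> \<in> basic_open UNIV fs"
      using ex_center[OF fx fs(1,2)] by auto
    obtain \<xi> where \<xi>: "\<xi> \<in> \<iota> ` ProdM x" "is_place UNIV \<xi>" "\<forall>i. \<xi> (x i) = Some (b i)"
      using centre_image[of b] by auto
    have "\<xi> \<in> W" using b[OF \<xi>(2,3)] fs(3) U(2) by (auto simp: basic_open_def)
    then show "\<exists>y. y \<in> \<iota> ` ProdM x \<and> y \<in> W" using \<xi>(1) by blast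
  qed
  then have dense: "Mtop UNIV closure_of (\<iota> ` ProdM x) = topspace (Mtop UNIV)"
    using closure_of_subset_topspace[of "Mtop UNIV"] unfolding topspace_Mtop[OF UNIV_I] by blast
  moreover have "infinite (basic_open UNIV fs - \<iota> ` ProdM x)"
    if card: "CARD('n) > 1" and fin: "finite fs" and ne: "basic_open UNIV fs \<noteq> {}" for fs :: "'k set"
  proof -
    obtain j k :: 'n where jk: "j \<noteq> k"
      using card by (metis card_le_Suc0_iff_eq finite not_less UNIV_I One_nat_def)
    obtain \<zeta> where "\<zeta> \<in> basic_open UNIV fs" using ne by auto
    from ex_center[OF fx fin this]
    obtain b where b: "\<And>\<xi>. is_place UNIV \<xi> \<Longrightarrow> \<forall>i. \<xi> (x i) = Some (b i) \<Longrightarrow> \<xi> \<in> basic_open UNIV fs"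
      by auto
    let ?slope = "(x j - of_real (b j)) / (x k - of_real (b k))"
    have "\<exists>\<xi>. is_place UNIV \<xi> \<and> (\<forall>i. \<xi> (x i) = Some (b i)) \<and> \<xi> ?slope = Some c" for c
      using place_with_slope[OF gx fx disjI1[OF jk], of b c] jk by simp
    then obtain \<xi> where \<xi>: "\<And>c. is_place UNIV (\<xi> c)" "\<And>c i. \<xi> c (x i) = Some (b i)" "\<And>c. \<xi> c ?slope = Some c"
      by metis
    \<comment> \<open>The value at \<open>?slope\<close> recovers \<open>c\<close>, so there are as
      many of these places as real numbers.\<close>
    have "inj \<xi>" by (rule injI) (metis \<xi>(3) option.inject)
    then have inf: "infinite (range \<xi>)" using finite_imageD infinite_UNIV_char_0 by blast
    have sub: "range \<xi> \<inter> \<iota> ` ProdM x \<subseteq> {\<iota> (rho x (\<xi> 0))}"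
    proof
      fix \<eta> assume "\<eta> \<in> range \<xi> \<inter> \<iota> ` ProdM x"
      then obtain c where "\<eta> = \<xi> c" "\<eta> \<in> \<iota> ` ProdM x" by auto
      then obtain p where *: "\<eta> = \<xi> c" "\<eta> = \<iota> p" "p \<in> ProdM x" by auto
      have "p = rho x (\<xi> c)" using \<iota>(2)[OF *(3)] *(1,2) by simp
      also have "\<dots> = rho x (\<xi> 0)" by (rule rho_determined) (rule \<xi>)+
      finally show "\<eta> \<in> {\<iota> (rho x (\<xi> 0))}" using *(2) by simp
    qed
    have "infinite (range \<xi> - \<iota> ` ProdM x)"
      using inf Un_Diff_Int[of "range \<xi>" "\<iota> ` ProdM x"] finite_subset[OF sub] by (metis finite.intros finite_Un)
    moreover have "range \<xi> \<subseteq> basic_open UNIV fs" using b \<xi>(1,2) by auto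
    ultimately show ?thesis using finite_subset[OF Diff_mono[OF _ order_refl]] by blast
  qed
  ultimately show ?thesis by simp
qed

end
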